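(* Let $k$ be a field, $m\ge 2$ an integer, and $b\in k^\times$. Let $G=\langle\sigma\rangle$ be a cyclic group of order $m$. Consider the projective space $X=\mathbb{P}^{m-1}_k$ with homogeneous coordinates $x_0,\ldots,x_{m-1}$, equipped with the $G$-action defined by $$\sigma(x_i)=x_{i+1}\ \text{ for } 0\le i\le m-2,\qquad \sigma(x_{m-1})=b\,x_0.$$ Then $\beta(X\circlearrowleft G)=0$ if and only if $b\in k^{\times m}$. Moreover, for $n\geq 2$, $\mathrm{Am}^n(X\circlearrowleft G,\mathbb{G}_m)=0$ if $n$ is odd, and $\mathrm{Am}^n(X\circlearrowleft G,\mathbb{G}_m)$ is isomorphic to the subgroup generated by (the class of) $b$ in $k^\times/k^{\times m}$ if $n$ is even.
   Context: $G$ acts on $X$ by $k$-automorphisms, and $G$ acts trivially on $k^\times$. For a finite group $G$ and a smooth irreducible $G$-variety $X$ over $k$ with $k[X]^\times=k^\times$, the $G$-equivariant exact sequence $$1\to k^\times\to k(X)^\times\xrightarrow{\mathrm{div}}\mathrm{Div}(X)\to\mathrm{Pic}(X)\to 0$$ induces, for all $n\ge2$, double connecting homomorphisms $\partial^n\colon H^{n-2}(G,\mathrm{Pic}(X))\to H^n(G,k^\times)$, and $\mathrm{Am}^n(X\circlearrowleft G,\mathbb{G}_m):=\mathrm{Im}(\partial^n)$ ($\mathbb{G}_m$ with trivial $G$-action). If $\mathrm{Pic}(X)$ is $\mathbb{Z}$-free and finitely generated, let $T_{\mathrm{NS}}$ be the $k$-split torus with $G$-action whose character lattice is $\mathrm{Pic}(X)$;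 thus $T_{\mathrm{NS}}(k)=\mathrm{Hom}(\mathrm{Pic}(X),k^\times)=k^\times\otimes\mathrm{Pic}(X)^\vee$. Tensoring the exact sequence $1\to k^\times\to k(X)^\times\xrightarrow{\mathrm{div}}\mathrm{Div}(X)\to\mathrm{Pic}(X)\to 0$ with $\mathrm{Pic}(X)^\vee$ yields a double connecting homomorphism $$\partial^2\colon\mathrm{End}(\mathrm{Pic}(X))^G=(\mathrm{Pic}(X)\otimes\mathrm{Pic}(X)^\vee)^G\to H^2(G,T_{\mathrm{NS}}(k)),$$ and the $G$-equivariant universal torsor obstruction is $\beta(X\circlearrowleft G):=\partial^2(\mathrm{Id}_{\mathrm{Pic}(X)})\in H^2(G,T_{\mathrm{NS}}(k))$. *)

theory Defs
  imports
    "HOL-Algebra.Free_Abelian_Groups"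
    "HOL-Algebra.Elementary_Groups"
    "HOL-Algebra.Ideal"
    "HOL-Computational_Algebra.Fraction_Field"
begin

section \<open>Group cohomology via inhomogeneous cochains\<close>

text \<open>A \<open>G\<close>-module is an abelian group, written multiplicatively, together with an action
  of \<open>G\<close> by automorphisms; the record only holds the data.\<close>

record ('a, 'g) gmodule = "'a monoid" +
  act :: "'g \<Rightarrow> 'a \<Rightarrow> 'a"

definition tuples :: "('g, 'x) monoid_scheme \<Rightarrow> nat \<Rightarrow> 'g list set" where
  "tuples G n = {gs. length gs = n \<and> set gs \<subseteq> carrier G}"

definition cochain_group ::
  "('g, 'x) monoid_scheme \<Rightarrow> ('a, 'g) gmodule \<Rightarrow> nat \<Rightarrow> ('g list \<Rightarrow> 'a) monoid" where
  "cochain_group G M n =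
     \<lparr>carrier = tuples G n \<rightarrow>\<^sub>E carrier M,
      monoid.mult = (\<lambda>f h. \<lambda>gs\<in>tuples G n. f gs \<otimes>\<^bsub>M\<^esub> h gs),
      one = (\<lambda>gs\<in>tuples G n. \<one>\<^bsub>M\<^esub>)\<rparr>"

text \<open>\<open>merge_at G i [g\<^sub>1, \<dots>]\<close> replaces the two consecutive entries \<open>g\<^sub>i, g\<^sub>i\<^sub>+\<^sub>1\<close>
  (counting from 1) by their product.\<close>

definition merge_at :: "('g, 'x) monoid_scheme \<Rightarrow> nat \<Rightarrow> 'g list \<Rightarrow> 'g list" where
  "merge_at G i gs = take (i - 1) gs @ [gs ! (i - 1) \<otimes>\<^bsub>G\<^esub> gs ! i] @ drop (i + 1) gs"

text \<open>The differential from \<open>n\<close>-cochains to \<open>(n + 1)\<close>-cochains.\<close>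

definition coboundary ::
  "('g, 'x) monoid_scheme \<Rightarrow> ('a, 'g) gmodule \<Rightarrow> nat \<Rightarrow> ('g list \<Rightarrow> 'a) \<Rightarrow> 'g list \<Rightarrow> 'a" where
  "coboundary G M n f = (\<lambda>gs\<in>tuples G (n + 1).
     act M (hd gs) (f (tl gs))
     \<otimes>\<^bsub>M\<^esub> finprod M (\<lambda>i. f (merge_at G i gs) [^]\<^bsub>M\<^esub> ((- 1) ^ i :: int)) {1..n}
     \<otimes>\<^bsub>M\<^esub> f (butlast gs) [^]\<^bsub>M\<^esub> ((- 1) ^ (n + 1) :: int))"

definition cocycles ::
  "('g, 'x) monoid_scheme \<Rightarrow> ('a, 'g) gmodule \<Rightarrow> nat \<Rightarrow> ('g list \<Rightarrow> 'a) set" where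
  "cocycles G M n =
     {f \<in> carrier (cochain_group G M n). coboundary G M n f = \<one>\<^bsub>cochain_group G M (n + 1)\<^esub>}"

definition coboundaries ::
  "('g, 'x) monoid_scheme \<Rightarrow> ('a, 'g) gmodule \<Rightarrow> nat \<Rightarrow> ('g list \<Rightarrow> 'a) set" where
  "coboundaries G M n =
     (case n of 0 \<Rightarrow> {\<one>\<^bsub>cochain_group G M 0\<^esub>}
      | Suc j \<Rightarrow> coboundary G M j ` carrier (cochain_group G M j))"

definition cohomology ::
  "('g, 'x) monoid_scheme \<Rightarrow> ('a, 'g) gmodule \<Rightarrow> nat \<Rightarrow> ('g list \<Rightarrow> 'a) set monoid" where
  "cohomology G M n = (cochain_group G M n)\<lparr>carrier := cocycles G M n\<rparr> Mod coboundaries G M n"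

definition cohomology_class ::
  "('g, 'x) monoid_scheme \<Rightarrow> ('a, 'g) gmodule \<Rightarrow> nat \<Rightarrow> ('g list \<Rightarrow> 'a) \<Rightarrow> ('g list \<Rightarrow> 'a) set" where
  "cohomology_class G M n f = coboundaries G M n #>\<^bsub>cochain_group G M n\<^esub> f"

section \<open>Connecting homomorphisms\<close>

text \<open>The connecting homomorphism \<open>H\<^sup>n(G, C) \<rightarrow> H\<^sup>n\<^sup>+\<^sup>1(G, A)\<close> of a short exact sequence
  \<open>1 \<rightarrow> A \<rightarrow> B \<rightarrow> C \<rightarrow> 1\<close> with maps \<open>i\<close> and \<open>p\<close>: lift a cocycle \<open>c\<close> to a cochain \<open>f\<close> of \<open>B\<close>
  and take the class of the cocycle \<open>a\<close> of \<open>A\<close> with \<open>i \<circ> a = d f\<close>.\<close>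

definition connecting ::
  "('g, 'x) monoid_scheme \<Rightarrow> ('a, 'g) gmodule \<Rightarrow> ('a \<Rightarrow> 'b) \<Rightarrow> ('b, 'g) gmodule \<Rightarrow>
   ('b \<Rightarrow> 'c) \<Rightarrow> nat \<Rightarrow> ('g list \<Rightarrow> 'c) set \<Rightarrow> ('g list \<Rightarrow> 'a) set" where
  "connecting G A i B p n Z =
     (THE W. W \<in> carrier (cohomology G A (n + 1)) \<and>
        (\<exists>c\<in>Z. \<exists>a\<in>W. \<exists>f\<in>carrier (cochain_group G B n).
           (\<forall>gs\<in>tuples G n. p (f gs) = c gs) \<and>
           (\<forall>gs\<in>tuples G (n + 1). i (a gs) = coboundary G B n f gs)))"

text \<open>The double connecting homomorphism \<open>H\<^sup>n(G, D) \<rightarrow> H\<^sup>n\<^sup>+\<^sup>2(G, A)\<close> of an exact sequence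
  \<open>1 \<rightarrow> A \<rightarrow> B \<rightarrow> C \<rightarrow> D \<rightarrow> 1\<close> with maps \<open>i\<close>, \<open>p\<close>, \<open>q\<close>, obtained by splitting it at the
  image of \<open>p\<close>.\<close>

definition double_connecting ::
  "('g, 'x) monoid_scheme \<Rightarrow> ('a, 'g) gmodule \<Rightarrow> ('a \<Rightarrow> 'b) \<Rightarrow> ('b, 'g) gmodule \<Rightarrow>
   ('b \<Rightarrow> 'c) \<Rightarrow> ('c, 'g) gmodule \<Rightarrow> ('c \<Rightarrow> 'd) \<Rightarrow> nat \<Rightarrow>
   ('g list \<Rightarrow> 'd) set \<Rightarrow> ('g list \<Rightarrow> 'a) set" where
  "double_connecting G A i B p C q n Z =
     connecting G A i B p (n + 1)
       (connecting G (C\<lparr>carrier := p ` carrier B\<rparr>) (\<lambda>x. x) C q n Z)"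

text \<open>\<open>hom_module G P M\<close> is \<open>Hom(P, M)\<close> with \<open>(g \<phi>)(x) = g \<phi>(g\<inverse> x)\<close>.\<close>

definition hom_module ::
  "('g, 'x) monoid_scheme \<Rightarrow> ('p, 'g) gmodule \<Rightarrow> ('a, 'g) gmodule \<Rightarrow> ('p \<Rightarrow> 'a, 'g) gmodule" where
  "hom_module G P M =
     \<lparr>carrier = hom P M \<inter> extensional (carrier P),
      monoid.mult = (\<lambda>\<phi> \<psi>. \<lambda>x\<in>carrier P. \<phi> x \<otimes>\<^bsub>M\<^esub> \<psi> x),
      one = (\<lambda>x\<in>carrier P. \<one>\<^bsub>M\<^esub>),
      act = (\<lambda>g \<phi>. \<lambda>x\<in>carrier P. act M g (\<phi> (act P (inv\<^bsub>G\<^esub> g) x)))\<rparr>"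

text \<open>In the next two definitions \<open>A \<rightarrow> B \<rightarrow> C \<rightarrow> D\<close> stands for
  \<open>k\<^sup>\<times> \<rightarrow> k(X)\<^sup>\<times> \<rightarrow> Div(X) \<rightarrow> Pic(X)\<close>.\<close>

definition Am_group ::
  "('g, 'x) monoid_scheme \<Rightarrow> ('a, 'g) gmodule \<Rightarrow> ('a \<Rightarrow> 'b) \<Rightarrow> ('b, 'g) gmodule \<Rightarrow>
   ('b \<Rightarrow> 'c) \<Rightarrow> ('c, 'g) gmodule \<Rightarrow> ('c \<Rightarrow> 'd) \<Rightarrow> ('d, 'g) gmodule \<Rightarrow> nat \<Rightarrow>
   ('g list \<Rightarrow> 'a) set monoid" where
  "Am_group G A i B p C q D n =
     (cohomology G A n)\<lparr>carrier :=
        double_connecting G A i B p C q (n - 2) ` carrier (cohomology G D (n - 2))\<rparr>"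

text \<open>For \<open>D\<close> free of finite rank, \<open>M \<otimes> D\<^sup>\<or>\<close> is \<open>Hom(D, M)\<close>; so the sequence tensored with
  \<open>D\<^sup>\<or>\<close> is \<open>Hom(D, A) \<rightarrow> Hom(D, B) \<rightarrow> Hom(D, C) \<rightarrow> End(D)\<close>, the maps being composition with
  \<open>i\<close>, \<open>p\<close>, \<open>q\<close>, and \<open>Hom(D, A) = T\<^sub>N\<^sub>S(k)\<close>. The identity of \<open>D\<close> is regarded as a 0-cocycle.\<close>

definition torsor_obstruction ::
  "('g, 'x) monoid_scheme \<Rightarrow> ('a, 'g) gmodule \<Rightarrow> ('a \<Rightarrow> 'b) \<Rightarrow> ('b, 'g) gmodule \<Rightarrow>
   ('b \<Rightarrow> 'c) \<Rightarrow> ('c, 'g) gmodule \<Rightarrow> ('c \<Rightarrow> 'd) \<Rightarrow> ('d, 'g) gmodule \<Rightarrow>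
   ('g list \<Rightarrow> ('d \<Rightarrow> 'a)) set" where
  "torsor_obstruction G A i B p C q D =
     double_connecting G
       (hom_module G D A) (compose (carrier D) i)
       (hom_module G D B) (compose (carrier D) p)
       (hom_module G D C) (compose (carrier D) q) 0
       (cohomology_class G (hom_module G D D) 0 (\<lambda>gs\<in>tuples G 0. \<lambda>x\<in>carrier D. x))"

section \<open>Projective space\<close>

text \<open>\<open>poly_carrier m\<close> is \<open>k[x\<^sub>0, \<dots>, x\<^sub>m\<^sub>-\<^sub>1]\<close> inside the polynomials in countably many
  variables: a polynomial maps exponent vectors to coefficients.\<close>

type_synonym 'k mpoly = "(nat \<Rightarrow>\<^sub>0 nat) \<Rightarrow>\<^sub>0 'k"

definition Const :: "'k::zero \<Rightarrow> 'k mpoly" where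
  "Const c = Poly_Mapping.single 0 c"

definition Var :: "nat \<Rightarrow> 'k::zero_neq_one mpoly" where
  "Var i = Poly_Mapping.single (Poly_Mapping.single i 1) 1"

definition poly_carrier :: "nat \<Rightarrow> 'k::zero mpoly set" where
  "poly_carrier m = {p. \<forall>t\<in>Poly_Mapping.keys p. Poly_Mapping.keys t \<subseteq> {..<m}}"

definition poly_ring :: "nat \<Rightarrow> 'k::field mpoly ring" where
  "poly_ring m = \<lparr>carrier = poly_carrier m, monoid.mult = (*), one = 1, ring.zero = 0, add = (+)\<rparr>"

definition homogeneous :: "nat \<Rightarrow> 'k::zero mpoly \<Rightarrow> bool" where
  "homogeneous d p \<longleftrightarrow> (\<forall>t\<in>Poly_Mapping.keys p. (\<Sum>i\<in>Poly_Mapping.keys t. Poly_Mapping.lookup t i) = d)"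

text \<open>Points of \<open>\<P>\<^sup>m\<^sup>-\<^sup>1 = Proj k[x\<^sub>0, \<dots>, x\<^sub>m\<^sub>-\<^sub>1]\<close>: homogeneous prime ideals (ideals generated
  by homogeneous elements) that do not contain all the variables.\<close>

definition proj_points :: "nat \<Rightarrow> 'k::field mpoly set set" where
  "proj_points m =
     {P. primeideal P (poly_ring m) \<and>
         genideal (poly_ring m) {p \<in> P. \<exists>d. homogeneous d p} = P \<and>
         \<not> Var ` {..<m} \<subseteq> P}"

text \<open>A prime divisor is represented by its generic point, a point of codimension one.\<close>

definition prime_divisors :: "nat \<Rightarrow> 'k::field mpoly set set" where
  "prime_divisors m =
     {P \<in> proj_points m. P \<noteq> {0} \<and> (\<forall>Q\<in>proj_points m. Q \<subseteq> P \<longrightarrow> Q = {0} \<or> Q = P)}"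

definition function_field :: "nat \<Rightarrow> 'k::field mpoly fract set" where
  "function_field m =
     {Fract p q | p q d. p \<in> poly_carrier m \<and> q \<in> poly_carrier m \<and>
        homogeneous d p \<and> homogeneous d q \<and> q \<noteq> 0}"

definition local_ring :: "nat \<Rightarrow> 'k::field mpoly set \<Rightarrow> 'k mpoly fract set" where
  "local_ring m P =
     {Fract p q | p q d. p \<in> poly_carrier m \<and> q \<in> poly_carrier m - P \<and>
        homogeneous d p \<and> homogeneous d q}"

definition local_max :: "nat \<Rightarrow> 'k::field mpoly set \<Rightarrow> 'k mpoly fract set" where
  "local_max m P =
     {Fract p q | p q d. p \<in> P \<and> q \<in> poly_carrier m - P \<and>
        homogeneous d p \<and> homogeneous d q}"

text \<open>The valuation of the discrete valuation ring \<open>local_ring m P\<close>: \<open>ord(u t\<^sup>n) = n\<close> for a unit \<open>u\<close>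
  and a uniformizer \<open>t\<close>.\<close>

definition ord_at :: "nat \<Rightarrow> 'k::field mpoly set \<Rightarrow> 'k mpoly fract \<Rightarrow> int" where
  "ord_at m P f =
     (THE n. \<exists>t u. local_max m P = (\<lambda>h. t * h) ` local_ring m P \<and>
        u \<in> local_ring m P - local_max m P \<and> f = u * t powi n)"

definition divisor_of ::
  "nat \<Rightarrow> 'k::field mpoly fract \<Rightarrow> ('k mpoly set \<Rightarrow>\<^sub>0 int)" where
  "divisor_of m f = Abs_poly_mapping (\<lambda>P. if P \<in> prime_divisors m then ord_at m P f else 0)"

section \<open>The action of the cyclic group\<close>

definition poly_subst :: "(nat \<Rightarrow> 'k mpoly) \<Rightarrow> 'k::field mpoly \<Rightarrow> 'k mpoly" where
  "poly_subst s p = (\<Sum>t\<in>Poly_Mapping.keys p. Const (Poly_Mapping.lookup p t) * (\<Prod>i\<in>Poly_Mapping.keys t. s i ^ Poly_Mapping.lookup t i))"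

definition sigma_poly :: "nat \<Rightarrow> 'k::field \<Rightarrow> 'k mpoly \<Rightarrow> 'k mpoly" where
  "sigma_poly m b = poly_subst (\<lambda>i. if i < m - 1 then Var (i + 1) else Const b * Var 0)"

text \<open>The substitution \<open>sigma_poly m b\<close> has infinite order in general, but its \<open>m\<close>-th power
  multiplies forms of degree \<open>d\<close> by \<open>b\<^sup>d\<close> and so is trivial on \<open>\<P>\<^sup>m\<^sup>-\<^sup>1\<close>. Hence for a cyclic
  group of order \<open>m\<close> with generator \<open>\<sigma>\<close> any exponent \<open>i\<close> with \<open>g = \<sigma>\<^sup>i\<close> gives the same action
  of \<open>g\<close> on points and rational functions.\<close>

definition act_poly ::
  "('g, 'x) monoid_scheme \<Rightarrow> 'g \<Rightarrow> nat \<Rightarrow> 'k::field \<Rightarrow> 'g \<Rightarrow> 'k mpoly \<Rightarrow> 'k mpoly" where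
  "act_poly G \<sigma> m b g = sigma_poly m b ^^ (LEAST i. \<sigma> [^]\<^bsub>G\<^esub> (i::nat) = g)"

definition act_fract ::
  "('g, 'x) monoid_scheme \<Rightarrow> 'g \<Rightarrow> nat \<Rightarrow> 'k::field \<Rightarrow> 'g \<Rightarrow> 'k mpoly fract \<Rightarrow> 'k mpoly fract" where
  "act_fract G \<sigma> m b g f =
     (THE h. \<exists>p\<in>poly_carrier m. \<exists>q\<in>poly_carrier m. q \<noteq> 0 \<and> f = Fract p q \<and>
        h = Fract (act_poly G \<sigma> m b g p) (act_poly G \<sigma> m b g q))"

definition act_divisor ::
  "('g, 'x) monoid_scheme \<Rightarrow> 'g \<Rightarrow> nat \<Rightarrow> 'k::field \<Rightarrow> 'g \<Rightarrow>
   ('k mpoly set \<Rightarrow>\<^sub>0 int) \<Rightarrow> ('k mpoly set \<Rightarrow>\<^sub>0 int)" where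
  "act_divisor G \<sigma> m b g = frag_extend (\<lambda>P. frag_of (act_poly G \<sigma> m b g ` P))"

section \<open>The equivariant exact sequence of projective space\<close>

definition const_units :: "('k::field, 'g) gmodule" where
  "const_units = \<lparr>carrier = - {0}, monoid.mult = (*), one = 1, act = (\<lambda>g c. c)\<rparr>"

definition rational_units ::
  "('g, 'x) monoid_scheme \<Rightarrow> 'g \<Rightarrow> nat \<Rightarrow> 'k::field \<Rightarrow> ('k mpoly fract, 'g) gmodule" where
  "rational_units G \<sigma> m b =
     \<lparr>carrier = function_field m - {0}, monoid.mult = (*), one = 1, act = act_fract G \<sigma> m b\<rparr>"

definition Div ::
  "('g, 'x) monoid_scheme \<Rightarrow> 'g \<Rightarrow> nat \<Rightarrow> 'k::field \<Rightarrow> ('k mpoly set \<Rightarrow>\<^sub>0 int, 'g) gmodule" where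
  "Div G \<sigma> m b =
     monoid.extend (free_Abelian_group (prime_divisors m)) \<lparr>act = act_divisor G \<sigma> m b\<rparr>"

definition principal_divisors :: "nat \<Rightarrow> ('k::field mpoly set \<Rightarrow>\<^sub>0 int) set" where
  "principal_divisors m = divisor_of m ` (function_field m - {0})"

definition divisor_class ::
  "nat \<Rightarrow> ('k::field mpoly set \<Rightarrow>\<^sub>0 int) \<Rightarrow> ('k mpoly set \<Rightarrow>\<^sub>0 int) set" where
  "divisor_class m D = principal_divisors m #>\<^bsub>free_Abelian_group (prime_divisors m)\<^esub> D"

definition Pic ::
  "('g, 'x) monoid_scheme \<Rightarrow> 'g \<Rightarrow> nat \<Rightarrow> 'k::field \<Rightarrow> (('k mpoly set \<Rightarrow>\<^sub>0 int) set, 'g) gmodule" where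
  "Pic G \<sigma> m b =
     monoid.extend (free_Abelian_group (prime_divisors m) Mod principal_divisors m)
       \<lparr>act = (\<lambda>g C. act_divisor G \<sigma> m b g ` C)\<rparr>"

definition Am_proj ::
  "('g, 'x) monoid_scheme \<Rightarrow> 'g \<Rightarrow> nat \<Rightarrow> 'k::field \<Rightarrow> nat \<Rightarrow> ('g list \<Rightarrow> 'k) set monoid" where
  "Am_proj G \<sigma> m b n =
     Am_group G const_units (\<lambda>c. Fract (Const c) 1) (rational_units G \<sigma> m b) (divisor_of m)
       (Div G \<sigma> m b) (divisor_class m) (Pic G \<sigma> m b) n"

definition T_NS ::
  "('g, 'x) monoid_scheme \<Rightarrow> 'g \<Rightarrow> nat \<Rightarrow> 'k::field \<Rightarrow>
   (('k mpoly set \<Rightarrow>\<^sub>0 int) set \<Rightarrow> 'k, 'g) gmodule" where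
  "T_NS G \<sigma> m b = hom_module G (Pic G \<sigma> m b) const_units"

definition beta_proj ::
  "('g, 'x) monoid_scheme \<Rightarrow> 'g \<Rightarrow> nat \<Rightarrow> 'k::field \<Rightarrow>
   ('g list \<Rightarrow> (('k mpoly set \<Rightarrow>\<^sub>0 int) set \<Rightarrow> 'k)) set" where
  "beta_proj G \<sigma> m b =
     torsor_obstruction G const_units (\<lambda>c. Fract (Const c) 1) (rational_units G \<sigma> m b)
       (divisor_of m) (Div G \<sigma> m b) (divisor_class m) (Pic G \<sigma> m b)"

section \<open>Power classes\<close>

definition units_group :: "'k::field monoid" where
  "units_group = \<lparr>carrier = - {0}, monoid.mult = (*), one = 1\<rparr>"

definition unit_powers :: "nat \<Rightarrow> 'k::field set" where
  "unit_powers m = (\<lambda>c. c ^ m) ` (- {0})"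

end

theory Submission
  imports Defs "HOL-Algebra.Multiplicative_Group" "HOL-Computational_Algebra.Polynomial"
begin

text \<open>Since \<open>k[x\<^sub>0, \<dots>, x\<^sub>m\<^sub>-\<^sub>1]\<close> is factorial, prime divisors of the projective space correspond
  to prime forms up to scalars, so \<open>Pic\<close> is infinite cyclic with trivial action, generated by the class
  of the hyperplane \<open>H = (x\<^sub>0)\<close>. The functions \<open>u(g) = g x\<^sub>0 / x\<^sub>0\<close> satisfy \<open>div u(g) = g H - H\<close>, and the
  coboundary of \<open>u\<close> is \<open>b\<close> raised to the carry cocycle: the carry of the addition of exponents of
  \<open>\<sigma>\<close> modulo \<open>m\<close>. Cup product with the carry cocycle is the periodicity of the cohomology of the cyclic
  group, so in even degrees the double connecting homomorphism sends the generator of \<open>H\<^sup>n\<^sup>-\<^sup>2(G, Pic)\<close>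
  to the class of \<open>b\<close> in \<open>k\<^sup>\<times>/k\<^sup>\<times>\<^sup>m\<close>, and \<open>H\<^sup>n\<^sup>-\<^sup>2(G, Pic) = 0\<close> in odd degrees. Applying
  \<open>Hom(Pic, -)\<close> to the sequence gives the same formula for the universal torsor obstruction.\<close>

text \<open>The constant \<open>b\<close> enters because the substitution has order \<open>m\<close>
  only up to scalars: its \<open>m\<close>-th power multiplies forms of degree \<open>d\<close> by
  \<open>b^d\<close>, so \<open>g (h x_0)\<close> and \<open>(g h) x_0\<close> differ by a factor
  \<open>b\<close> exactly when the exponents wrap around. The connecting maps are definite
  descriptions over cochains, so a value is obtained by exhibiting lifts and checking independence
  of all choices; this is why cohomology is computed with explicit cochains. Periodicity is
  accordingly a statement about cochains: \<open>slant\<close> lowers the degree by two, cup product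
  with the carry raises it by two, and every cocycle is, up to a coboundary, the carry cupped with
  its slant. In odd degrees this descends to homomorphisms from a finite group to the torsion-free
  group \<open>Pic\<close>, which vanish. Factoriality is proved by induction on the number of
  variables, with pseudo-division in place of a fraction field. Points, valuations and divisor
  classes are then all translated into multiplicities and degrees of forms. The isomorphism in even
  degrees comes from comparing two images of the integers with the same kernel.\<close>

hide_const (open) Polynomial.order Poly_Mapping.degree

section \<open>Inhomogeneous cochains\<close>

lemma tuples_0 [simp]: "gs \<in> tuples G 0 \<longleftrightarrow> gs = []"
  by (auto simp: tuples_def)

lemma Nil_in_tuples [simp]: "[] \<in> tuples G n \<longleftrightarrow> n = 0"
  by (auto simp: tuples_def)

lemma Cons_in_tuples [simp]:
  "g # gs \<in> tuples G n \<longleftrightarrow> (\<exists>j. n = Suc j \<and> g \<in> carrier G \<and> gs \<in> tuples G j)"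
  by (auto simp: tuples_def)

lemma tuples_SucE:
  assumes "gs \<in> tuples G (Suc n)"
  obtains g hs where "gs = g # hs" "g \<in> carrier G" "hs \<in> tuples G n"
  using assms by (cases gs) auto

context comm_group
begin

lemma subgroup_imp_comm_group: "subgroup H G \<Longrightarrow> comm_group (G\<lparr>carrier := H\<rparr>)"
  by (rule group.group_comm_groupI[OF subgroup_imp_group]) (auto simp: subgroup.mem_carrier m_comm)

lemma inv_quot: "\<lbrakk>a \<in> carrier G; b \<in> carrier G\<rbrakk> \<Longrightarrow> inv (a \<otimes> inv b) = b \<otimes> inv a"
  by (simp add: m_ac inv_mult)

lemma finprod_inv: "f \<in> A \<rightarrow> carrier G \<Longrightarrow> finprod G (\<lambda>i. inv (f i)) A = inv finprod G f A"
  by (induction A rule: infinite_finite_induct) (auto simp: inv_mult Pi_iff)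

end

text \<open>The part of the coboundary that does not involve the action, with the opposite sign.
  The recursion splits off the face that merges the first two arguments.\<close>

fun tdiff :: "('g, 'x) monoid_scheme \<Rightarrow> ('a, 'y) monoid_scheme \<Rightarrow> ('g list \<Rightarrow> 'a) \<Rightarrow> 'g list \<Rightarrow> 'a"
  where
    "tdiff G M f [] = \<one>\<^bsub>M\<^esub>"
  | "tdiff G M f [g] = f []"
  | "tdiff G M f (g # h # gs) =
       f ((g \<otimes>\<^bsub>G\<^esub> h) # gs) \<otimes>\<^bsub>M\<^esub> inv\<^bsub>M\<^esub> (tdiff G M (\<lambda>l. f (g # l)) (h # gs))"

locale group_comm = G: group G + comm_group M
  for G :: "('g, 'x) monoid_scheme" and M :: "('a, 'y) monoid_scheme" (structure)
begin

lemma tdiff_closed: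
  "f \<in> tuples G n \<rightarrow> carrier M \<Longrightarrow> gs \<in> tuples G (Suc n) \<Longrightarrow> tdiff G M f gs \<in> carrier M"
proof (induction n arbitrary: f gs)
  case 0
  then show ?case by (auto elim!: tuples_SucE)
next
  case (Suc n)
  from Suc.prems(2) obtain g h hs where gs: "gs = g # h # hs" "g \<in> carrier G" "h \<in> carrier G"
      "hs \<in> tuples G n" by (auto elim!: tuples_SucE)
  have "tdiff G M (\<lambda>l. f (g # l)) (h # hs) \<in> carrier M"
    using Suc.prems gs by (intro Suc.IH) auto
  then show ?case using Suc.prems gs by (auto intro!: m_closed)
qed

lemma tdiff_cong:
  "(\<And>gs. gs \<in> tuples G n \<Longrightarrow> f gs = f' gs) \<Longrightarrow> gs \<in> tuples G (Suc n) \<Longrightarrow>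
    tdiff G M f gs = tdiff G M f' gs"
proof (induction n arbitrary: f f' gs)
  case 0
  then show ?case by (auto elim!: tuples_SucE)
next
  case (Suc n)
  from Suc.prems(2) obtain g h hs where gs: "gs = g # h # hs" "g \<in> carrier G" "h \<in> carrier G"
      "hs \<in> tuples G n" by (auto elim!: tuples_SucE)
  have "tdiff G M (\<lambda>l. f (g # l)) (h # hs) = tdiff G M (\<lambda>l. f' (g # l)) (h # hs)"
    using Suc.prems gs by (intro Suc.IH) auto
  then show ?case using Suc.prems gs by auto
qed

lemma tdiff_one:
  "gs \<in> tuples G (Suc n) \<Longrightarrow> tdiff G M (\<lambda>_. \<one>) gs = \<one>"
  by (induction n arbitrary: gs) (auto elim!: tuples_SucE)

lemma tdiff_mult:
  "f \<in> tuples G n \<rightarrow> carrier M \<Longrightarrow> f' \<in> tuples G n \<rightarrow> carrier M \<Longrightarrow> gs \<in> tuples G (Suc n) \<Longrightarrow>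
    tdiff G M (\<lambda>l. f l \<otimes> f' l) gs = tdiff G M f gs \<otimes> tdiff G M f' gs"
proof (induction n arbitrary: f f' gs)
  case 0
  then show ?case by (auto elim!: tuples_SucE)
next
  case (Suc n)
  from Suc.prems(3) obtain g h hs where gs: "gs = g # h # hs" "g \<in> carrier G" "h \<in> carrier G"
      "hs \<in> tuples G n" by (auto elim!: tuples_SucE)
  have IH: "tdiff G M (\<lambda>l. f (g # l) \<otimes> f' (g # l)) (h # hs) =
      tdiff G M (\<lambda>l. f (g # l)) (h # hs) \<otimes> tdiff G M (\<lambda>l. f' (g # l)) (h # hs)"
    using Suc.prems gs by (intro Suc.IH) auto
  have cl: "tdiff G M (\<lambda>l. f (g # l)) (h # hs) \<in> carrier M"
     "tdiff G M (\<lambda>l. f' (g # l)) (h # hs) \<in> carrier M"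
    using Suc.prems gs by (auto intro!: tdiff_closed)
  have "f ((g \<otimes>\<^bsub>G\<^esub> h) # hs) \<in> carrier M" "f' ((g \<otimes>\<^bsub>G\<^esub> h) # hs) \<in> carrier M"
    using Suc.prems gs by (auto dest!: funcset_mem)
  with cl show ?case by (simp add: gs IH inv_mult m_ac)
qed

text \<open>Inversion, integer powers and the action of a single group element are all
  homomorphisms; this one statement moves each of them through \<open>tdiff\<close>.\<close>

lemma tdiff_hom:
  assumes "comm_group N" "\<phi> \<in> hom M N"
  shows "f \<in> tuples G n \<rightarrow> carrier M \<Longrightarrow> gs \<in> tuples G (Suc n) \<Longrightarrow>
    tdiff G N (\<lambda>l. \<phi> (f l)) gs = \<phi> (tdiff G M f gs)"
proof (induction n arbitrary: f gs)
  case 0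
  then show ?case by (auto elim!: tuples_SucE)
next
  case (Suc n)
  interpret N: comm_group N by fact
  interpret \<phi>: group_hom M N \<phi>
    using assms by unfold_locales
  from Suc.prems(2) obtain g h hs where gs: "gs = g # h # hs" "g \<in> carrier G" "h \<in> carrier G"
      "hs \<in> tuples G n" by (auto elim!: tuples_SucE)
  have IH: "tdiff G N (\<lambda>l. \<phi> (f (g # l))) (h # hs) = \<phi> (tdiff G M (\<lambda>l. f (g # l)) (h # hs))"
    using Suc.prems gs by (intro Suc.IH) auto
  have cl: "tdiff G M (\<lambda>l. f (g # l)) (h # hs) \<in> carrier M"
    using Suc.prems gs by (auto intro!: tdiff_closed)
  have "f ((g \<otimes>\<^bsub>G\<^esub> h) # hs) \<in> carrier M"
    using Suc.prems gs by (auto dest!: funcset_mem)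
  with cl show ?case by (simp add: gs IH)
qed

lemma inv_hom: "(\<lambda>x. inv x) \<in> hom M M"
  by (auto simp: hom_def inv_mult)

lemma tdiff_inv:
  "f \<in> tuples G n \<rightarrow> carrier M \<Longrightarrow> gs \<in> tuples G (Suc n) \<Longrightarrow>
    tdiff G M (\<lambda>l. inv f l) gs = inv tdiff G M f gs"
  by (rule tdiff_hom[OF _ inv_hom]) unfold_locales

text \<open>Prepares the products over powers of \<sigma> that define \<open>slant\<close> and the
  partial products in the decomposition of cocycles.\<close>

lemma tdiff_finprod:
  assumes "finite I" "\<And>i. i \<in> I \<Longrightarrow> f i \<in> tuples G n \<rightarrow> carrier M" "gs \<in> tuples G (Suc n)"
  shows "tdiff G M (\<lambda>l. finprod M (\<lambda>i. f i l) I) gs = finprod M (\<lambda>i. tdiff G M (f i) gs) I"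
  using assms(1,2)
proof (induction I)
  case empty
  then show ?case using assms(3) by (simp add: tdiff_one)
next
  case (insert x F)
  have cl: "(\<lambda>i. tdiff G M (f i) gs) \<in> F \<rightarrow> carrier M" "tdiff G M (f x) gs \<in> carrier M"
    using insert.prems assms(3) by (auto intro!: tdiff_closed)
  have cl2: "(\<lambda>i. f i l) \<in> F \<rightarrow> carrier M" "f x l \<in> carrier M" if "l \<in> tuples G n" for l
    using insert.prems that by (auto dest: funcset_mem)
  have "tdiff G M (\<lambda>l. finprod M (\<lambda>i. f i l) (insert x F)) gs
     = tdiff G M (\<lambda>l. f x l \<otimes> finprod M (\<lambda>i. f i l) F) gs"
    using insert.hyps cl2 by (intro tdiff_cong[OF _ assms(3)]) simp
  also have "\<dots> = tdiff G M (f x) gs \<otimes> tdiff G M (\<lambda>l. finprod M (\<lambda>i. f i l) F) gs"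
    using insert.hyps cl2 insert.prems by (intro tdiff_mult[OF _ _ assms(3)]) (auto intro!: finprod_closed)
  also have "\<dots> = finprod M (\<lambda>i. tdiff G M (f i) gs) (insert x F)"
    using insert cl by simp
  finally show ?case .
qed

text \<open>The part of \<open>d d = 0\<close> that does not involve the action. Splitting off the
  first merge leaves the same claim for \<open>f\<close> with its first argument frozen, and the
  extreme terms cancel by associativity in \<open>G\<close>.\<close>

lemma tdiff_tdiff:
  "f \<in> tuples G n \<rightarrow> carrier M \<Longrightarrow> gs \<in> tuples G (Suc (Suc n)) \<Longrightarrow>
    tdiff G M (tdiff G M f) gs = \<one>"
proof (induction n arbitrary: f gs)
  case 0
  have "f [] \<in> carrier M" using funcset_mem[OF 0(1), of "[]"] by simp
  then show ?case using 0 by (auto elim!: tuples_SucE)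
next
  case (Suc n)
  from Suc.prems(2) obtain g h k hs where gs: "gs = g # h # k # hs" "g \<in> carrier G" "h \<in> carrier G"
      "k \<in> carrier G" "hs \<in> tuples G n" by (auto elim!: tuples_SucE)
  let ?T = "tdiff G M"
  have fin [simp]: "f (x # l) \<in> carrier M" if "x \<in> carrier G" "l \<in> tuples G n" for x l
    using Suc.prems(1) that by auto
  have ft: "(\<lambda>l. f (x # l)) \<in> tuples G n \<rightarrow> carrier M" if "x \<in> carrier G" for x
    using that by auto
  note cl = tdiff_closed[OF ft]
  have cl2: "?T (?T (\<lambda>l. f (g # l))) (h # k # hs) = \<one>"
    using gs by (intro Suc.IH) auto
  have t1: "?T (\<lambda>l. f ((g \<otimes>\<^bsub>G\<^esub> h) # l) \<otimes> inv (?T (\<lambda>l. f (g # l)) (h # l))) (k # hs) =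
     ?T (\<lambda>l. f ((g \<otimes>\<^bsub>G\<^esub> h) # l)) (k # hs) \<otimes> inv ?T (\<lambda>l. ?T (\<lambda>l. f (g # l)) (h # l)) (k # hs)"
  proof -
    have "?T (\<lambda>l. f ((g \<otimes>\<^bsub>G\<^esub> h) # l) \<otimes> inv (?T (\<lambda>l. f (g # l)) (h # l))) (k # hs)
     = ?T (\<lambda>l. f ((g \<otimes>\<^bsub>G\<^esub> h) # l)) (k # hs) \<otimes>
       ?T (\<lambda>l. inv (?T (\<lambda>l. f (g # l)) (h # l))) (k # hs)"
      using gs by (intro tdiff_mult[where n=n]) (auto intro!: inv_closed cl)
    also have "?T (\<lambda>l. inv (?T (\<lambda>l. f (g # l)) (h # l))) (k # hs) =
       inv ?T (\<lambda>l. ?T (\<lambda>l. f (g # l)) (h # l)) (k # hs)"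
      using gs by (intro tdiff_inv[where n=n]) (auto intro!: cl)
    finally show ?thesis .
  qed
  \<comment> \<open>This is the induction hypothesis \<open>cl2\<close> with the outer
    \<open>tdiff\<close> unfolded once and solved for its first factor.\<close>
  have eq: "?T (\<lambda>l. f (g # l)) ((h \<otimes>\<^bsub>G\<^esub> k) # hs) = ?T (\<lambda>l. ?T (\<lambda>l. f (g # l)) (h # l)) (k # hs)"
    (is "?a = ?b")
  proof -
    have "?a \<otimes> inv ?b = \<one>" "?a \<in> carrier M" "?b \<in> carrier M"
      using cl2 gs by (auto intro!: cl tdiff_closed[where n=n])
    then show ?thesis using inv_equality inv_inv by fastforce
  qed
  have c3: "?T (\<lambda>l. f (g # l)) ((h \<otimes>\<^bsub>G\<^esub> k) # hs) \<in> carrier M"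
    "?T (\<lambda>l. f ((g \<otimes>\<^bsub>G\<^esub> h) # l)) (k # hs) \<in> carrier M"
    using gs by (auto intro!: cl)
  have alg: "x \<otimes> inv b \<otimes> inv (x \<otimes> inv a \<otimes> inv (b \<otimes> inv a)) = \<one>"
    if "x \<in> carrier M" "a \<in> carrier M" "b \<in> carrier M" for x a b
  proof -
    have "x \<otimes> inv a \<otimes> inv (b \<otimes> inv a) = x \<otimes> inv a \<otimes> (a \<otimes> inv b)"
      using that by (simp add: inv_quot)
    also have "\<dots> = x \<otimes> (inv a \<otimes> a) \<otimes> inv b" using that by (simp only: m_assoc m_closed inv_closed)
    finally show ?thesis using that by simp
  qed
  have x: "f ((g \<otimes>\<^bsub>G\<^esub> h \<otimes>\<^bsub>G\<^esub> k) # hs) \<in> carrier M" using gs by simp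
  show ?case
    using gs alg[OF x c3] unfolding gs tdiff.simps t1 eq[symmetric] by (simp only: G.m_assoc)
qed

end

lemma (in group) merge_at_in_tuples:
  assumes "gs \<in> tuples G (Suc n)" "i \<in> {1..n}"
  shows "merge_at G i gs \<in> tuples G n"
proof -
  have gs: "length gs = Suc n" "set gs \<subseteq> carrier G" using assms by (auto simp: tuples_def)
  then have "gs ! (i - 1) \<in> carrier G" "gs ! i \<in> carrier G"
    using assms(2) by (auto intro!: subsetD[OF gs(2)] nth_mem)
  moreover have "set (take (i - 1) gs) \<subseteq> carrier G" "set (drop (i + 1) gs) \<subseteq> carrier G"
    using gs set_take_subset set_drop_subset by fast+
  ultimately show ?thesis using gs assms(2) by (auto simp: merge_at_def tuples_def)
qed

lemma butlast_in_tuples: "gs \<in> tuples G (Suc n) \<Longrightarrow> butlast gs \<in> tuples G n"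
  by (auto simp: tuples_def dest: in_set_butlastD)

section \<open>The differential of a module and its square\<close>

locale G_module = group_comm G M
  for G :: "('g, 'x) monoid_scheme" and M :: "('a, 'g) gmodule" (structure) +
  assumes act_closed [simp]: "g \<in> carrier G \<Longrightarrow> x \<in> carrier M \<Longrightarrow> act M g x \<in> carrier M"
    and act_mult: "g \<in> carrier G \<Longrightarrow> x \<in> carrier M \<Longrightarrow> y \<in> carrier M \<Longrightarrow>
      act M g (x \<otimes> y) = act M g x \<otimes> act M g y"
    and act_act: "g \<in> carrier G \<Longrightarrow> h \<in> carrier G \<Longrightarrow> x \<in> carrier M \<Longrightarrow>
      act M (g \<otimes>\<^bsub>G\<^esub> h) x = act M g (act M h x)"
begin

lemma act_hom: "g \<in> carrier G \<Longrightarrow> act M g \<in> hom M M"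
  by (auto simp: hom_def act_mult)

lemma act_one [simp]: "g \<in> carrier G \<Longrightarrow> act M g \<one> = \<one>"
  by (meson act_hom hom_one is_group)

lemma act_inv: "g \<in> carrier G \<Longrightarrow> x \<in> carrier M \<Longrightarrow> act M g (inv x) = inv act M g x"
  by (metis act_hom group_hom.hom_inv group_hom.intro group_hom_axioms.intro is_group)

text \<open>Reconciles the closed formula with the recursion: face 1 merges the first two arguments,
  while face \<open>Suc i\<close> is face \<open>i\<close> of the tail with the first argument kept
  and the sign reversed. The face that drops the last argument behaves in the same way, and in
  degree 0 it is the only one.\<close>

lemma coboundary_aux:
  "f \<in> tuples G n \<rightarrow> carrier M \<Longrightarrow> gs \<in> tuples G (Suc n) \<Longrightarrow>
    finprod M (\<lambda>i. f (merge_at G i gs) [^] ((- 1) ^ i :: int)) {1..n}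
     \<otimes> f (butlast gs) [^] ((- 1) ^ (n + 1) :: int) = inv tdiff G M f gs"
proof (induction n arbitrary: f gs)
  case 0
  have "f [] \<in> carrier M" using funcset_mem[OF 0(1), of "[]"] by simp
  then show ?case using 0 by (auto elim!: tuples_SucE simp: int_pow_neg int_pow_1)
next
  case (Suc n)
  from Suc.prems(2) obtain g h hs where gs: "gs = g # h # hs" "g \<in> carrier G" "h \<in> carrier G"
      "hs \<in> tuples G n" by (auto elim!: tuples_SucE)
  let ?F = "\<lambda>l. f (g # l)"
  have fin [simp]: "f (x # l) \<in> carrier M" if "x \<in> carrier G" "l \<in> tuples G n" for x l
    using Suc.prems(1) that by auto
  have ma: "merge_at G i (h # hs) \<in> tuples G n" if "i \<in> {1..n}" for i
    using gs that by (intro G.merge_at_in_tuples) auto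
  have bl: "butlast (h # hs) \<in> tuples G n"
    using gs by (intro butlast_in_tuples) auto
  have IH: "finprod M (\<lambda>i. ?F (merge_at G i (h # hs)) [^] ((- 1) ^ i :: int)) {1..n}
     \<otimes> ?F (butlast (h # hs)) [^] ((- 1) ^ (n + 1) :: int) = inv tdiff G M ?F (h # hs)"
    using gs by (intro Suc.IH) auto
  have neg: "x [^] ((-1) ^ Suc i :: int) = inv (x [^] ((-1) ^ i :: int))" if "x \<in> carrier M" for x i
    using that by (simp add: int_pow_neg)
  have m1: "merge_at G 1 gs = (g \<otimes>\<^bsub>G\<^esub> h) # hs" by (simp add: merge_at_def gs)
  have mS: "merge_at G (Suc i) gs = g # merge_at G i (h # hs)" if "i \<in> {1..n}" for i
    using that by (cases i) (auto simp: merge_at_def gs)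
  have mc: "f (merge_at G (Suc i) gs) \<in> carrier M" if "i \<in> {1..n}" for i
    using mS[OF that] ma[OF that] gs by simp
  have "finprod M (\<lambda>i. f (merge_at G i gs) [^] ((- 1) ^ i :: int)) {1..Suc n} =
     finprod M (\<lambda>i. f (merge_at G i gs) [^] ((- 1) ^ i :: int)) (insert 1 (Suc ` {1..n}))"
    by (rule arg_cong[where f="finprod M _"]) (simp add: image_Suc_atLeastAtMost atLeastAtMost_insertL)
  also have "\<dots> = f ((g \<otimes>\<^bsub>G\<^esub> h) # hs) [^] (-1 :: int) \<otimes>
      finprod M (\<lambda>i. f (merge_at G i gs) [^] ((- 1) ^ i :: int)) (Suc ` {1..n})"
    using gs m1 mc by (subst finprod_insert) (auto intro!: int_pow_closed simp del: image_Suc_atLeastAtMost)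
  also have "finprod M (\<lambda>i. f (merge_at G i gs) [^] ((- 1) ^ i :: int)) (Suc ` {1..n}) =
     finprod M (\<lambda>i. f (merge_at G (Suc i) gs) [^] ((- 1) ^ (Suc i) :: int)) {1..n}"
    using mc by (subst finprod_reindex) (auto intro!: int_pow_closed simp del: image_Suc_atLeastAtMost)
  also have "\<dots> = finprod M (\<lambda>i. inv (?F (merge_at G i (h # hs)) [^] ((- 1) ^ i :: int))) {1..n}"
    using gs ma mS neg by (intro finprod_cong') (auto intro!: int_pow_closed inv_closed)
  also have "\<dots> = inv finprod M (\<lambda>i. (?F (merge_at G i (h # hs)) [^] ((- 1) ^ i :: int))) {1..n}"
    using mc mS by (intro finprod_inv) (auto intro!: int_pow_closed)
  finally have e: "finprod M (\<lambda>i. f (merge_at G i gs) [^] ((- 1) ^ i :: int)) {1..Suc n} =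
      f ((g \<otimes>\<^bsub>G\<^esub> h) # hs) [^] (-1 :: int) \<otimes>
      inv finprod M (\<lambda>i. (?F (merge_at G i (h # hs)) [^] ((- 1) ^ i :: int))) {1..n}" .
  have b: "f (butlast gs) [^] ((-1) ^ (Suc n + 1) :: int) =
      inv (?F (butlast (h # hs)) [^] ((- 1) ^ (n + 1) :: int))"
    using bl gs neg[of "?F (butlast (h # hs))" "Suc n"] by simp
  define X where "X = finprod M (\<lambda>i. (?F (merge_at G i (h # hs)) [^] ((- 1) ^ i :: int))) {1..n}"
  define Y where "Y = ?F (butlast (h # hs)) [^] ((- 1) ^ (n + 1) :: int)"
  have c: "X \<in> carrier M" "Y \<in> carrier M"
    using gs ma bl unfolding X_def Y_def by (auto intro!: finprod_closed)
  have td: "tdiff G M ?F (h # hs) \<in> carrier M" using gs by (auto intro!: tdiff_closed)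
  have "X \<otimes> Y = inv tdiff G M ?F (h # hs)" using IH unfolding X_def Y_def .
  then have t: "tdiff G M ?F (h # hs) = inv X \<otimes> inv Y"
    using c td by (metis inv_inv inv_mult)
  then show ?case
    unfolding e b X_def[symmetric] Y_def[symmetric] using gs c td
    by (simp add: t inv_mult int_pow_neg int_pow_1 m_ac)
qed

text \<open>The working form of the differential, action term minus \<open>tdiff\<close>. Later
  computations use it instead of the alternating product over faces.\<close>

lemma coboundary_Cons:
  assumes "f \<in> tuples G n \<rightarrow> carrier M" "g \<in> carrier G" "gs \<in> tuples G n"
  shows "coboundary G M n f (g # gs) = act M g (f gs) \<otimes> inv tdiff G M f (g # gs)"
proof -
  have bl: "butlast (g # gs) \<in> tuples G n"
    using assms by (intro butlast_in_tuples) auto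
  have ma: "merge_at G i (g # gs) \<in> tuples G n" if "i \<in> {1..n}" for i
    using assms that by (intro G.merge_at_in_tuples) auto
  define X where "X = finprod M (\<lambda>i. f (merge_at G i (g # gs)) [^] ((- 1) ^ i :: int)) {1..n}"
  define Y where "Y = f (butlast (g # gs)) [^] ((- 1) ^ (n + 1) :: int)"
  have c: "X \<in> carrier M" "Y \<in> carrier M" "act M g (f gs) \<in> carrier M"
    unfolding X_def Y_def using assms funcset_mem[OF assms(1) ma] funcset_mem[OF assms(1) bl]
    by (auto intro!: finprod_closed int_pow_closed simp del: butlast.simps dest: funcset_mem)
  have "coboundary G M n f (g # gs) = act M g (f gs) \<otimes> X \<otimes> Y"
    using assms unfolding coboundary_def X_def Y_def by (simp del: butlast.simps)
  also have "\<dots> = act M g (f gs) \<otimes> (X \<otimes> Y)" using c by (simp add: m_assoc)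
  also have "X \<otimes> Y = inv tdiff G M f (g # gs)"
    unfolding X_def Y_def using assms by (intro coboundary_aux) auto
  finally show ?thesis .
qed

end

context G_module
begin

lemma coboundary_closed:
  assumes "f \<in> tuples G n \<rightarrow> carrier M" "gs \<in> tuples G (Suc n)"
  shows "coboundary G M n f gs \<in> carrier M"
proof -
  obtain g hs where gs: "gs = g # hs" "g \<in> carrier G" "hs \<in> tuples G n"
    using assms(2) by (auto elim!: tuples_SucE)
  then have "tdiff G M f gs \<in> carrier M" "f hs \<in> carrier M" using assms by (auto intro!: tdiff_closed)
  then show ?thesis using gs assms by (simp add: coboundary_Cons)
qed

lemma coboundary_cong:
  assumes "f \<in> tuples G n \<rightarrow> carrier M" "gs \<in> tuples G (Suc n)"
    "\<And>gs. gs \<in> tuples G n \<Longrightarrow> f gs = f' gs"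
  shows "coboundary G M n f gs = coboundary G M n f' gs"
proof -
  obtain g hs where gs: "gs = g # hs" "g \<in> carrier G" "hs \<in> tuples G n"
    using assms(2) by (auto elim!: tuples_SucE)
  have f': "f' \<in> tuples G n \<rightarrow> carrier M" using assms(1,3) by force
  have "tdiff G M f gs = tdiff G M f' gs" using assms by (intro tdiff_cong)
  then show ?thesis using gs assms f' by (simp add: coboundary_Cons)
qed

lemma coboundary_mult:
  assumes "f \<in> tuples G n \<rightarrow> carrier M" "f' \<in> tuples G n \<rightarrow> carrier M" "gs \<in> tuples G (Suc n)"
  shows "coboundary G M n (\<lambda>l. f l \<otimes> f' l) gs = coboundary G M n f gs \<otimes> coboundary G M n f' gs"
proof -
  obtain g hs where gs: "gs = g # hs" "g \<in> carrier G" "hs \<in> tuples G n"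
    using assms(3) by (auto elim!: tuples_SucE)
  have m: "(\<lambda>l. f l \<otimes> f' l) \<in> tuples G n \<rightarrow> carrier M" using assms by auto
  have c: "tdiff G M f (g # hs) \<in> carrier M" "tdiff G M f' (g # hs) \<in> carrier M"
      "f hs \<in> carrier M" "f' hs \<in> carrier M" using assms gs by (auto intro!: tdiff_closed)
  then show ?thesis using gs assms m
    by (simp add: coboundary_Cons tdiff_mult act_mult inv_mult m_ac)
qed

lemma coboundary_one:
  assumes "gs \<in> tuples G (Suc n)"
  shows "coboundary G M n (\<lambda>l. \<one>) gs = \<one>"
proof -
  obtain g hs where gs: "gs = g # hs" "g \<in> carrier G" "hs \<in> tuples G n"
    using assms by (auto elim!: tuples_SucE)
  then show ?thesis using assms by (simp add: coboundary_Cons tdiff_one)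
qed

text \<open>With the action term of \<open>d f\<close> written as a cochain \<open>F\<close>, the
  \<open>tdiff\<close> of the remaining part vanishes by \<open>tdiff_tdiff\<close>. The
  \<open>tdiff\<close> of \<open>F\<close> consists of the action of a product and of
  \<open>g\<close> applied to \<open>tdiff f\<close>, which is exactly \<open>g\<close> applied to
  \<open>d f\<close>.\<close>

lemma coboundary_coboundary:
  assumes "f \<in> tuples G n \<rightarrow> carrier M" "gs \<in> tuples G (Suc (Suc n))"
  shows "coboundary G M (Suc n) (coboundary G M n f) gs = \<one>"
proof -
  obtain g h hs where gs: "gs = g # h # hs" "g \<in> carrier G" "h \<in> carrier G" "hs \<in> tuples G n"
    using assms(2) by (auto elim!: tuples_SucE)
  have d: "coboundary G M n f \<in> tuples G (Suc n) \<rightarrow> carrier M"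
    using assms(1) by (auto intro: coboundary_closed)
  define F where "F = (\<lambda>l. act M (hd l) (f (tl l)))"
  have F: "F \<in> tuples G (Suc n) \<rightarrow> carrier M"
    unfolding F_def using assms(1) by (auto elim!: tuples_SucE simp: Pi_iff)
  have T: "tdiff G M f \<in> tuples G (Suc n) \<rightarrow> carrier M" using assms(1) by (auto intro: tdiff_closed)
  have "coboundary G M (Suc n) (coboundary G M n f) gs =
     act M g (coboundary G M n f (h # hs)) \<otimes> inv tdiff G M (coboundary G M n f) gs"
    using gs d by (simp add: coboundary_Cons)
  also have "tdiff G M (coboundary G M n f) gs = tdiff G M (\<lambda>l. F l \<otimes> inv tdiff G M f l) gs"
    by (rule tdiff_cong[OF _ assms(2)]) (auto elim!: tuples_SucE simp: coboundary_Cons assms(1) F_def)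
  also have "\<dots> = tdiff G M F gs \<otimes> tdiff G M (\<lambda>l. inv tdiff G M f l) gs"
    using F T by (intro tdiff_mult[OF _ _ assms(2)]) auto
  also have "tdiff G M (\<lambda>l. inv tdiff G M f l) gs = \<one>"
    using T assms by (simp add: tdiff_inv[OF _ assms(2)] tdiff_tdiff)
  also have "tdiff G M F gs = F ((g \<otimes>\<^bsub>G\<^esub> h) # hs) \<otimes> inv tdiff G M (\<lambda>l. act M g (f l)) (h # hs)"
    unfolding gs by (simp add: F_def)
  also have "tdiff G M (\<lambda>l. act M g (f l)) (h # hs) = act M g (tdiff G M f (h # hs))"
    using gs assms(1) by (intro tdiff_hom[where n=n, OF comm_group_axioms act_hom]) auto
  finally have *: "coboundary G M (Suc n) (coboundary G M n f) gs =
     act M g (coboundary G M n f (h # hs)) \<otimes>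
     inv (F ((g \<otimes>\<^bsub>G\<^esub> h) # hs) \<otimes> inv act M g (tdiff G M f (h # hs)) \<otimes> \<one>)" .
  have T': "tdiff G M f (h # hs) \<in> carrier M" "f hs \<in> carrier M"
    using gs assms(1) T by auto
  have "act M g (coboundary G M n f (h # hs)) = F ((g \<otimes>\<^bsub>G\<^esub> h) # hs) \<otimes> inv act M g (tdiff G M f (h # hs))"
    using gs assms(1) T' by (simp add: coboundary_Cons act_mult act_inv act_act F_def)
  then show ?thesis unfolding * using T' gs F by (simp add: F_def)
qed

section \<open>Cohomology groups as quotients of cochain groups\<close>

lemma carrier_cochain_group [simp]: "carrier (cochain_group G M n) = tuples G n \<rightarrow>\<^sub>E carrier M"
  by (simp add: cochain_group_def)

lemma mult_cochain_group: "f \<otimes>\<^bsub>cochain_group G M n\<^esub> h = (\<lambda>gs\<in>tuples G n. f gs \<otimes> h gs)"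
  by (simp add: cochain_group_def)

lemma one_cochain_group: "\<one>\<^bsub>cochain_group G M n\<^esub> = (\<lambda>gs\<in>tuples G n. \<one>)"
  by (simp add: cochain_group_def)

lemma comm_group_cochain_group: "comm_group (cochain_group G M n)"
proof (rule comm_groupI; unfold carrier_cochain_group mult_cochain_group one_cochain_group)
  fix f assume "f \<in> tuples G n \<rightarrow>\<^sub>E carrier M"
  then show "\<exists>h\<in>tuples G n \<rightarrow>\<^sub>E carrier M. (\<lambda>gs\<in>tuples G n. h gs \<otimes> f gs) = (\<lambda>gs\<in>tuples G n. \<one>)"
    by (intro bexI[of _ "\<lambda>gs\<in>tuples G n. inv (f gs)"]) (auto simp: PiE_iff intro!: restrict_ext)
qed (auto simp: PiE_iff fun_eq_iff extensional_def restrict_def m_ac)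

lemma coboundary_in_hom:
  "coboundary G M n \<in> hom (cochain_group G M n) (cochain_group G M (Suc n))"
proof (rule homI; unfold carrier_cochain_group mult_cochain_group)
  fix f assume f: "f \<in> tuples G n \<rightarrow>\<^sub>E carrier M"
  show "coboundary G M n f \<in> tuples G (Suc n) \<rightarrow>\<^sub>E carrier M"
    using f by (intro PiE_I coboundary_closed) (auto simp: coboundary_def PiE_iff)
  fix f' assume f': "f' \<in> tuples G n \<rightarrow>\<^sub>E carrier M"
  show "coboundary G M n (\<lambda>gs\<in>tuples G n. f gs \<otimes> f' gs) =
      (\<lambda>gs\<in>tuples G (Suc n). coboundary G M n f gs \<otimes> coboundary G M n f' gs)"
  proof
    fix gs
    show "coboundary G M n (\<lambda>gs\<in>tuples G n. f gs \<otimes> f' gs) gs =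
      (\<lambda>gs\<in>tuples G (Suc n). coboundary G M n f gs \<otimes> coboundary G M n f' gs) gs"
    proof (cases "gs \<in> tuples G (Suc n)")
      case True
      then have "coboundary G M n (\<lambda>gs\<in>tuples G n. f gs \<otimes> f' gs) gs =
          coboundary G M n (\<lambda>gs. f gs \<otimes> f' gs) gs"
        using f f' by (intro coboundary_cong) (auto simp: PiE_iff)
      then show ?thesis using True f f' by (subst (asm) coboundary_mult) (auto simp: PiE_iff)
    next
      case False then show ?thesis by (simp add: coboundary_def)
    qed
  qed
qed

lemma cocyclesI:
  assumes "f \<in> tuples G n \<rightarrow>\<^sub>E carrier M" "\<And>gs. gs \<in> tuples G (Suc n) \<Longrightarrow> coboundary G M n f gs = \<one>"
  shows "f \<in> cocycles G M n"
  using assms by (auto simp: cocycles_def one_cochain_group fun_eq_iff coboundary_def)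

lemma cocyclesD:
  assumes "f \<in> cocycles G M n"
  shows "f \<in> tuples G n \<rightarrow>\<^sub>E carrier M" "\<And>gs. gs \<in> tuples G (Suc n) \<Longrightarrow> coboundary G M n f gs = \<one>"
  using assms by (auto simp: cocycles_def one_cochain_group fun_eq_iff)

sublocale cochain: comm_group "cochain_group G M n" for n
  by (rule comm_group_cochain_group)

lemma subgroup_cocycles: "subgroup (cocycles G M n) (cochain_group G M n)"
proof -
  interpret group_hom "cochain_group G M n" "cochain_group G M (Suc n)" "coboundary G M n"
    using coboundary_in_hom by unfold_locales
  have "cocycles G M n = kernel (cochain_group G M n) (cochain_group G M (Suc n)) (coboundary G M n)"
    by (auto simp: cocycles_def kernel_def)
  then show ?thesis using subgroup_kernel by simp
qed

lemma coboundaries_subset: "coboundaries G M n \<subseteq> cocycles G M n"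
proof (cases n)
  case 0
  then show ?thesis using subgroup.one_closed[OF subgroup_cocycles] by (simp add: coboundaries_def)
next
  case (Suc j)
  have "coboundary G M j f \<in> cocycles G M (Suc j)" if "f \<in> tuples G j \<rightarrow>\<^sub>E carrier M" for f
    using that coboundary_coboundary[of f j] hom_in_carrier[OF coboundary_in_hom, of f j]
    by (intro cocyclesI) (auto simp: PiE_iff)
  then show ?thesis by (auto simp: coboundaries_def Suc)
qed

lemma subgroup_coboundaries: "subgroup (coboundaries G M n) (cochain_group G M n)"
proof (cases n)
  case 0
  then show ?thesis using cochain.triv_subgroup[of 0] by (simp add: coboundaries_def)
next
  case (Suc j)
  interpret group_hom "cochain_group G M j" "cochain_group G M (Suc j)" "coboundary G M j"
    using coboundary_in_hom by unfold_locales
  show ?thesis using img_is_subgroup by (simp add: coboundaries_def Suc)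
qed

abbreviation "cocycle_group n \<equiv> (cochain_group G M n)\<lparr>carrier := cocycles G M n\<rparr>"

lemma comm_group_cocycle_group: "comm_group (cocycle_group n)"
  using cochain.subgroup_imp_comm_group[OF subgroup_cocycles] .

lemma normal_coboundaries: "normal (coboundaries G M n) (cocycle_group n)"
  using comm_group.subgroup_imp_normal[OF comm_group_cocycle_group]
    cochain.subgroup_incl[OF subgroup_coboundaries subgroup_cocycles coboundaries_subset] by blast

lemma carrier_cohomology:
  "carrier (cohomology G M n) = cohomology_class G M n ` cocycles G M n"
  by (auto simp: cohomology_def carrier_FactGroup cohomology_class_def r_coset_def)

lemma one_cohomology: "\<one>\<^bsub>cohomology G M n\<^esub> = cohomology_class G M n \<one>\<^bsub>cochain_group G M n\<^esub>"
  using subgroup.subset[OF subgroup_coboundaries]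
  by (simp add: cohomology_def cohomology_class_def cochain.coset_mult_one)

lemma cohomology_class_hom:
  "cohomology_class G M n \<in> hom (cocycle_group n) (cohomology G M n)"
proof -
  have "(\<lambda>a. coboundaries G M n #>\<^bsub>cocycle_group n\<^esub> a) \<in> hom (cocycle_group n) (cohomology G M n)"
    unfolding cohomology_def using normal.r_coset_hom_Mod[OF normal_coboundaries] .
  then show ?thesis by (simp add: cohomology_class_def[abs_def] r_coset_def)
qed

lemma group_cohomology: "group (cohomology G M n)"
  unfolding cohomology_def by (rule normal.factorgroup_is_group[OF normal_coboundaries])

lemma mem_cohomology_class_iff:
  "a \<in> cohomology_class G M n b \<longleftrightarrow> (\<exists>c\<in>coboundaries G M n. a = c \<otimes>\<^bsub>cochain_group G M n\<^esub> b)"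
  by (auto simp: cohomology_class_def r_coset_def)

lemma cohomology_class_self:
  "a \<in> tuples G n \<rightarrow>\<^sub>E carrier M \<Longrightarrow> a \<in> cohomology_class G M n a"
  unfolding cohomology_class_def using cochain.rcos_self subgroup_coboundaries by simp

lemma cohomology_class_eq:
  "a \<in> tuples G n \<rightarrow>\<^sub>E carrier M \<Longrightarrow> b \<in> cohomology_class G M n a \<Longrightarrow>
    cohomology_class G M n b = cohomology_class G M n a"
  unfolding cohomology_class_def
  by (metis carrier_cochain_group cochain.repr_independence subgroup_coboundaries)

lemma cohomology_class_eq_iff:
  assumes "a \<in> tuples G n \<rightarrow>\<^sub>E carrier M" "b \<in> tuples G n \<rightarrow>\<^sub>E carrier M"
  shows "cohomology_class G M n a = cohomology_class G M n b \<longleftrightarrow>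
     (\<exists>c\<in>coboundaries G M n. a = c \<otimes>\<^bsub>cochain_group G M n\<^esub> b)"
  using cohomology_class_self[OF assms(1)] cohomology_class_eq[OF assms(2), of a]
  unfolding mem_cohomology_class_iff[symmetric] by auto

text \<open>Witnesses are given as plain functions on tuples. Cochains are extensional, so the proof
  passes to the restriction, which has the same coboundary.\<close>

lemma cohomology_class_eqI:
  assumes "a \<in> tuples G (Suc n) \<rightarrow>\<^sub>E carrier M" "b \<in> tuples G (Suc n) \<rightarrow>\<^sub>E carrier M"
    "f \<in> tuples G n \<rightarrow> carrier M"
    "\<And>gs. gs \<in> tuples G (Suc n) \<Longrightarrow> a gs = coboundary G M n f gs \<otimes> b gs"
  shows "cohomology_class G M (Suc n) a = cohomology_class G M (Suc n) b"
proof -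
  let ?f = "restrict f (tuples G n)"
  have "coboundary G M n ?f gs = coboundary G M n f gs" if "gs \<in> tuples G (Suc n)" for gs
    using assms(3) that by (intro coboundary_cong) auto
  then have "a = coboundary G M n ?f \<otimes>\<^bsub>cochain_group G M (Suc n)\<^esub> b"
    using assms by (auto simp: mult_cochain_group fun_eq_iff PiE_iff extensional_def)
  moreover have "coboundary G M n ?f \<in> coboundaries G M (Suc n)"
    using assms(3) by (auto simp: coboundaries_def)
  ultimately show ?thesis using assms by (auto simp: cohomology_class_eq_iff)
qed

lemma cohomology_class_eq_oneD:
  assumes "a \<in> tuples G (Suc n) \<rightarrow>\<^sub>E carrier M"
    "cohomology_class G M (Suc n) a = \<one>\<^bsub>cohomology G M (Suc n)\<^esub>"
  obtains f where "f \<in> tuples G n \<rightarrow> carrier M" "\<And>gs. gs \<in> tuples G (Suc n) \<Longrightarrow> a gs = coboundary G M n f gs"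
proof -
  have "a \<in> coboundaries G M (Suc n)"
    using cohomology_class_self[OF assms(1)] assms(2) by (simp add: cohomology_def)
  then show ?thesis using that by (auto simp: coboundaries_def)
qed

lemma cohomology_class_eq_oneI:
  assumes "a \<in> tuples G (Suc n) \<rightarrow>\<^sub>E carrier M" "f \<in> tuples G n \<rightarrow> carrier M"
    "\<And>gs. gs \<in> tuples G (Suc n) \<Longrightarrow> a gs = coboundary G M n f gs"
  shows "cohomology_class G M (Suc n) a = \<one>\<^bsub>cohomology G M (Suc n)\<^esub>"
  unfolding one_cohomology
  using assms coboundary_closed[OF assms(2)] cochain.one_closed[of "Suc n"]
  by (intro cohomology_class_eqI[of _ _ _ f]) (auto simp: one_cochain_group PiE_iff)

end

section \<open>Equivariant maps and the connecting homomorphism\<close>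

locale G_module_hom = M: G_module G M + N: G_module G N
  for G :: "('g, 'x) monoid_scheme" and M :: "('a, 'g) gmodule" and N :: "('b, 'g) gmodule" +
  fixes \<phi> :: "'a \<Rightarrow> 'b"
  assumes hom: "\<phi> \<in> hom M N"
    and equivariant: "g \<in> carrier G \<Longrightarrow> x \<in> carrier M \<Longrightarrow> \<phi> (act M g x) = act N g (\<phi> x)"
begin

sublocale group_hom M N \<phi>
  using hom by unfold_locales

lemma coboundary_hom:
  assumes "f \<in> tuples G n \<rightarrow> carrier M" "gs \<in> tuples G (Suc n)"
  shows "coboundary G N n (\<lambda>l. \<phi> (f l)) gs = \<phi> (coboundary G M n f gs)"
proof -
  obtain g hs where gs: "gs = g # hs" "g \<in> carrier G" "hs \<in> tuples G n"
    using assms(2) by (auto elim!: tuples_SucE)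
  have \<phi>f: "(\<lambda>l. \<phi> (f l)) \<in> tuples G n \<rightarrow> carrier N" using assms(1) by (auto simp: Pi_iff)
  have "tdiff G M f gs \<in> carrier M" "f hs \<in> carrier M"
    using gs assms by (auto intro!: M.tdiff_closed)
  moreover have "tdiff G N (\<lambda>l. \<phi> (f l)) gs = \<phi> (tdiff G M f gs)"
    by (rule M.tdiff_hom[OF N.comm_group_axioms hom assms])
  ultimately show ?thesis using gs assms \<phi>f
    by (simp add: N.coboundary_Cons M.coboundary_Cons equivariant)
qed

end

locale G_short_exact = i: G_module_hom G A B i + p: G_module_hom G B C p
  for G :: "('g, 'x) monoid_scheme" and A :: "('a, 'g) gmodule" and i and B :: "('b, 'g) gmodule"
    and p and C :: "('c, 'g) gmodule" +
  assumes inj: "inj_on i (carrier A)"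
    and surj: "p ` carrier B = carrier C"
    and exact: "kernel B C p = i ` carrier A"
begin

text \<open>Evaluates the definite description. Existence is the given data. For uniqueness, a
  competing cocycle \<open>c'\<close> differs from \<open>c\<close> by a coboundary, which lifts to
  a cochain \<gamma>' of \<open>B\<close> with trivial coboundary; then \<open>f'\<close> and
  \<gamma>' \<open>f\<close> have the same image in \<open>C\<close>, so they differ by a cochain
  \<alpha> of \<open>A\<close>, and \<open>a'\<close> and \<open>a\<close> differ by its
  coboundary.\<close>

lemma connecting_class:
  assumes c: "c \<in> cocycles G C n"
    and f: "f \<in> tuples G n \<rightarrow> carrier B" "\<And>gs. gs \<in> tuples G n \<Longrightarrow> p (f gs) = c gs"
    and a: "a \<in> tuples G (Suc n) \<rightarrow>\<^sub>E carrier A"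
      "\<And>gs. gs \<in> tuples G (Suc n) \<Longrightarrow> i (a gs) = coboundary G B n f gs"
  shows "a \<in> cocycles G A (Suc n)"
    and "connecting G A i B p n (cohomology_class G C n c) = cohomology_class G A (Suc n) a"
proof -
  note cD = i.M.cocyclesD
  have a': "a \<in> tuples G (Suc n) \<rightarrow> carrier A" using a(1) by auto
  have df: "coboundary G B n f \<in> tuples G (Suc n) \<rightarrow> carrier B"
    using f(1) by (auto intro: i.N.coboundary_closed)
  show acoc: "a \<in> cocycles G A (Suc n)"
  proof (rule i.M.cocyclesI[OF a(1)])
    fix gs assume gs: "gs \<in> tuples G (Suc (Suc n))"
    have "i (coboundary G A (Suc n) a gs) = coboundary G B (Suc n) (\<lambda>l. i (a l)) gs"
      by (rule i.coboundary_hom[OF a' gs, symmetric])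
    also have "\<dots> = coboundary G B (Suc n) (coboundary G B n f) gs"
      using a' a(2) gs by (intro i.N.coboundary_cong) (auto simp: Pi_iff simp flip: a(2))
    also have "\<dots> = i \<one>\<^bsub>A\<^esub>" using i.N.coboundary_coboundary[OF f(1) gs] by simp
    finally show "coboundary G A (Suc n) a gs = \<one>\<^bsub>A\<^esub>"
      using inj_onD[OF inj, of "coboundary G A (Suc n) a gs" "\<one>\<^bsub>A\<^esub>"] i.M.coboundary_closed[OF a' gs] by simp
  qed
  show "connecting G A i B p n (cohomology_class G C n c) = cohomology_class G A (Suc n) a"
    unfolding connecting_def
  proof (rule the_equality, intro conjI)
    show "cohomology_class G A (Suc n) a \<in> carrier (cohomology G A (n + 1))"
      using acoc by (simp add: i.M.carrier_cohomology)
    show "\<exists>c'\<in>cohomology_class G C n c. \<exists>a'\<in>cohomology_class G A (Suc n) a.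
       \<exists>f\<in>carrier (cochain_group G B n). (\<forall>gs\<in>tuples G n. p (f gs) = c' gs) \<and>
         (\<forall>gs\<in>tuples G (n + 1). i (a' gs) = coboundary G B n f gs)"
    proof (intro bexI conjI ballI)
      show "c \<in> cohomology_class G C n c" using p.N.cocyclesD(1)[OF c] by (rule p.N.cohomology_class_self)
      show "a \<in> cohomology_class G A (Suc n) a" using a(1) by (rule i.M.cohomology_class_self)
      show "restrict f (tuples G n) \<in> carrier (cochain_group G B n)" using f by auto
      show "p (restrict f (tuples G n) gs) = c gs" if "gs \<in> tuples G n" for gs using f that by auto
      show "i (a gs) = coboundary G B n (restrict f (tuples G n)) gs" if "gs \<in> tuples G (n + 1)" for gs
        using a(2)[of gs] that f(1) i.N.coboundary_cong[of f n gs "restrict f (tuples G n)"] by auto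
    qed
  next
    fix W
    assume "W \<in> carrier (cohomology G A (n + 1)) \<and> (\<exists>c'\<in>cohomology_class G C n c. \<exists>a'\<in>W.
       \<exists>f\<in>carrier (cochain_group G B n). (\<forall>gs\<in>tuples G n. p (f gs) = c' gs) \<and>
         (\<forall>gs\<in>tuples G (n + 1). i (a' gs) = coboundary G B n f gs))"
    then obtain w c' a' f' where w: "w \<in> cocycles G A (Suc n)" "W = cohomology_class G A (Suc n) w"
      and c': "c' \<in> cohomology_class G C n c" and a'W: "a' \<in> W"
      and f': "f' \<in> tuples G n \<rightarrow>\<^sub>E carrier B" "\<And>gs. gs \<in> tuples G n \<Longrightarrow> p (f' gs) = c' gs"
        "\<And>gs. gs \<in> tuples G (Suc n) \<Longrightarrow> i (a' gs) = coboundary G B n f' gs"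
      by (auto simp: i.M.carrier_cohomology)
    have w1: "w \<in> tuples G (Suc n) \<rightarrow>\<^sub>E carrier A" using i.M.cocyclesD[OF w(1)] by simp
    have Wa': "W = cohomology_class G A (Suc n) a'"
      using i.M.cohomology_class_eq[OF w1] a'W w(2) by simp
    obtain v where v: "v \<in> coboundaries G A (Suc n)" "a' = v \<otimes>\<^bsub>cochain_group G A (Suc n)\<^esub> w"
      using a'W w(2) i.M.mem_cohomology_class_iff by auto
    have a'1: "a' \<in> tuples G (Suc n) \<rightarrow>\<^sub>E carrier A"
      using v w1 subgroup.mem_carrier[OF i.M.subgroup_coboundaries]
      by (metis i.M.carrier_cochain_group i.M.cochain.m_closed)
    obtain \<gamma> where \<gamma>: "\<gamma> \<in> coboundaries G C n" "c' = \<gamma> \<otimes>\<^bsub>cochain_group G C n\<^esub> c"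
      using c' p.N.mem_cohomology_class_iff by auto
    have c'eq: "c' gs = \<gamma> gs \<otimes>\<^bsub>C\<^esub> c gs" if "gs \<in> tuples G n" for gs
      using \<gamma>(2) that by (simp add: p.N.mult_cochain_group)
    \<comment> \<open>In degree 0 the only coboundary is trivial and lifts to 1. In positive degree
      a cochain with coboundary \<gamma> is lifted pointwise, and the coboundary of the lift serves
      as \<gamma>'.\<close>
    obtain \<gamma>' where \<gamma>': "\<gamma>' \<in> tuples G n \<rightarrow> carrier B" "\<And>gs. gs \<in> tuples G n \<Longrightarrow> p (\<gamma>' gs) = \<gamma> gs"
      "\<And>gs. gs \<in> tuples G (Suc n) \<Longrightarrow> coboundary G B n \<gamma>' gs = \<one>\<^bsub>B\<^esub>"
    proof (cases n)
      case 0
      show ?thesis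
        by (rule that[of "\<lambda>_. \<one>\<^bsub>B\<^esub>"])
          (use \<gamma>(1) 0 in \<open>auto simp: coboundaries_def p.N.one_cochain_group i.N.coboundary_one\<close>)
    next
      case (Suc j)
      then obtain \<beta> where \<beta>: "\<beta> \<in> tuples G j \<rightarrow>\<^sub>E carrier C" "\<gamma> = coboundary G C j \<beta>"
        using \<gamma>(1) by (auto simp: coboundaries_def)
      then have "\<forall>gs\<in>tuples G j. \<exists>y\<in>carrier B. p y = \<beta> gs" using surj by (metis PiE_mem imageE)
      then obtain \<beta>' where \<beta>': "\<And>gs. gs \<in> tuples G j \<Longrightarrow> \<beta>' gs \<in> carrier B \<and> p (\<beta>' gs) = \<beta> gs"
        by metis
      then have \<beta>'1: "\<beta>' \<in> tuples G j \<rightarrow> carrier B" by auto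
      show ?thesis
      proof (rule that[of "coboundary G B j \<beta>'"])
        show "coboundary G B j \<beta>' \<in> tuples G n \<rightarrow> carrier B"
          using \<beta>'1 Suc by (auto intro: i.N.coboundary_closed)
        show "coboundary G B n (coboundary G B j \<beta>') gs = \<one>\<^bsub>B\<^esub>" if "gs \<in> tuples G (Suc n)" for gs
          using that \<beta>'1 Suc by (auto intro: i.N.coboundary_coboundary)
        show "p (coboundary G B j \<beta>' gs) = \<gamma> gs" if "gs \<in> tuples G n" for gs
        proof -
          have "p (coboundary G B j \<beta>' gs) = coboundary G C j (\<lambda>l. p (\<beta>' l)) gs"
            using p.coboundary_hom[OF \<beta>'1, of gs] that Suc by simp
          also have "\<dots> = coboundary G C j \<beta> gs"
            using \<beta>' \<beta>(1) that Suc by (intro p.N.coboundary_cong) (auto simp: PiE_iff)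
          finally show ?thesis using \<beta> by simp
        qed
      qed
    qed
    have cC: "c gs \<in> carrier C" "\<gamma> gs \<in> carrier C" if "gs \<in> tuples G n" for gs
      using p.N.cocyclesD(1)[OF c] that \<gamma>'(1) by (auto simp: PiE_iff Pi_iff simp flip: \<gamma>'(2))
    have fB: "f gs \<in> carrier B" "f' gs \<in> carrier B" "\<gamma>' gs \<in> carrier B" if "gs \<in> tuples G n" for gs
      using that f \<gamma>' f' by (auto simp: PiE_iff)
    \<comment> \<open>Exactness at \<open>B\<close>, applied pointwise, produces the values of
      \<alpha>.\<close>
    have "\<forall>gs\<in>tuples G n. \<exists>x\<in>carrier A. f' gs = i x \<otimes>\<^bsub>B\<^esub> (\<gamma>' gs \<otimes>\<^bsub>B\<^esub> f gs)"
    proof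
      fix gs assume gs: "gs \<in> tuples G n"
      have "p (f' gs \<otimes>\<^bsub>B\<^esub> inv\<^bsub>B\<^esub> (\<gamma>' gs \<otimes>\<^bsub>B\<^esub> f gs)) = \<one>\<^bsub>C\<^esub>"
        using gs f f' \<gamma>' c'eq fB[OF gs] cC[OF gs] by simp
      then have "f' gs \<otimes>\<^bsub>B\<^esub> inv\<^bsub>B\<^esub> (\<gamma>' gs \<otimes>\<^bsub>B\<^esub> f gs) \<in> i ` carrier A"
        unfolding exact[symmetric] using fB[OF gs] by (simp add: kernel_def)
      then show "\<exists>x\<in>carrier A. f' gs = i x \<otimes>\<^bsub>B\<^esub> (\<gamma>' gs \<otimes>\<^bsub>B\<^esub> f gs)"
        using fB[OF gs] by (metis (no_types, opaque_lifting) i.N.inv_closed i.N.inv_solve_right i.N.m_closed imageE)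
    qed
    then obtain \<alpha> where \<alpha>: "\<And>gs. gs \<in> tuples G n \<Longrightarrow> \<alpha> gs \<in> carrier A \<and> f' gs = i (\<alpha> gs) \<otimes>\<^bsub>B\<^esub> (\<gamma>' gs \<otimes>\<^bsub>B\<^esub> f gs)"
      by metis
    then have \<alpha>1: "\<alpha> \<in> tuples G n \<rightarrow> carrier A" by auto
    have "cohomology_class G A (Suc n) a' = cohomology_class G A (Suc n) a"
    proof (rule i.M.cohomology_class_eqI[OF a'1 a(1) \<alpha>1])
      fix gs assume gs: "gs \<in> tuples G (Suc n)"
      have cl: "coboundary G A n \<alpha> gs \<in> carrier A" "a gs \<in> carrier A" "a' gs \<in> carrier A"
        using i.M.coboundary_closed[OF \<alpha>1 gs] a(1) a'1 gs by auto
      have "i (a' gs) = coboundary G B n f' gs" using f'(3) gs by simp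
      also have "\<dots> = coboundary G B n (\<lambda>l. i (\<alpha> l) \<otimes>\<^bsub>B\<^esub> (\<gamma>' l \<otimes>\<^bsub>B\<^esub> f l)) gs"
        using \<alpha> f'(1) gs by (intro i.N.coboundary_cong) auto
      also have "\<dots> = coboundary G B n (\<lambda>l. i (\<alpha> l)) gs \<otimes>\<^bsub>B\<^esub>
          (coboundary G B n \<gamma>' gs \<otimes>\<^bsub>B\<^esub> coboundary G B n f gs)"
        using \<alpha> fB \<gamma>' f by (subst i.N.coboundary_mult[OF _ _ gs]; (subst i.N.coboundary_mult[OF _ _ gs])?) auto
      also have "\<dots> = i (coboundary G A n \<alpha> gs) \<otimes>\<^bsub>B\<^esub> (\<one>\<^bsub>B\<^esub> \<otimes>\<^bsub>B\<^esub> i (a gs))"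
        using gs \<gamma>'(3) a(2) by (simp add: i.coboundary_hom[OF \<alpha>1 gs])
      also have "\<dots> = i (coboundary G A n \<alpha> gs \<otimes>\<^bsub>A\<^esub> a gs)" using cl by simp
      finally show "a' gs = coboundary G A n \<alpha> gs \<otimes>\<^bsub>A\<^esub> a gs"
        by (rule inj_onD[OF inj]) (use cl in auto)
    qed
    then show "W = cohomology_class G A (Suc n) a" using Wa' by simp
  qed
qed

end

section \<open>Cohomology of cyclic groups\<close>

locale cyclic_group = group G for G :: "('g, 'x) monoid_scheme" (structure) +
  fixes \<sigma> :: 'g and m :: nat
  assumes order: "order G = m" and m_gt_1: "m > 1"
    and \<sigma>_closed [simp]: "\<sigma> \<in> carrier G" and generate: "generate G {\<sigma>} = carrier G"
begin

text \<open>The same choice of exponent as in \<open>act_poly\<close>, so that the action of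
  \<open>g\<close> is literally the power \<open>idx g\<close> of the substitution.\<close>

definition idx :: "'g \<Rightarrow> nat" where "idx g = (LEAST i. \<sigma> [^] i = g)"

lemma ord_\<sigma>: "ord \<sigma> = m"
  using generate_pow_card[OF \<sigma>_closed] generate order by (simp add: Coset.order_def)

lemma pow_\<sigma>_eq_iff: "\<sigma> [^] i = \<sigma> [^] j \<longleftrightarrow> i mod m = j mod m" for i j :: nat
proof -
  have "\<sigma> [^] i = \<sigma> [^] j \<longleftrightarrow> \<sigma> [^] int i = \<sigma> [^] int j" by (simp add: int_pow_int)
  also have "\<dots> \<longleftrightarrow> int m dvd int i - int j"
    by (simp add: int_pow_eq ord_\<sigma> dvd_diff_commute)
  also have "\<dots> \<longleftrightarrow> int i mod int m = int j mod int m" by (simp add: mod_eq_dvd_iff)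
  also have "\<dots> \<longleftrightarrow> i mod m = j mod m" by (simp flip: of_nat_mod)
  finally show ?thesis .
qed

lemma pow_idx [simp]: assumes "g \<in> carrier G" shows "\<sigma> [^] idx g = g"
proof -
  have "finite (carrier G)" using order m_gt_1 order_gt_0_iff_finite by simp
  then have "\<exists>i::nat. \<sigma> [^] i = g"
    using generate_pow_on_finite_carrier[OF _ \<sigma>_closed] generate assms by auto
  then show ?thesis unfolding idx_def by (rule LeastI_ex)
qed

lemma idx_pow [simp]: "idx (\<sigma> [^] (i::nat)) = i mod m"
  unfolding idx_def using m_gt_1 by (intro Least_equality) (auto simp: pow_\<sigma>_eq_iff, metis mod_less_eq_dividend)

lemma idx_less: "g \<in> carrier G \<Longrightarrow> idx g < m"
  using idx_pow[of "idx g"] m_gt_1 by (metis mod_less_divisor not_one_less_zero pow_idx gr0I)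

lemma idx_\<sigma>: "idx \<sigma> = 1"
  using idx_pow[of 1] m_gt_1 by simp

lemma idx_mult: assumes "g \<in> carrier G" "h \<in> carrier G" shows "idx (g \<otimes> h) = (idx g + idx h) mod m"
proof -
  have "g \<otimes> h = \<sigma> [^] (idx g + idx h)" using assms by (simp flip: nat_pow_mult)
  then show ?thesis by (simp only: idx_pow)
qed

text \<open>The coboundary of \<open>idx\<close> divided by \<open>m\<close> (see
  \<open>carry_eq\<close>). It is integer-valued because it serves as an exponent in arbitrary
  modules.\<close>

definition carry :: "'g \<Rightarrow> 'g \<Rightarrow> int" where "carry g h = int ((idx g + idx h) div m)"

lemma carry_eq:
  assumes "g \<in> carrier G" "h \<in> carrier G"
  shows "int m * carry g h = int (idx g) + int (idx h) - int (idx (g \<otimes> h))"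
proof -
  have "m * ((idx g + idx h) div m) + idx (g \<otimes> h) = idx g + idx h"
    using assms by (simp add: idx_mult)
  then have "int (m * ((idx g + idx h) div m) + idx (g \<otimes> h)) = int (idx g + idx h)" by metis
  then show ?thesis by (simp add: carry_def)
qed

text \<open>The 2-cocycle identity. After multiplication by \<open>m\<close> both sides become the
  same sum of indices, by associativity in \<open>G\<close>, and \<open>m\<close> can be cancelled
  in the integers.\<close>

lemma carry_assoc:
  assumes "g \<in> carrier G" "h \<in> carrier G" "k \<in> carrier G"
  shows "carry g h + carry (g \<otimes> h) k = carry h k + carry g (h \<otimes> k)"
proof -
  have "int m * (carry g h + carry (g \<otimes> h) k) = int m * (carry h k + carry g (h \<otimes> k))"
    using assms by (simp add: distrib_left carry_eq m_assoc)
  then show ?thesis using m_gt_1 by simp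
qed

lemma carry_\<sigma>_pow: "i < m \<Longrightarrow> carry \<sigma> (\<sigma> [^] i) = (if Suc i = m then 1 else 0)"
  using m_gt_1 by (auto simp: carry_def idx_\<sigma> div_less)

lemma carry_cases: assumes "g \<in> carrier G" "h \<in> carrier G"
  obtains "idx g + idx h < m" "carry g h = 0" "idx (g \<otimes> h) = idx g + idx h"
  | "idx g + idx h \<ge> m" "carry g h = 1" "idx (g \<otimes> h) = idx g + idx h - m"
proof (cases "idx g + idx h < m")
  case True then show ?thesis using that(1) assms by (simp add: carry_def idx_mult)
next
  case False
  have "idx g + idx h - m < m" using idx_less[OF assms(1)] idx_less[OF assms(2)] by simp
  moreover from this have "(idx g + idx h) div m = 1" using False by (intro div_nat_eqI) auto
  ultimately show ?thesis using that(2) False assms m_gt_1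
    by (simp add: carry_def idx_mult le_mod_geq)
qed

text \<open>In degree \<open>2 r\<close> this is the \<open>r\<close>-th cup power of the carry cocycle. Its values on tuples of odd length are
  irrelevant.\<close>

fun carries :: "'g list \<Rightarrow> int" where
  "carries [] = 1"
| "carries [g] = 0"
| "carries (g # h # gs) = carry g h * carries gs"

text \<open>Identities between exponents are proved with \<open>tdiff\<close> over the integers and
  transferred to a module along the powers of an element.\<close>

sublocale int: group_comm G integer_group
  by (intro group_comm.intro is_group abelian_integer_group)

lemma tdiff_scale: "gs \<in> tuples G (Suc n) \<Longrightarrow>
    tdiff G integer_group (\<lambda>l. a * f l) gs = a * tdiff G integer_group f gs"
proof (induction n arbitrary: f gs)
  case (Suc n)
  from Suc.prems obtain g h hs where gs: "gs = g # h # hs" "g \<in> carrier G" "h \<in> carrier G"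
      "hs \<in> tuples G n" by (auto elim!: tuples_SucE)
  show ?case using gs Suc.IH[of "h # hs" "\<lambda>l. f (g # l)"] by (simp add: algebra_simps)
qed (auto elim!: tuples_SucE)

text \<open>Since the action on the integers is trivial, this says that \<open>carries\<close> is a
  cocycle in even degrees. Two arguments are peeled off at a time, and what remains is
  \<open>carry_assoc\<close> times the value on the tail.\<close>

lemma tdiff_carries:
  "even n \<Longrightarrow> g \<in> carrier G \<Longrightarrow> gs \<in> tuples G n \<Longrightarrow> tdiff G integer_group carries (g # gs) = carries gs"
proof (induction n arbitrary: g gs rule: less_induct)
  case (less n)
  show ?case
  proof (cases n)
    case 0 then show ?thesis using less by simp
  next
    case (Suc n')
    with less.prems obtain j where n: "n = Suc (Suc j)" "even j" by (cases n') auto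
    then obtain h k hs where gs: "gs = h # k # hs" "h \<in> carrier G" "k \<in> carrier G" "hs \<in> tuples G j"
      using less.prems by (auto elim!: tuples_SucE)
    have IH: "tdiff G integer_group carries (k # hs) = carries hs"
      using n gs by (intro less.IH) auto
    have "tdiff G integer_group carries (g # gs) =
       carry (g \<otimes> h) k * carries hs - (carry g (h \<otimes> k) * carries hs -
         carry g h * carries hs)"
      using gs by (simp add: tdiff_scale[of _ j] IH)
    also have "\<dots> = carries gs"
      using arg_cong[OF carry_assoc[of g h k], of "\<lambda>x. x * carries hs"] gs less.prems
      by (simp add: algebra_simps)
    finally show ?thesis .
  qed
qed

end

section \<open>Carry cochains over a cyclic group\<close>

locale cyclic_module = G: cyclic_group G \<sigma> m + G_module G M
  for G :: "('g, 'x) monoid_scheme" and \<sigma> m and M :: "('a, 'g) gmodule" (structure)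
begin

lemma tdiff_pow:
  assumes "x \<in> carrier M" "gs \<in> tuples G (Suc n)"
  shows "tdiff G M (\<lambda>l. x [^] (f l :: int)) gs = x [^] tdiff G integer_group f gs"
  using assms hom_integer_group_pow[of x]
  by (intro G.int.tdiff_hom[where n=n, OF comm_group_axioms]) auto

text \<open>For even \<open>n\<close>, the cup product of the 0-cochain \<open>x\<close> with a
  power of the carry cocycle.\<close>

definition carry_cochain :: "'a \<Rightarrow> nat \<Rightarrow> 'g list \<Rightarrow> 'a" where
  "carry_cochain x n = (\<lambda>gs\<in>tuples G n. x [^] G.carries gs)"

lemma carry_cochain_closed: "x \<in> carrier M \<Longrightarrow> carry_cochain x n \<in> tuples G n \<rightarrow>\<^sub>E carrier M"
  by (auto simp: carry_cochain_def)

text \<open>The Leibniz rule: \<open>carries\<close> is a cocycle, so only the coboundary of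
  \<open>x\<close> survives. The action is kept general because the rule is applied to divisors that
  move under \<open>G\<close>.\<close>

lemma coboundary_carries:
  assumes "even n" "x \<in> carrier M" "g \<in> carrier G" "gs \<in> tuples G n"
  shows "coboundary G M n (\<lambda>l. x [^] G.carries l) (g # gs) = (act M g x \<otimes> inv x) [^] G.carries gs"
proof -
  interpret a: group_hom M M "act M g" using assms by unfold_locales (rule act_hom)
  have f: "(\<lambda>l. x [^] G.carries l) \<in> tuples G n \<rightarrow> carrier M" using assms by auto
  show ?thesis using assms
    by (simp add: coboundary_Cons[OF f] tdiff_pow[of _ _ n] G.tdiff_carries a.hom_int_pow
        int_pow_distrib int_pow_inv)
qed

text \<open>The Leibniz rule one degree higher: the first factor on the right is the coboundary of
  the 1-cochain \<open>u\<close>, cupped with the cocycle \<open>carries\<close>.\<close>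

lemma coboundary_cup_carries:
  assumes "even n" "u \<in> carrier G \<rightarrow> carrier M" "g \<in> carrier G" "h \<in> carrier G" "gs \<in> tuples G n"
  shows "coboundary G M (Suc n) (\<lambda>l. u (hd l) [^] G.carries (tl l)) (g # h # gs) =
    (act M g (u h) \<otimes> inv (u (g \<otimes>\<^bsub>G\<^esub> h)) \<otimes> u g) [^] G.carries gs"
proof -
  interpret a: group_hom M M "act M g" using assms by unfold_locales (rule act_hom)
  have f: "(\<lambda>l. u (hd l) [^] G.carries (tl l)) \<in> tuples G (Suc n) \<rightarrow> carrier M"
    using assms(2) by (auto elim!: tuples_SucE simp: Pi_iff)
  have u: "u g \<in> carrier M" "u h \<in> carrier M" "u (g \<otimes>\<^bsub>G\<^esub> h) \<in> carrier M"
    using assms by (auto simp: Pi_iff)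
  show ?thesis using assms u
    by (simp add: coboundary_Cons[OF f] tdiff_pow[of _ _ n] G.tdiff_carries a.hom_int_pow
        int_pow_distrib int_pow_inv inv_mult m_ac)
qed

end

section \<open>Trivial coefficients: the slant map and periodicity\<close>

locale trivial_cyclic_module = cyclic_module G \<sigma> m M
  for G :: "('g, 'x) monoid_scheme" and \<sigma> m and M :: "('a, 'g) gmodule" (structure) +
  assumes act_trivial: "g \<in> carrier G \<Longrightarrow> x \<in> carrier M \<Longrightarrow> act M g x = x"
begin

lemma carry_cochain_cocycle:
  assumes "even n" "x \<in> carrier M" shows "carry_cochain x n \<in> cocycles G M n"
proof (rule cocyclesI)
  show "carry_cochain x n \<in> tuples G n \<rightarrow>\<^sub>E carrier M" using assms carry_cochain_closed by auto
  fix gs assume gs: "gs \<in> tuples G (Suc n)"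
  then obtain g hs where g: "gs = g # hs" "g \<in> carrier G" "hs \<in> tuples G n" by (auto elim!: tuples_SucE)
  have "coboundary G M n (carry_cochain x n) gs = coboundary G M n (\<lambda>l. x [^] G.carries l) gs"
    using assms by (intro coboundary_cong gs) (auto simp: carry_cochain_def)
  also have "\<dots> = \<one>" using g assms by (simp add: coboundary_carries act_trivial)
  finally show "coboundary G M n (carry_cochain x n) gs = \<one>" .
qed

lemma coboundary_trivial:
  assumes "f \<in> tuples G n \<rightarrow> carrier M" "g \<in> carrier G" "gs \<in> tuples G n"
  shows "coboundary G M n f (g # gs) = f gs \<otimes> inv tdiff G M f (g # gs)"
  using assms coboundary_Cons[OF assms] act_trivial by (simp add: Pi_iff)

text \<open>The map inducing the inverse of the periodicity isomorphism.\<close>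

definition slant :: "('g list \<Rightarrow> 'a) \<Rightarrow> 'g list \<Rightarrow> 'a" where
  "slant f gs = finprod M (\<lambda>i. f (\<sigma> # \<sigma> [^]\<^bsub>G\<^esub> i # gs)) {..<m}"

lemma slant_closed:
  "f \<in> tuples G (Suc (Suc n)) \<rightarrow> carrier M \<Longrightarrow> gs \<in> tuples G n \<Longrightarrow> slant f gs \<in> carrier M"
  unfolding slant_def by (intro finprod_closed) auto

lemma pow_m: "\<sigma> [^]\<^bsub>G\<^esub> m = \<one>\<^bsub>G\<^esub>"
  using G.pow_\<sigma>_eq_iff[of m 0] by simp

text \<open>Both sides are the product of \<open>F\<close> over all of \<open>G\<close>, which right
  translation by \<open>g\<close> permutes.\<close>

lemma finprod_shift:
  assumes "F \<in> carrier G \<rightarrow> carrier M" "g \<in> carrier G"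
  shows "finprod M (\<lambda>i. F (\<sigma> [^]\<^bsub>G\<^esub> i \<otimes>\<^bsub>G\<^esub> g)) {..<m} = finprod M (\<lambda>i. F (\<sigma> [^]\<^bsub>G\<^esub> (i::nat))) {..<m}"
proof -
  have bij: "bij_betw (\<lambda>i. \<sigma> [^]\<^bsub>G\<^esub> (i::nat)) {..<m} (carrier G)"
    by (rule bij_betwI[where g=G.idx]) (auto simp: G.idx_less)
  have inj: "inj_on (\<lambda>x. x \<otimes>\<^bsub>G\<^esub> g) (carrier G)" using assms(2) by (simp add: inj_on_def)
  have im: "(\<lambda>x. x \<otimes>\<^bsub>G\<^esub> g) ` carrier G = carrier G"
  proof -
    have "x \<in> (\<lambda>x. x \<otimes>\<^bsub>G\<^esub> g) ` carrier G" if "x \<in> carrier G" for x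
      using that assms(2) by (intro image_eqI[of _ _ "x \<otimes>\<^bsub>G\<^esub> inv\<^bsub>G\<^esub> g"]) (auto simp: G.m_assoc)
    then show ?thesis using assms(2) by auto
  qed
  have "finprod M (\<lambda>i. F (\<sigma> [^]\<^bsub>G\<^esub> i \<otimes>\<^bsub>G\<^esub> g)) {..<m} = finprod M (\<lambda>x. F (x \<otimes>\<^bsub>G\<^esub> g)) ((\<lambda>i. \<sigma> [^]\<^bsub>G\<^esub> (i::nat)) ` {..<m})"
    using bij assms by (subst finprod_reindex) (auto simp: bij_betw_def)
  also have "(\<lambda>i. \<sigma> [^]\<^bsub>G\<^esub> (i::nat)) ` {..<m} = carrier G" using bij by (simp add: bij_betw_def)
  also have "finprod M (\<lambda>x. F (x \<otimes>\<^bsub>G\<^esub> g)) (carrier G) = finprod M F ((\<lambda>x. x \<otimes>\<^bsub>G\<^esub> g) ` carrier G)"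
    using inj im assms by (subst finprod_reindex) auto
  also have "\<dots> = finprod M F ((\<lambda>i. \<sigma> [^]\<^bsub>G\<^esub> (i::nat)) ` {..<m})" using bij im by (simp add: bij_betw_def)
  also have "\<dots> = finprod M (\<lambda>i. F (\<sigma> [^]\<^bsub>G\<^esub> (i::nat))) {..<m}"
    using bij assms by (subst finprod_reindex) (auto simp: bij_betw_def)
  finally show ?thesis .
qed

text \<open>The grouping anticipates \<open>h\<close> running through the powers of \<sigma>: the
  first two factors telescope, the third is shifted by \<open>g\<close>, and the last assembles to a
  \<open>tdiff\<close> in the remaining arguments.\<close>

lemma coboundary_\<sigma>:
  assumes f: "f \<in> tuples G (Suc (Suc n)) \<rightarrow> carrier M"
    and "h \<in> carrier G" "g \<in> carrier G" "gs \<in> tuples G n"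
  shows "coboundary G M (Suc (Suc n)) f (\<sigma> # h # g # gs) = f (h # g # gs) \<otimes> inv f (\<sigma> \<otimes>\<^bsub>G\<^esub> h # g # gs)
     \<otimes> (f (\<sigma> # h \<otimes>\<^bsub>G\<^esub> g # gs) \<otimes> inv tdiff G M (\<lambda>l. f (\<sigma> # h # l)) (g # gs))"
proof -
  have "tdiff G M (\<lambda>l. f (\<sigma> # h # l)) (g # gs) \<in> carrier M"
    using assms by (intro tdiff_closed[where n=n]) auto
  moreover have "f (h # g # gs) \<in> carrier M" "f (\<sigma> \<otimes>\<^bsub>G\<^esub> h # g # gs) \<in> carrier M"
    "f (\<sigma> # h \<otimes>\<^bsub>G\<^esub> g # gs) \<in> carrier M" using assms by auto
  ultimately show ?thesis using assms
    by (simp add: coboundary_trivial[OF f] inv_mult m_ac)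
qed

lemma finprod_telescope:
  assumes "F \<in> UNIV \<rightarrow> carrier M"
  shows "finprod M (\<lambda>i. F i \<otimes> inv F (Suc i)) {..<a} = F 0 \<otimes> inv F a"
proof (induction a)
  case 0 then show ?case using assms by (simp add: Pi_iff)
next
  case (Suc a)
  have F: "F i \<in> carrier M" for i using assms by auto
  have "finprod M (\<lambda>i. F i \<otimes> inv F (Suc i)) {..<Suc a} = F a \<otimes> inv F (Suc a) \<otimes> (F 0 \<otimes> inv F a)"
    using F by (simp add: lessThan_Suc Suc del: finprod_multf)
  also have "\<dots> = F 0 \<otimes> (F a \<otimes> inv F a) \<otimes> inv F (Suc a)"
    using F by (simp only: m_ac m_closed inv_closed)
  finally show ?case using F by simp
qed

text \<open>\<open>slant\<close> is a cochain map lowering the degree by two. The telescoping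
  factors close up because the \<open>m\<close>-th power of \<sigma> is 1, the shifted product is
  \<open>slant f\<close> on the tail, and the remaining product is \<open>tdiff\<close> of
  \<open>slant f\<close>.\<close>

lemma slant_coboundary:
  assumes f: "f \<in> tuples G (Suc (Suc n)) \<rightarrow> carrier M" and gs: "gs \<in> tuples G (Suc n)"
  shows "slant (coboundary G M (Suc (Suc n)) f) gs = coboundary G M n (slant f) gs"
proof -
  obtain g hs where g: "gs = g # hs" "g \<in> carrier G" "hs \<in> tuples G n" using gs by (auto elim!: tuples_SucE)
  let ?s = "\<lambda>i. \<sigma> [^]\<^bsub>G\<^esub> (i::nat)"
  define P where "P = (\<lambda>i. f (?s i # g # hs))"
  have P: "P \<in> UNIV \<rightarrow> carrier M" unfolding P_def using f g by auto
  have Q: "f (\<sigma> # ?s i \<otimes>\<^bsub>G\<^esub> g # hs) \<in> carrier M" for i using f g by auto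
  have R: "tdiff G M (\<lambda>l. f (\<sigma> # ?s i # l)) (g # hs) \<in> carrier M" for i
    using f g by (intro tdiff_closed[where n=n]) auto
  have Psuc: "f (\<sigma> \<otimes>\<^bsub>G\<^esub> ?s i # g # hs) = P (Suc i)" for i
    unfolding P_def using G.nat_pow_Suc2[of \<sigma> i] by simp
  have "slant (coboundary G M (Suc (Suc n)) f) gs = finprod M (\<lambda>i. P i \<otimes> inv P (Suc i)
     \<otimes> (f (\<sigma> # ?s i \<otimes>\<^bsub>G\<^esub> g # hs) \<otimes> inv tdiff G M (\<lambda>l. f (\<sigma> # ?s i # l)) (g # hs))) {..<m}"
    unfolding slant_def g(1) using g P Q R
    by (intro finprod_cong') (auto simp: coboundary_\<sigma>[OF f] Psuc Pi_iff, simp add: P_def)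
  also have "\<dots> = finprod M (\<lambda>i. P i \<otimes> inv P (Suc i)) {..<m} \<otimes>
     (finprod M (\<lambda>i. f (\<sigma> # ?s i \<otimes>\<^bsub>G\<^esub> g # hs)) {..<m} \<otimes>
     inv finprod M (\<lambda>i. tdiff G M (\<lambda>l. f (\<sigma> # ?s i # l)) (g # hs)) {..<m})"
    using P Q R by (simp add: Pi_iff finprod_inv[symmetric])
  also have "finprod M (\<lambda>i. P i \<otimes> inv P (Suc i)) {..<m} = \<one>"
    using P f g by (simp add: finprod_telescope del: finprod_multf) (simp add: P_def pow_m Pi_iff)
  also have "finprod M (\<lambda>i. f (\<sigma> # ?s i \<otimes>\<^bsub>G\<^esub> g # hs)) {..<m} = slant f hs"
    unfolding slant_def using f g by (intro finprod_shift[of "\<lambda>x. f (\<sigma> # x # hs)"]) auto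
  also have "finprod M (\<lambda>i. tdiff G M (\<lambda>l. f (\<sigma> # ?s i # l)) (g # hs)) {..<m} = tdiff G M (slant f) gs"
    unfolding slant_def[abs_def] g(1) using f g
    by (intro tdiff_finprod[where n=n, symmetric]) auto
  finally show ?thesis
    using g f slant_closed[OF f] tdiff_closed[OF _ gs, of "slant f"]
    by (simp add: coboundary_trivial[of "slant f"])
qed

lemma slant_cocycle:
  assumes "f \<in> cocycles G M (Suc (Suc n))"
  shows "restrict (slant f) (tuples G n) \<in> cocycles G M n"
proof (rule cocyclesI)
  have f: "f \<in> tuples G (Suc (Suc n)) \<rightarrow> carrier M" using cocyclesD(1)[OF assms] by auto
  then show "restrict (slant f) (tuples G n) \<in> tuples G n \<rightarrow>\<^sub>E carrier M" by (auto intro: slant_closed)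
  fix gs assume gs: "gs \<in> tuples G (Suc n)"
  have "coboundary G M n (restrict (slant f) (tuples G n)) gs = coboundary G M n (slant f) gs"
    by (intro coboundary_cong gs) (auto intro: slant_closed[OF f])
  also have "\<dots> = slant (coboundary G M (Suc (Suc n)) f) gs" by (rule slant_coboundary[OF f gs, symmetric])
  also have "\<dots> = \<one>" unfolding slant_def using gs cocyclesD(2)[OF assms] by (intro finprod_one_eqI) auto
  finally show "coboundary G M n (restrict (slant f) (tuples G n)) gs = \<one>" .
qed

end

lemma (in G_module) coboundary_inv:
  assumes "f \<in> tuples G n \<rightarrow> carrier M" "gs \<in> tuples G (Suc n)"
  shows "coboundary G M n (\<lambda>l. inv f l) gs = inv coboundary G M n f gs"
proof -
  obtain g hs where gs: "gs = g # hs" "g \<in> carrier G" "hs \<in> tuples G n"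
    using assms(2) by (auto elim!: tuples_SucE)
  have m: "(\<lambda>l. inv f l) \<in> tuples G n \<rightarrow> carrier M" using assms by auto
  have c: "tdiff G M f (g # hs) \<in> carrier M" "f hs \<in> carrier M"
    using assms gs by (auto intro!: tdiff_closed)
  then show ?thesis using gs assms m
    by (simp add: coboundary_Cons tdiff_inv act_inv inv_mult)
qed

lemma (in comm_monoid) finprod_lessThan_add:
  fixes a b :: nat
  assumes "F \<in> UNIV \<rightarrow> carrier G"
  shows "finprod G F {..<a + b} = finprod G (\<lambda>i. F (i + b)) {..<a} \<otimes> finprod G F {..<b}"
proof (induction a)
  case 0 then show ?case using assms by (simp add: Pi_iff)
next
  case (Suc a)
  have F: "F i \<in> carrier G" for i using assms by auto
  show ?case using F by (simp add: lessThan_Suc Suc m_assoc Pi_iff)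
qed

context trivial_cyclic_module
begin

text \<open>The cocycle identity at \<open>\<sigma>, \<sigma>\<^sup>i, g, \<dots>\<close> telescopes when it is multiplied over \<open>i < idx x\<close>. What
  remains is the coboundary of \<open>h' / h\<close>, except that the exponents wrap around modulo \<open>m\<close> when
  \<open>idx x + idx g\<close> exceeds \<open>m\<close>, which contributes the slant of \<open>f\<close>.\<close>

lemma cocycle_decomposition:
  assumes f: "f \<in> cocycles G M (Suc (Suc n))"
  obtains k where "k \<in> tuples G (Suc n) \<rightarrow> carrier M"
    "\<And>x g gs. x \<in> carrier G \<Longrightarrow> g \<in> carrier G \<Longrightarrow> gs \<in> tuples G n \<Longrightarrow>
      f (x # g # gs) = coboundary G M (Suc n) k (x # g # gs) \<otimes> slant f gs [^] G.carry x g"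
proof -
  have f1: "f \<in> tuples G (Suc (Suc n)) \<rightarrow> carrier M" using cocyclesD(1)[OF f] by auto
  have fc: "f (x # y # l) \<in> carrier M" if "x \<in> carrier G" "y \<in> carrier G" "l \<in> tuples G n" for x y l
    using f1 that by auto
  let ?s = "\<lambda>i. \<sigma> [^]\<^bsub>G\<^esub> (i::nat)"
  define h where "h = (\<lambda>l. finprod M (\<lambda>i. f (\<sigma> # ?s i # tl l)) {..<G.idx (hd l)})"
  \<comment> \<open>Since \<open>f\<close> is not assumed normalized, the telescoping product starts
    at the value of \<open>f\<close> with first argument 1; \<open>h'\<close> absorbs this
    value.\<close>
  define h' where "h' = (\<lambda>l. f (\<one>\<^bsub>G\<^esub> # l))"
  have h: "h \<in> tuples G (Suc n) \<rightarrow> carrier M"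
    unfolding h_def by (auto elim!: tuples_SucE intro!: finprod_closed fc)
  have h': "h' \<in> tuples G (Suc n) \<rightarrow> carrier M"
    unfolding h'_def by (auto elim!: tuples_SucE intro!: fc)
  define k where "k = (\<lambda>l. h' l \<otimes> inv h l)"
  have k: "k \<in> tuples G (Suc n) \<rightarrow> carrier M" using h h' unfolding k_def by auto
  show ?thesis
  proof (rule that[OF k])
    fix x g gs assume x: "x \<in> carrier G" and g: "g \<in> carrier G" and gs: "gs \<in> tuples G n"
    define P where "P = (\<lambda>i. f (?s i # g # gs))"
    define Q where "Q = (\<lambda>i. f (\<sigma> # ?s i \<otimes>\<^bsub>G\<^esub> g # gs))"
    define R where "R = (\<lambda>i. tdiff G M (\<lambda>l. f (\<sigma> # ?s i # l)) (g # gs))"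
    define a where "a = G.idx x"
    have P: "P i \<in> carrier M" for i unfolding P_def using g gs by (auto intro: fc)
    have Q: "Q i \<in> carrier M" for i unfolding Q_def using g gs by (auto intro: fc)
    have R: "R i \<in> carrier M" for i
      unfolding R_def using g gs by (intro tdiff_closed[where n=n]) (auto intro: fc)
    have Psuc: "f (\<sigma> \<otimes>\<^bsub>G\<^esub> ?s i # g # gs) = P (Suc i)" for i
      unfolding P_def using G.nat_pow_Suc2[of \<sigma> i] by simp
    have "P i \<otimes> inv P (Suc i) \<otimes> (Q i \<otimes> inv R i) = \<one>" for i
      using coboundary_\<sigma>[OF f1, of "?s i" g gs] cocyclesD(2)[OF f, of "\<sigma> # ?s i # g # gs"] g gs
      by (simp add: Psuc Q_def R_def) (simp add: P_def)
    then have "finprod M (\<lambda>i. P i \<otimes> inv P (Suc i) \<otimes> (Q i \<otimes> inv R i)) {..<a} = \<one>"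
      by (intro finprod_one_eqI)
    moreover have "finprod M (\<lambda>i. A i \<otimes> (Q i \<otimes> inv R i)) {..<a} =
      finprod M A {..<a} \<otimes> (finprod M Q {..<a} \<otimes> inv finprod M R {..<a})"
      if "\<And>i. A i \<in> carrier M" for A
      using that Q R by (simp add: Pi_iff finprod_inv)
    note this[of "\<lambda>i. P i \<otimes> inv P (Suc i)"]
    ultimately have 1: "P 0 \<otimes> inv P a \<otimes> (finprod M Q {..<a} \<otimes> inv finprod M R {..<a}) = \<one>"
      using P by (simp add: finprod_telescope del: finprod_multf)
    define PQ where "PQ = finprod M Q {..<a}"
    define PR where "PR = finprod M R {..<a}"
    have c: "PQ \<in> carrier M" "PR \<in> carrier M" "P 0 \<in> carrier M" "P a \<in> carrier M"
      unfolding PQ_def PR_def using P Q R by auto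
    have 1: "P 0 \<otimes> PQ = P a \<otimes> PR"
    proof -
      have "P 0 \<otimes> PQ = P 0 \<otimes> (inv P a \<otimes> P a) \<otimes> (PQ \<otimes> (inv PR \<otimes> PR))" using c by simp
      also have "\<dots> = (P 0 \<otimes> inv P a \<otimes> (PQ \<otimes> inv PR)) \<otimes> (P a \<otimes> PR)"
        using c by (simp only: m_ac m_closed inv_closed)
      finally show ?thesis using 1 c unfolding PQ_def[symmetric] PR_def[symmetric] by simp
    qed
    have PR: "PR = tdiff G M (\<lambda>l. h (x # l)) (g # gs)"
      unfolding PR_def R_def h_def list.sel a_def using g gs
      by (intro tdiff_finprod[where n=n, symmetric]) (auto intro: fc)
    define \<phi> where "\<phi> = (\<lambda>i. f (\<sigma> # ?s i # gs))"
    have \<phi>: "\<phi> i \<in> carrier M" for i unfolding \<phi>_def using gs by (auto intro: fc)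
    have hx: "h (y # gs) = finprod M \<phi> {..<G.idx y}" for y unfolding h_def \<phi>_def by simp
    have "?s i \<otimes>\<^bsub>G\<^esub> g = ?s (i + G.idx g)" for i using g by (simp flip: G.nat_pow_mult)
    then have PQ: "PQ = finprod M (\<lambda>i. \<phi> (i + G.idx g)) {..<a}"
      unfolding PQ_def Q_def \<phi>_def by simp
    have sl: "slant f gs = finprod M \<phi> {..<m}" unfolding slant_def \<phi>_def ..
    have per: "\<phi> (i + m) = \<phi> i" for i
      unfolding \<phi>_def by (simp add: pow_m flip: G.nat_pow_mult)
    have "PQ \<otimes> h (g # gs) = finprod M \<phi> {..<a + G.idx g}"
      unfolding hx PQ using \<phi> by (intro finprod_lessThan_add[symmetric]) auto
    also have "\<dots> = h (x \<otimes>\<^bsub>G\<^esub> g # gs) \<otimes> slant f gs [^] G.carry x g"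
    proof (rule G.carry_cases[OF x g])
      assume "G.idx x + G.idx g < m" "G.carry x g = 0" "G.idx (x \<otimes>\<^bsub>G\<^esub> g) = G.idx x + G.idx g"
      then show ?thesis using \<phi> unfolding hx a_def by simp
    next
      assume *: "m \<le> G.idx x + G.idx g" "G.carry x g = 1" "G.idx (x \<otimes>\<^bsub>G\<^esub> g) = G.idx x + G.idx g - m"
      \<comment> \<open>With a wrap-around the product runs over \<open>m\<close> further indices.
        Its first \<open>m\<close> factors form \<open>slant f gs\<close>, and the others are
        periodic, hence equal to those of \<open>h\<close> at the product of \<open>x\<close> and
        \<open>g\<close>.\<close>
      then have e: "a + G.idx g = G.idx (x \<otimes>\<^bsub>G\<^esub> g) + m" by (simp add: a_def)
      show ?thesis unfolding e hx sl using \<phi> *(2)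
        by (subst finprod_lessThan_add) (auto simp: per)
    qed
    finally have 2: "PQ \<otimes> h (g # gs) = h (x \<otimes>\<^bsub>G\<^esub> g # gs) \<otimes> slant f gs [^] G.carry x g" .
    have T1c: "tdiff G M h' (x # g # gs) \<in> carrier M"
      using h' x g gs by (intro tdiff_closed[where n="Suc n"]) auto
    \<comment> \<open>The cocycle identity with 1 in front: the action term and the first merge are
      the same value of \<open>f\<close>, so the rest, which is \<open>tdiff\<close> of
      \<open>h'\<close>, must be trivial.\<close>
    have "f (x # g # gs) \<otimes> inv (f (x # g # gs) \<otimes> inv tdiff G M h' (x # g # gs)) = \<one>"
      using cocyclesD(2)[OF f, of "\<one>\<^bsub>G\<^esub> # x # g # gs"] x g gs
      by (simp add: coboundary_trivial[OF f1] h'_def)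
    then have T1: "tdiff G M h' (x # g # gs) = \<one>"
      using T1c fc[OF x g gs] by (simp add: inv_mult m_assoc[symmetric])
    have hc: "h (y # gs) \<in> carrier M" if "y \<in> carrier G" for y using h that gs by auto
    have P0: "h' (g # gs) = P 0" unfolding h'_def P_def by simp
    have Pa: "f (x # g # gs) = P a" unfolding P_def a_def using x by simp
    have xg: "x # g # gs \<in> tuples G (Suc (Suc n))" using x g gs by simp
    have "coboundary G M (Suc n) k (x # g # gs) =
       coboundary G M (Suc n) h' (x # g # gs) \<otimes> inv coboundary G M (Suc n) h (x # g # gs)"
      unfolding k_def using h h' xg by (subst coboundary_mult) (auto simp: coboundary_inv)
    also have "coboundary G M (Suc n) h' (x # g # gs) = P 0"
      using x g gs c by (simp add: coboundary_trivial[OF h'] T1 P0 del: tdiff.simps)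
    also have "coboundary G M (Suc n) h (x # g # gs) = h (g # gs) \<otimes> inv (h (x \<otimes>\<^bsub>G\<^esub> g # gs) \<otimes> inv PR)"
      using x g gs by (simp add: coboundary_trivial[OF h] PR)
    finally have 3: "coboundary G M (Suc n) k (x # g # gs) =
        P 0 \<otimes> inv (h (g # gs) \<otimes> inv (h (x \<otimes>\<^bsub>G\<^esub> g # gs) \<otimes> inv PR))" .
    define S where "S = slant f gs [^] G.carry x g"
    have S: "S \<in> carrier M" unfolding S_def using slant_closed[OF f1 gs] by simp
    have h1: "h (g # gs) \<in> carrier M" "h (x \<otimes>\<^bsub>G\<^esub> g # gs) \<in> carrier M" using hc x g by auto
    have "P 0 \<otimes> inv (h (g # gs) \<otimes> inv (h (x \<otimes>\<^bsub>G\<^esub> g # gs) \<otimes> inv PR)) \<otimes> S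
       = (P 0 \<otimes> (h (x \<otimes>\<^bsub>G\<^esub> g # gs) \<otimes> S)) \<otimes> inv (h (g # gs) \<otimes> PR)"
      using h1 S c by (simp add: inv_quot inv_mult m_ac)
    also have "\<dots> = (P a \<otimes> (h (g # gs) \<otimes> PR)) \<otimes> inv (h (g # gs) \<otimes> PR)"
    proof -
      have "P 0 \<otimes> (h (x \<otimes>\<^bsub>G\<^esub> g # gs) \<otimes> S) = (P 0 \<otimes> PQ) \<otimes> h (g # gs)"
        using 2 c h1 unfolding S_def[symmetric] by (simp add: m_assoc)
      then show ?thesis unfolding 1 using c h1 by (simp add: m_ac)
    qed
    also have "\<dots> = P a" using c h1 by (simp add: m_assoc)
    finally show "f (x # g # gs) = coboundary G M (Suc n) k (x # g # gs) \<otimes> slant f gs [^] G.carry x g"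
      unfolding 3 Pa S_def by simp
  qed
qed

text \<open>The Leibniz rule for the carry placed in front of \<open>k\<close>: the carry is a
  cocycle of even degree, so only the coboundary of \<open>k\<close> contributes, with positive
  sign.\<close>

lemma coboundary_carry_cup:
  assumes k: "k \<in> tuples G n \<rightarrow> carrier M" and "x \<in> carrier G" "y \<in> carrier G" "g \<in> carrier G" "gs \<in> tuples G n"
  shows "coboundary G M (Suc (Suc n)) (\<lambda>l. k (tl (tl l)) [^] G.carry (hd l) (hd (tl l))) (x # y # g # gs)
     = coboundary G M n k (g # gs) [^] G.carry x y"
proof -
  have f: "(\<lambda>l. k (tl (tl l)) [^] G.carry (hd l) (hd (tl l))) \<in> tuples G (Suc (Suc n)) \<rightarrow> carrier M"
    using k by (auto elim!: tuples_SucE simp: Pi_iff)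
  have kc: "k gs \<in> carrier M" using assms by auto
  have tc: "tdiff G M k (g # gs) \<in> carrier M" using assms by (intro tdiff_closed[where n=n]) auto
  have pow_hom: "(\<lambda>x. x [^] (i::int)) \<in> hom M M" for i
    by (auto simp: hom_def int_pow_distrib)
  have t: "tdiff G M (\<lambda>l. k l [^] i) (g # gs) = tdiff G M k (g # gs) [^] i" for i :: int
    using assms by (intro tdiff_hom[where n=n, OF comm_group_axioms pow_hom]) auto
  have alg: "B \<otimes> inv (C \<otimes> inv (D \<otimes> inv T)) = A \<otimes> inv T"
    if "A \<in> carrier M" "B \<in> carrier M" "C \<in> carrier M" "D \<in> carrier M" "T \<in> carrier M"
      "B \<otimes> D = C \<otimes> A" for A B C D T
  proof -
    have "B \<otimes> inv (C \<otimes> inv (D \<otimes> inv T)) = (B \<otimes> D) \<otimes> (inv C \<otimes> inv T)"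
      using that(1-5) by (simp add: inv_quot inv_mult m_ac)
    also have "\<dots> = (inv C \<otimes> C) \<otimes> (A \<otimes> inv T)"
      unfolding that(6) using that(1-5) by (simp only: m_ac inv_closed m_closed)
    finally show ?thesis using that(1-5) by simp
  qed
  have "k gs [^] G.carry y g \<otimes> k gs [^] G.carry x (y \<otimes>\<^bsub>G\<^esub> g) = k gs [^] G.carry (x \<otimes>\<^bsub>G\<^esub> y) g \<otimes> k gs [^] G.carry x y"
    using G.carry_assoc[of x y g] assms kc by (simp add: add.commute flip: int_pow_mult)
  from alg[OF _ _ _ _ _ this, of "tdiff G M k (g # gs) [^] G.carry x y"] kc tc
  have "k gs [^] G.carry y g \<otimes> inv (k gs [^] G.carry (x \<otimes>\<^bsub>G\<^esub> y) g \<otimes> inv (k gs [^] G.carry x (y \<otimes>\<^bsub>G\<^esub> g) \<otimes>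
      inv (tdiff G M k (g # gs) [^] G.carry x y))) = k gs [^] G.carry x y \<otimes> inv (tdiff G M k (g # gs) [^] G.carry x y)"
    by simp
  then show ?thesis
    using assms kc tc
    by (simp add: coboundary_trivial[OF f] coboundary_trivial[OF k] t int_pow_distrib int_pow_inv)
qed

end

context trivial_cyclic_module
begin

text \<open>Replacing \<open>slant f\<close> by a cohomologous \<open>e\<close> changes the carry
  cup product by the coboundary of the carry cupped with \<open>j\<close>, and this cochain
  \<open>J\<close> is merged into \<open>k\<close>.\<close>

lemma cohomologous_step:
  assumes f: "f \<in> cocycles G M (Suc (Suc n))"
    and k: "k \<in> tuples G (Suc n) \<rightarrow> carrier M"
      "\<And>x g gs. x \<in> carrier G \<Longrightarrow> g \<in> carrier G \<Longrightarrow> gs \<in> tuples G n \<Longrightarrow>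
      f (x # g # gs) = coboundary G M (Suc n) k (x # g # gs) \<otimes> slant f gs [^] G.carry x g"
    and j: "n = Suc n'" "j \<in> tuples G n' \<rightarrow> carrier M"
    and e: "e \<in> tuples G n \<rightarrow> carrier M" "\<And>gs. gs \<in> tuples G n \<Longrightarrow> slant f gs = coboundary G M n' j gs \<otimes> e gs"
  obtains l where "l \<in> tuples G (Suc n) \<rightarrow> carrier M"
     "\<And>x g gs. x \<in> carrier G \<Longrightarrow> g \<in> carrier G \<Longrightarrow> gs \<in> tuples G n \<Longrightarrow>
      f (x # g # gs) = coboundary G M (Suc n) l (x # g # gs) \<otimes> e gs [^] G.carry x g"
proof -
  define J where "J = (\<lambda>l. j (tl (tl l)) [^] G.carry (hd l) (hd (tl l)))"
  have J: "J \<in> tuples G (Suc n) \<rightarrow> carrier M"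
    unfolding J_def j(1) using j(2) by (auto elim!: tuples_SucE simp: Pi_iff)
  show ?thesis
  proof (rule that[of "\<lambda>l. k l \<otimes> J l"])
    show "(\<lambda>l. k l \<otimes> J l) \<in> tuples G (Suc n) \<rightarrow> carrier M" using k(1) J by auto
    fix x g gs assume *: "x \<in> carrier G" "g \<in> carrier G" "gs \<in> tuples G n"
    then obtain h hs where hs: "gs = h # hs" "h \<in> carrier G" "hs \<in> tuples G n'"
      unfolding j(1) by (auto elim!: tuples_SucE)
    have c: "coboundary G M n' j gs \<in> carrier M" "e gs \<in> carrier M"
      "coboundary G M (Suc n) k (x # g # gs) \<in> carrier M"
      using j(2) * k(1) e(1) by (auto intro!: coboundary_closed simp: j(1) Pi_iff)
    have "coboundary G M (Suc n) J (x # g # gs) = coboundary G M n' j gs [^] G.carry x g"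
      unfolding J_def j(1) hs(1) using j(2) * hs by (intro coboundary_carry_cup) auto
    then show "f (x # g # gs) = coboundary G M (Suc n) (\<lambda>l. k l \<otimes> J l) (x # g # gs) \<otimes> e gs [^] G.carry x g"
      using * c by (simp add: k(2) e(2) coboundary_mult[OF k(1) J] int_pow_distrib m_assoc)
  qed
qed

text \<open>Up to a coboundary a cocycle is the carry cupped with its slant, a cocycle two degrees
  lower to which the induction applies. At the bottom a 0-cochain is just its value at the empty
  tuple.\<close>

theorem cohomology_even:
  assumes "even n" "f \<in> cocycles G M n"
  shows "\<exists>x\<in>carrier M. cohomology_class G M n f = cohomology_class G M n (carry_cochain x n)"
  using assms
proof (induction n arbitrary: f rule: less_induct)
  case (less n)
  show ?case
  proof (cases n)
    case 0
    have f: "f \<in> tuples G 0 \<rightarrow>\<^sub>E carrier M" using less.prems 0 cocyclesD(1) by blast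
    then have "f = carry_cochain (f []) 0"
      by (intro ext) (auto simp: carry_cochain_def PiE_iff extensional_def)
    moreover have "f [] \<in> carrier M" using f by auto
    ultimately show ?thesis unfolding 0 by metis
  next
    case (Suc n')
    with less.prems obtain r where n: "n = Suc (Suc r)" "even r" by (cases n') auto
    have f: "f \<in> cocycles G M (Suc (Suc r))" using less.prems n by simp
    obtain k where k: "k \<in> tuples G (Suc r) \<rightarrow> carrier M"
      "\<And>x g gs. x \<in> carrier G \<Longrightarrow> g \<in> carrier G \<Longrightarrow> gs \<in> tuples G r \<Longrightarrow>
        f (x # g # gs) = coboundary G M (Suc r) k (x # g # gs) \<otimes> slant f gs [^] G.carry x g"
      using cocycle_decomposition[OF f] by metis
    let ?e = "restrict (slant f) (tuples G r)"
    have "r < n" using n by simp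
    note IH = less.IH[OF this n(2) slant_cocycle[OF f]]
    obtain x where x: "x \<in> carrier M"
      "cohomology_class G M r ?e = cohomology_class G M r (carry_cochain x r)"
      by (rule bexE[OF IH])
    have e: "?e \<in> tuples G r \<rightarrow>\<^sub>E carrier M" using slant_cocycle[OF f] cocyclesD(1) by blast
    have cx: "carry_cochain x r \<in> tuples G r \<rightarrow>\<^sub>E carrier M" using x carry_cochain_closed by simp
    obtain b where b: "b \<in> coboundaries G M r" "?e = b \<otimes>\<^bsub>cochain_group G M r\<^esub> carry_cochain x r"
      using x(2) cohomology_class_eq_iff[OF e cx] by auto
    have be: "slant f gs = b gs \<otimes> x [^] G.carries gs" if "gs \<in> tuples G r" for gs
      using fun_cong[OF b(2), of gs] that by (simp add: mult_cochain_group carry_cochain_def)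
    obtain l where l: "l \<in> tuples G (Suc r) \<rightarrow> carrier M"
     "\<And>y g gs. y \<in> carrier G \<Longrightarrow> g \<in> carrier G \<Longrightarrow> gs \<in> tuples G r \<Longrightarrow>
      f (y # g # gs) = coboundary G M (Suc r) l (y # g # gs) \<otimes> (x [^] G.carries gs) [^] G.carry y g"
    \<comment> \<open>In degree 0 the coboundary \<open>b\<close> is trivial and no correction
      arises; otherwise it comes from a cochain \<open>j\<close> that
      \<open>cohomologous_step\<close> moves into the correcting cochain.\<close>
    proof (cases r)
      case 0
      have "slant f gs = x [^] G.carries gs" if "gs \<in> tuples G r" for gs
        using be[OF that] b(1) x that unfolding 0 by (simp add: coboundaries_def one_cochain_group)
      then show ?thesis using that[OF k(1)] k(2) by simp
    next
      case (Suc r')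
      then obtain j where j: "j \<in> tuples G r' \<rightarrow>\<^sub>E carrier M" "b = coboundary G M r' j"
        using b(1) by (auto simp: coboundaries_def)
      have j': "j \<in> tuples G r' \<rightarrow> carrier M" using j by auto
      show ?thesis
        by (rule cohomologous_step[OF f k Suc j', where e="\<lambda>gs. x [^] G.carries gs"])
          (use x be j that in auto)
    qed
    have "cohomology_class G M n f = cohomology_class G M n (carry_cochain x n)"
      unfolding n(1)
    proof (rule cohomology_class_eqI[OF _ _ l(1)])
      show "f \<in> tuples G (Suc (Suc r)) \<rightarrow>\<^sub>E carrier M" using cocyclesD(1)[OF f] .
      show "carry_cochain x (Suc (Suc r)) \<in> tuples G (Suc (Suc r)) \<rightarrow>\<^sub>E carrier M"
        using x carry_cochain_closed by simp
      fix gs assume "gs \<in> tuples G (Suc (Suc r))"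
      then obtain y g hs where gs: "gs = y # g # hs" "y \<in> carrier G" "g \<in> carrier G" "hs \<in> tuples G r"
        by (auto elim!: tuples_SucE)
      then show "f gs = coboundary G M (Suc r) l gs \<otimes> carry_cochain x (Suc (Suc r)) gs"
        using x by (simp add: l(2) carry_cochain_def int_pow_pow mult.commute)
    qed
    then show ?thesis using x by auto
  qed
qed

text \<open>The slant map brings the problem down to degree 1. There a cocycle for the trivial
  action is a homomorphism, whose value at \<sigma> is killed by \<open>m\<close> and hence trivial
  by \<open>tf\<close>.\<close>

theorem cohomology_odd:
  assumes tf: "\<And>x. x \<in> carrier M \<Longrightarrow> x [^] m = \<one> \<Longrightarrow> x = \<one>"
    and "odd n" "f \<in> cocycles G M n"
  shows "cohomology_class G M n f = \<one>\<^bsub>cohomology G M n\<^esub>"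
  using assms(2,3)
proof (induction n arbitrary: f rule: less_induct)
  case (less n)
  then obtain n' where n': "n = Suc n'" "even n'" by (cases n) auto
  show ?case
  proof (cases n')
    case 0
    have f: "f \<in> tuples G 1 \<rightarrow>\<^sub>E carrier M" using less.prems n' 0 cocyclesD(1) by fastforce
    then have f1: "f \<in> tuples G (Suc 0) \<rightarrow> carrier M" by auto
    have fc: "f [x] \<in> carrier M" if "x \<in> carrier G" for x using f1 that by auto
    have hom: "f [x \<otimes>\<^bsub>G\<^esub> y] = f [x] \<otimes> f [y]" if xy: "x \<in> carrier G" "y \<in> carrier G" for x y
    proof -
      have "coboundary G M 1 f [x, y] = \<one>" using less.prems n' 0 xy by (intro cocyclesD(2)) auto
      then have "f [y] \<otimes> inv (f [x \<otimes>\<^bsub>G\<^esub> y] \<otimes> inv f [x]) = \<one>"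
        using xy coboundary_trivial[OF f1, of x "[y]"] by simp
      then have "f [x] \<otimes> f [y] \<otimes> inv f [x \<otimes>\<^bsub>G\<^esub> y] = \<one>"
        using fc xy by (simp add: inv_mult m_ac)
      then show ?thesis using fc xy by (metis G.m_closed inv_equality inv_inv inv_closed m_closed)
    qed
    interpret F: group_hom G M "\<lambda>x. f [x]"
      by unfold_locales (auto simp: hom_def fc hom)
    have "f [\<sigma>] [^] m = \<one>" using F.hom_nat_pow[of \<sigma> m] pow_m by simp
    then have s: "f [\<sigma>] = \<one>" by (rule tf[OF fc[OF G.\<sigma>_closed]])
    have "f [x] = \<one>" if "x \<in> carrier G" for x
      using F.hom_nat_pow[of \<sigma> "G.idx x"] that s by simp
    then have "f gs = coboundary G M 0 (\<lambda>_. \<one>) gs" if "gs \<in> tuples G (Suc 0)" for gs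
      using that coboundary_one[OF that] by (auto elim!: tuples_SucE)
    then show ?thesis unfolding n'(1) 0 using f by (intro cohomology_class_eq_oneI[where f="\<lambda>_. \<one>"]) auto
  next
    case (Suc r)
    with n' have n: "n = Suc (Suc r)" "odd r" by auto
    then obtain r' where r': "r = Suc r'" by (cases r) auto
    have f: "f \<in> cocycles G M (Suc (Suc r))" using less.prems n by simp
    obtain k where k: "k \<in> tuples G (Suc r) \<rightarrow> carrier M"
      "\<And>x g gs. x \<in> carrier G \<Longrightarrow> g \<in> carrier G \<Longrightarrow> gs \<in> tuples G r \<Longrightarrow>
        f (x # g # gs) = coboundary G M (Suc r) k (x # g # gs) \<otimes> slant f gs [^] G.carry x g"
      using cocycle_decomposition[OF f] by metis
    let ?e = "restrict (slant f) (tuples G r)"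
    have "cohomology_class G M r ?e = \<one>\<^bsub>cohomology G M r\<^esub>"
      by (rule less.IH[OF _ n(2) slant_cocycle[OF f]]) (simp add: n(1))
    moreover have "?e \<in> tuples G r \<rightarrow>\<^sub>E carrier M" using slant_cocycle[OF f] cocyclesD(1) by blast
    ultimately obtain j where j: "j \<in> tuples G r' \<rightarrow> carrier M"
        "\<And>gs. gs \<in> tuples G r \<Longrightarrow> ?e gs = coboundary G M r' j gs"
      unfolding r' using cohomology_class_eq_oneD by metis
    have sl: "slant f gs = coboundary G M r' j gs \<otimes> \<one>" if "gs \<in> tuples G r" for gs
      using j(2)[OF that] that coboundary_closed[OF j(1)] by (simp add: r')
    obtain l where l: "l \<in> tuples G (Suc r) \<rightarrow> carrier M"
     "\<And>y g gs. y \<in> carrier G \<Longrightarrow> g \<in> carrier G \<Longrightarrow> gs \<in> tuples G r \<Longrightarrow>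
      f (y # g # gs) = coboundary G M (Suc r) l (y # g # gs) \<otimes> \<one> [^] G.carry y g"
      by (rule cohomologous_step[OF f k r' j(1), where e="\<lambda>gs. \<one>"]) (use sl in auto)
    show ?thesis unfolding n(1)
    proof (rule cohomology_class_eq_oneI[OF _ l(1)])
      show "f \<in> tuples G (Suc (Suc r)) \<rightarrow>\<^sub>E carrier M" using cocyclesD(1)[OF f] .
      fix gs assume gs: "gs \<in> tuples G (Suc (Suc r))"
      then show "f gs = coboundary G M (Suc r) l gs"
        using l coboundary_closed[OF l(1) gs] by (auto elim!: tuples_SucE)
    qed
  qed
qed

text \<open>Among the powers of \<sigma> with exponent below \<open>m\<close>, only exponent
  \<open>m - 1\<close> produces a carry when multiplied by \<sigma>, so a single factor survives.
  Thus \<open>slant\<close> undoes the cup product with the carry.\<close>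

lemma slant_carries:
  assumes "x \<in> carrier M"
  shows "slant (\<lambda>l. x [^] G.carries l) gs = x [^] G.carries gs"
proof -
  have "slant (\<lambda>l. x [^] G.carries l) gs =
      finprod M (\<lambda>i. if m - 1 = i then x [^] G.carries gs else \<one>) {..<m}"
    unfolding slant_def using assms G.m_gt_1 by (intro finprod_cong') (auto simp: G.carry_\<sigma>_pow)
  also have "\<dots> = x [^] G.carries gs"
    using assms G.m_gt_1 by (subst finprod_singleton) auto
  finally show ?thesis .
qed

text \<open>Slanting both sides lowers the degree by two and leaves \<open>x\<close> fixed, until a
  1-cochain \<open>f\<close> remains. Multiplying its coboundary over the powers of \<sigma> then
  telescopes, except for a constant factor that contributes the \<open>m\<close>-th power of
  \<open>f [\<sigma>]\<close>.\<close>

lemma carries_coboundary_imp_power: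
  assumes "x \<in> carrier M" "f \<in> tuples G (Suc (2 * r)) \<rightarrow> carrier M"
    "\<And>gs. gs \<in> tuples G (Suc (Suc (2 * r))) \<Longrightarrow> x [^] G.carries gs = coboundary G M (Suc (2 * r)) f gs"
  shows "\<exists>y\<in>carrier M. x = y [^] m"
  using assms(2,3)
proof (induction r arbitrary: f)
  case 0
  let ?s = "\<lambda>i. \<sigma> [^]\<^bsub>G\<^esub> (i::nat)"
  have fc: "f [y] \<in> carrier M" if "y \<in> carrier G" for y using 0(1) that by auto
  have "x = slant (\<lambda>l. x [^] G.carries l) []" using assms(1) by (simp add: slant_carries)
  also have "\<dots> = finprod M (\<lambda>i. (f [?s i] \<otimes> inv f [?s (Suc i)]) \<otimes> f [\<sigma>]) {..<m}"
    unfolding slant_def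
  proof (intro finprod_cong' refl)
    fix i assume "i \<in> {..<m}"
    have "x [^] G.carries [\<sigma>, ?s i] = coboundary G M (Suc (2 * 0)) f [\<sigma>, ?s i]"
      by (rule 0(2)) simp
    also have "\<dots> = f [?s i] \<otimes> inv f [?s (Suc i)] \<otimes> f [\<sigma>]"
      using coboundary_trivial[OF 0(1), of \<sigma> "[?s i]"] fc G.nat_pow_Suc2[of \<sigma> i]
      by (simp add: inv_quot inv_mult m_ac)
    finally show "x [^] G.carries [\<sigma>, ?s i] = f [?s i] \<otimes> inv f [?s (Suc i)] \<otimes> f [\<sigma>]" .
  qed (use fc in auto)
  also have "\<dots> = finprod M (\<lambda>i. f [?s i] \<otimes> inv f [?s (Suc i)]) {..<m} \<otimes> finprod M (\<lambda>i. f [\<sigma>]) {..<m}"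
    using fc by (intro finprod_multf) (auto simp del: G.nat_pow_Suc)
  also have "finprod M (\<lambda>i. f [?s i] \<otimes> inv f [?s (Suc i)]) {..<m} = \<one>"
    using fc finprod_telescope[of "\<lambda>i. f [?s i]" m] pow_m by simp
  also have "finprod M (\<lambda>i. f [\<sigma>]) {..<m} = f [\<sigma>] [^] m" using fc by (simp add: finprod_const)
  finally show ?case using fc by auto
next
  case (Suc r)
  have f: "f \<in> tuples G (Suc (Suc (Suc (2 * r)))) \<rightarrow> carrier M" using Suc.prems(1) by simp
  show ?case
  proof (rule Suc.IH[of "slant f"])
    show "slant f \<in> tuples G (Suc (2 * r)) \<rightarrow> carrier M" using slant_closed[OF f] by auto
    fix gs assume gs: "gs \<in> tuples G (Suc (Suc (2 * r)))"
    have "x [^] G.carries gs = slant (\<lambda>l. x [^] G.carries l) gs" using assms(1) by (simp add: slant_carries)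
    also have "\<dots> = slant (coboundary G M (Suc (Suc (Suc (2 * r)))) f) gs"
      unfolding slant_def
    proof (intro finprod_cong' refl)
      fix i
      have "x [^] G.carries (\<sigma> # \<sigma> [^]\<^bsub>G\<^esub> (i::nat) # gs) = coboundary G M (Suc (2 * Suc r)) f (\<sigma> # \<sigma> [^]\<^bsub>G\<^esub> i # gs)"
        using gs by (intro Suc.prems(2)) auto
      then show "x [^] G.carries (\<sigma> # \<sigma> [^]\<^bsub>G\<^esub> (i::nat) # gs) = coboundary G M (Suc (Suc (Suc (2 * r)))) f (\<sigma> # \<sigma> [^]\<^bsub>G\<^esub> i # gs)"
        by simp
    qed (use gs in \<open>auto intro!: coboundary_closed[OF f]\<close>)
    also have "\<dots> = coboundary G M (Suc (2 * r)) (slant f) gs" by (rule slant_coboundary[OF f gs])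
    finally show "x [^] G.carries gs = coboundary G M (Suc (2 * r)) (slant f) gs" .
  qed
qed

text \<open>By \<open>carry_eq\<close> the coboundary of \<open>idx\<close> is \<open>m\<close>
  times the carry; so the \<open>m\<close>-th power of \<open>y\<close> on the carry is the
  coboundary of \<open>y\<close> raised to \<open>idx\<close>, and cupping with
  \<open>carries\<close> extends this to all even degrees.\<close>

lemma carries_power_coboundary:
  assumes "even n" "y \<in> carrier M" "gs \<in> tuples G (Suc (Suc n))"
  shows "(y [^] m) [^] G.carries gs =
    coboundary G M (Suc n) (\<lambda>l. (y [^] int (G.idx (hd l))) [^] G.carries (tl l)) gs"
proof -
  obtain g h hs where gs: "gs = g # h # hs" "g \<in> carrier G" "h \<in> carrier G" "hs \<in> tuples G n"
    using assms(3) by (auto elim!: tuples_SucE)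
  have "coboundary G M (Suc n) (\<lambda>l. (y [^] int (G.idx (hd l))) [^] G.carries (tl l)) gs =
    (y [^] int (G.idx h) \<otimes> inv (y [^] int (G.idx (g \<otimes>\<^bsub>G\<^esub> h))) \<otimes> y [^] int (G.idx g)) [^] G.carries hs"
    using gs assms coboundary_cup_carries[of n "\<lambda>g. y [^] int (G.idx g)" g h hs]
    by (simp add: act_trivial)
  also have "y [^] int (G.idx h) \<otimes> inv (y [^] int (G.idx (g \<otimes>\<^bsub>G\<^esub> h))) \<otimes> y [^] int (G.idx g) =
     y [^] (int (G.idx h) - int (G.idx (g \<otimes>\<^bsub>G\<^esub> h)) + int (G.idx g))"
    using assms by (simp only: int_pow_mult int_pow_diff)
  also have "\<dots> = (y [^] m) [^] G.carry g h"
  proof -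
    have "int (G.idx h) - int (G.idx (g \<otimes>\<^bsub>G\<^esub> h)) + int (G.idx g) = int m * G.carry g h"
      using gs G.carry_eq[of g h] by simp
    then show ?thesis using assms by (simp add: int_pow_pow flip: int_pow_int)
  qed
  finally show ?thesis using gs assms by (simp add: int_pow_pow)
qed

text \<open>Together with \<open>cohomology_even\<close> this identifies the cohomology in positive
  even degree with the module modulo its \<open>m\<close>-th powers.\<close>

theorem carry_cochain_trivial_iff:
  assumes "even n" "n > 0" "x \<in> carrier M"
  shows "cohomology_class G M n (carry_cochain x n) = \<one>\<^bsub>cohomology G M n\<^esub> \<longleftrightarrow> (\<exists>y\<in>carrier M. x = y [^] m)"
proof -
  obtain r where r: "n = Suc (Suc (2 * r))" using assms by (metis Suc_pred dvdE even_Suc odd_Suc_div_two odd_pos evenE mult_Suc_right add_2_eq_Suc)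
  have cl: "carry_cochain x n \<in> tuples G n \<rightarrow>\<^sub>E carrier M" using assms carry_cochain_closed by simp
  show ?thesis
  proof
    assume "cohomology_class G M n (carry_cochain x n) = \<one>\<^bsub>cohomology G M n\<^esub>"
    then obtain f where f: "f \<in> tuples G (Suc (2 * r)) \<rightarrow> carrier M"
      "\<And>gs. gs \<in> tuples G n \<Longrightarrow> carry_cochain x n gs = coboundary G M (Suc (2 * r)) f gs"
      using cohomology_class_eq_oneD[of "carry_cochain x n" "Suc (2 * r)"] cl unfolding r by metis
    then show "\<exists>y\<in>carrier M. x = y [^] m"
      using assms by (intro carries_coboundary_imp_power[of x f r]) (auto simp: r carry_cochain_def)
  next
    assume "\<exists>y\<in>carrier M. x = y [^] m"
    then obtain y where y: "y \<in> carrier M" "x = y [^] m" by auto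
    show "cohomology_class G M n (carry_cochain x n) = \<one>\<^bsub>cohomology G M n\<^esub>"
      unfolding r
      by (rule cohomology_class_eq_oneI[where f="\<lambda>l. (y [^] int (G.idx (hd l))) [^] G.carries (tl l)"])
        (use y cl r carries_power_coboundary[of "2 * r" y] in \<open>auto simp: carry_cochain_def\<close>)
  qed
qed

lemma carry_cochain_hom: "even n \<Longrightarrow>
   (\<lambda>x. cohomology_class G M n (carry_cochain x n)) \<in> hom M (cohomology G M n)"
proof -
  assume n: "even n"
  have "(\<lambda>x. carry_cochain x n) \<in> hom M (cocycle_group n)"
    using n by (auto simp: hom_def carry_cochain_cocycle mult_cochain_group)
      (auto simp: carry_cochain_def fun_eq_iff int_pow_distrib)
  then show ?thesis using cohomology_class_hom[of n] unfolding hom_def by (auto simp: Pi_iff)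
qed

end

section \<open>The double connecting homomorphism\<close>

locale G_exact4 = i: G_module_hom G A B i + p: G_module_hom G B C p + q: G_module_hom G C D q
  for G :: "('g, 'x) monoid_scheme" and A :: "('a, 'g) gmodule" and i and B :: "('b, 'g) gmodule"
    and p and C :: "('c, 'g) gmodule" and q and D :: "('d, 'g) gmodule" +
  assumes inj: "inj_on i (carrier A)"
    and exact_B: "kernel B C p = i ` carrier A"
    and exact_C: "kernel C D q = p ` carrier B"
    and surj: "q ` carrier C = carrier D"
begin

abbreviation "C' \<equiv> C\<lparr>carrier := p ` carrier B\<rparr>"

lemma G_module_image: "G_module G C'"
proof -
  have sub: "subgroup (p ` carrier B) C" by (rule p.img_is_subgroup)
  interpret C': comm_group C'
    by (rule p.N.subgroup_imp_comm_group[OF sub])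
  show ?thesis
    by (unfold_locales) (auto simp flip: p.equivariant p.hom_mult i.N.act_mult i.N.act_act
      simp: p.N.act_mult p.N.act_act)
qed

sublocale C': G_module G C' by (rule G_module_image)

sublocale incl: G_module_hom G C' C "\<lambda>x. x"
  by (unfold_locales) (auto simp: hom_def)

sublocale res: G_module_hom G B C' p
  by (unfold_locales) (auto simp: hom_def p.equivariant)

sublocale s1: G_short_exact G C' "\<lambda>x. x" C q D
  by (unfold_locales) (auto simp: exact_C surj)

sublocale s2: G_short_exact G A i B p C'
  by (unfold_locales) (use inj exact_B in \<open>auto simp: kernel_def\<close>)

text \<open>The recipe for evaluating the double connecting map from chosen lifts. The intermediate
  cocycle is the coboundary of \<open>f\<close>, regarded as a cochain in the image of
  \<open>p\<close>, for which \<open>h\<close> is the second lift.\<close>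

lemma double_connecting_class:
  assumes "c \<in> cocycles G D n"
    and "f \<in> tuples G n \<rightarrow> carrier C" "\<And>gs. gs \<in> tuples G n \<Longrightarrow> q (f gs) = c gs"
    and "h \<in> tuples G (Suc n) \<rightarrow> carrier B"
      "\<And>gs. gs \<in> tuples G (Suc n) \<Longrightarrow> p (h gs) = coboundary G C n f gs"
    and "a \<in> tuples G (Suc (Suc n)) \<rightarrow>\<^sub>E carrier A"
      "\<And>gs. gs \<in> tuples G (Suc (Suc n)) \<Longrightarrow> i (a gs) = coboundary G B (Suc n) h gs"
  shows "double_connecting G A i B p C q n (cohomology_class G D n c) = cohomology_class G A (Suc (Suc n)) a"
proof -
  let ?w = "\<lambda>gs\<in>tuples G (Suc n). coboundary G C n f gs"
  have w: "?w \<in> tuples G (Suc n) \<rightarrow>\<^sub>E carrier C'"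
    using assms(4,5) by (auto simp flip: assms(5))
  have "connecting G C' (\<lambda>x. x) C q n (cohomology_class G D n c) = cohomology_class G C' (Suc n) ?w"
    and coc: "?w \<in> cocycles G C' (Suc n)"
    using s1.connecting_class[OF assms(1-3) w] by auto
  moreover have "connecting G A i B p (Suc n) (cohomology_class G C' (Suc n) ?w) =
       cohomology_class G A (Suc (Suc n)) a"
    using assms by (intro s2.connecting_class(2)[OF coc]) auto
  ultimately show ?thesis by (simp add: double_connecting_def)
qed

end

locale cyclic_exact4 = cyc: cyclic_group G \<sigma> m + G_exact4 G A i B p C q D
  for G :: "('g, 'x) monoid_scheme" and \<sigma> m and A :: "('a, 'g) gmodule" and i and B :: "('b, 'g) gmodule"
    and p and C :: "('c, 'g) gmodule" and q and D :: "('d, 'g) gmodule" +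
  assumes trivial_A: "g \<in> carrier G \<Longrightarrow> x \<in> carrier A \<Longrightarrow> act A g x = x"
    and trivial_D: "g \<in> carrier G \<Longrightarrow> y \<in> carrier D \<Longrightarrow> act D g y = y"
begin

sublocale A: trivial_cyclic_module G \<sigma> m A
  by unfold_locales (rule trivial_A)

sublocale D: trivial_cyclic_module G \<sigma> m D
  by unfold_locales (rule trivial_D)

sublocale B: cyclic_module G \<sigma> m B ..
sublocale C: cyclic_module G \<sigma> m C ..

text \<open>Cup products with carries reduce every even degree to the lifts \<open>y\<close> and \<open>u\<close> used in degree zero.\<close>

lemma double_connecting_carry_cochain:
  assumes "even n" "y \<in> carrier C" "u \<in> carrier G \<rightarrow> carrier B" "x \<in> carrier A"
    and u: "\<And>g. g \<in> carrier G \<Longrightarrow> p (u g) = act C g y \<otimes>\<^bsub>C\<^esub> inv\<^bsub>C\<^esub> y"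
    and du: "\<And>g h. g \<in> carrier G \<Longrightarrow> h \<in> carrier G \<Longrightarrow>
      act B g (u h) \<otimes>\<^bsub>B\<^esub> inv\<^bsub>B\<^esub> (u (g \<otimes>\<^bsub>G\<^esub> h)) \<otimes>\<^bsub>B\<^esub> u g = i x [^]\<^bsub>B\<^esub> cyc.carry g h"
  shows "double_connecting G A i B p C q n (cohomology_class G D n (D.carry_cochain (q y) n)) =
     cohomology_class G A (n + 2) (A.carry_cochain x (n + 2))"
proof -
  have "double_connecting G A i B p C q n (cohomology_class G D n (D.carry_cochain (q y) n)) =
     cohomology_class G A (Suc (Suc n)) (A.carry_cochain x (Suc (Suc n)))"
  proof (rule double_connecting_class[where f="\<lambda>l. y [^]\<^bsub>C\<^esub> cyc.carries l"
        and h="\<lambda>l. u (hd l) [^]\<^bsub>B\<^esub> cyc.carries (tl l)"])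
    show "D.carry_cochain (q y) n \<in> cocycles G D n"
      using assms by (intro D.carry_cochain_cocycle) auto
    show "(\<lambda>l. y [^]\<^bsub>C\<^esub> cyc.carries l) \<in> tuples G n \<rightarrow> carrier C" using assms by auto
    show "q (y [^]\<^bsub>C\<^esub> cyc.carries gs) = D.carry_cochain (q y) n gs" if "gs \<in> tuples G n" for gs
      using assms that by (simp add: D.carry_cochain_def q.hom_int_pow)
    show "(\<lambda>l. u (hd l) [^]\<^bsub>B\<^esub> cyc.carries (tl l)) \<in> tuples G (Suc n) \<rightarrow> carrier B"
      using assms by (auto elim!: tuples_SucE simp: Pi_iff)
    show "p (u (hd gs) [^]\<^bsub>B\<^esub> cyc.carries (tl gs)) = coboundary G C n (\<lambda>l. y [^]\<^bsub>C\<^esub> cyc.carries l) gs"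
      if gs: "gs \<in> tuples G (Suc n)" for gs
    proof -
      obtain g hs where g: "gs = g # hs" "g \<in> carrier G" "hs \<in> tuples G n" using gs by (auto elim!: tuples_SucE)
      then show ?thesis using assms(1-3) C.coboundary_carries[of n y g hs]
        by (auto simp: p.hom_int_pow u Pi_iff)
    qed
    show "A.carry_cochain x (Suc (Suc n)) \<in> tuples G (Suc (Suc n)) \<rightarrow>\<^sub>E carrier A"
      using assms by (intro A.carry_cochain_closed)
    show "i (A.carry_cochain x (Suc (Suc n)) gs) =
       coboundary G B (Suc n) (\<lambda>l. u (hd l) [^]\<^bsub>B\<^esub> cyc.carries (tl l)) gs"
      if gs: "gs \<in> tuples G (Suc (Suc n))" for gs
    proof -
      obtain g h hs where g: "gs = g # h # hs" "g \<in> carrier G" "h \<in> carrier G" "hs \<in> tuples G n"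
        using gs by (auto elim!: tuples_SucE)
      then show ?thesis using assms(1-4) B.coboundary_cup_carries[of n u g h hs]
        by (simp add: A.carry_cochain_def i.hom_int_pow du i.N.int_pow_pow)
    qed
  qed
  then show ?thesis by simp
qed

lemma double_connecting_one:
  "double_connecting G A i B p C q n \<one>\<^bsub>cohomology G D n\<^esub> = \<one>\<^bsub>cohomology G A (n + 2)\<^esub>"
proof -
  have "double_connecting G A i B p C q n (cohomology_class G D n \<one>\<^bsub>cochain_group G D n\<^esub>) =
     cohomology_class G A (Suc (Suc n)) \<one>\<^bsub>cochain_group G A (Suc (Suc n))\<^esub>"
  proof (rule double_connecting_class[where f="\<lambda>l. \<one>\<^bsub>C\<^esub>" and h="\<lambda>l. \<one>\<^bsub>B\<^esub>"])
    show "\<one>\<^bsub>cochain_group G D n\<^esub> \<in> cocycles G D n"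
      by (rule subgroup.one_closed[OF q.N.subgroup_cocycles])
    show "\<one>\<^bsub>cochain_group G A (Suc (Suc n))\<^esub> \<in> tuples G (Suc (Suc n)) \<rightarrow>\<^sub>E carrier A"
      using i.M.cochain.one_closed[of "Suc (Suc n)"] by simp
  qed (auto simp: i.M.one_cochain_group q.N.one_cochain_group i.N.coboundary_one p.N.coboundary_one)
  then show ?thesis by (simp add: q.N.one_cohomology i.M.one_cohomology)
qed

text \<open>The source of the double connecting map is already trivial, because it has odd degree
  and \<open>D\<close> has no \<open>m\<close>-torsion.\<close>

theorem Am_odd:
  assumes "\<And>x. x \<in> carrier D \<Longrightarrow> x [^]\<^bsub>D\<^esub> m = \<one>\<^bsub>D\<^esub> \<Longrightarrow> x = \<one>\<^bsub>D\<^esub>" "odd n" "n \<ge> 2"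
  shows "carrier (Am_group G A i B p C q D n) = {\<one>\<^bsub>cohomology G A n\<^esub>}"
proof -
  have "odd (n - 2)" using assms by simp
  then have "cohomology_class G D (n - 2) f = \<one>\<^bsub>cohomology G D (n - 2)\<^esub>" if "f \<in> cocycles G D (n - 2)" for f
    using D.cohomology_odd[OF assms(1)] that by blast
  moreover have "\<one>\<^bsub>cochain_group G D (n - 2)\<^esub> \<in> cocycles G D (n - 2)"
    by (rule subgroup.one_closed[OF q.N.subgroup_cocycles])
  ultimately have "carrier (cohomology G D (n - 2)) = {\<one>\<^bsub>cohomology G D (n - 2)\<^esub>}"
    unfolding q.N.carrier_cohomology by (metis (no_types, lifting) image_cong image_constant)
  moreover have "n - 2 + 2 = n" using assms by simp
  ultimately show ?thesis using double_connecting_one[of "n - 2"] by (simp add: Am_group_def)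
qed

text \<open>Every class in the source is the carry cochain of a power of \<open>q y\<close>. The
  lifting data \<open>y\<close>, \<open>u\<close>, \<open>x\<close> raised to the power
  \<open>l\<close> are again lifting data, so the computation for the generator covers all of its
  powers.\<close>

lemma Am_even_carrier:
  assumes "even n" "n \<ge> 2" "y \<in> carrier C" "u \<in> carrier G \<rightarrow> carrier B" "x \<in> carrier A"
    and u: "\<And>g. g \<in> carrier G \<Longrightarrow> p (u g) = act C g y \<otimes>\<^bsub>C\<^esub> inv\<^bsub>C\<^esub> y"
    and du: "\<And>g h. g \<in> carrier G \<Longrightarrow> h \<in> carrier G \<Longrightarrow>
      act B g (u h) \<otimes>\<^bsub>B\<^esub> inv\<^bsub>B\<^esub> (u (g \<otimes>\<^bsub>G\<^esub> h)) \<otimes>\<^bsub>B\<^esub> u g = i x [^]\<^bsub>B\<^esub> cyc.carry g h"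
    and gen: "carrier D = range (\<lambda>l::int. q y [^]\<^bsub>D\<^esub> l)"
  shows "carrier (Am_group G A i B p C q D n) =
     range (\<lambda>l::int. cohomology_class G A n (A.carry_cochain (x [^]\<^bsub>A\<^esub> l) n))"
proof -
  have n: "even (n - 2)" "n - 2 + 2 = n" using assms by auto
  have yl: "double_connecting G A i B p C q (n - 2) (cohomology_class G D (n - 2) (D.carry_cochain (q y [^]\<^bsub>D\<^esub> l) (n - 2)))
     = cohomology_class G A n (A.carry_cochain (x [^]\<^bsub>A\<^esub> l) n)" for l :: int
  proof -
    have "double_connecting G A i B p C q (n - 2) (cohomology_class G D (n - 2) (D.carry_cochain (q (y [^]\<^bsub>C\<^esub> l)) (n - 2)))
     = cohomology_class G A (n - 2 + 2) (A.carry_cochain (x [^]\<^bsub>A\<^esub> l) (n - 2 + 2))"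
    proof (rule double_connecting_carry_cochain[where u="\<lambda>g. u g [^]\<^bsub>B\<^esub> l"])
      fix g assume g: "g \<in> carrier G"
      interpret a: group_hom C C "act C g" using p.N.act_hom[OF g] by unfold_locales
      show "p (u g [^]\<^bsub>B\<^esub> l) = act C g (y [^]\<^bsub>C\<^esub> l) \<otimes>\<^bsub>C\<^esub> inv\<^bsub>C\<^esub> (y [^]\<^bsub>C\<^esub> l)"
        using g assms(3,4) by (simp add: p.hom_int_pow Pi_iff u a.hom_int_pow p.N.int_pow_distrib p.N.int_pow_inv)
      interpret b: group_hom B B "act B g" using i.N.act_hom[OF g] by unfold_locales
      fix h assume h: "h \<in> carrier G"
      have c: "u g \<in> carrier B" "u h \<in> carrier B" "u (g \<otimes>\<^bsub>G\<^esub> h) \<in> carrier B" "i x \<in> carrier B"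
        using g h assms(4,5) by (auto simp: Pi_iff)
      have "(act B g (u h) \<otimes>\<^bsub>B\<^esub> inv\<^bsub>B\<^esub> (u (g \<otimes>\<^bsub>G\<^esub> h)) \<otimes>\<^bsub>B\<^esub> u g) [^]\<^bsub>B\<^esub> l = (i x [^]\<^bsub>B\<^esub> cyc.carry g h) [^]\<^bsub>B\<^esub> l"
        using du[OF g h] by simp
      then show "act B g (u h [^]\<^bsub>B\<^esub> l) \<otimes>\<^bsub>B\<^esub> inv\<^bsub>B\<^esub> (u (g \<otimes>\<^bsub>G\<^esub> h) [^]\<^bsub>B\<^esub> l) \<otimes>\<^bsub>B\<^esub> u g [^]\<^bsub>B\<^esub> l =
          i (x [^]\<^bsub>A\<^esub> l) [^]\<^bsub>B\<^esub> cyc.carry g h"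
        using g c assms(5) by (simp add: b.hom_int_pow i.hom_int_pow i.N.int_pow_distrib i.N.int_pow_inv
            i.N.int_pow_pow mult.commute)
    qed (use assms n in \<open>auto simp: Pi_iff\<close>)
    then show ?thesis using n assms by (simp add: q.hom_int_pow)
  qed
  have "carrier (cohomology G D (n - 2)) =
     range (\<lambda>l::int. cohomology_class G D (n - 2) (D.carry_cochain (q y [^]\<^bsub>D\<^esub> l) (n - 2)))" (is "?L = ?R")
  proof
    show "?L \<subseteq> ?R"
    proof
      fix Z assume "Z \<in> ?L"
      then obtain f where "f \<in> cocycles G D (n - 2)" "Z = cohomology_class G D (n - 2) f"
        by (auto simp: q.N.carrier_cohomology)
      then obtain z where "z \<in> carrier D" "Z = cohomology_class G D (n - 2) (D.carry_cochain z (n - 2))"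
        using D.cohomology_even[OF n(1)] by blast
      then show "Z \<in> ?R" unfolding gen by auto
    qed
    show "?R \<subseteq> ?L" unfolding q.N.carrier_cohomology using n assms
      by (auto intro!: imageI D.carry_cochain_cocycle)
  qed
  then show ?thesis by (simp add: Am_group_def image_image yl)
qed

end

section \<open>Modules of homomorphisms\<close>

locale two_G_modules = D: G_module G D + M: G_module G M
  for G :: "('g, 'x) monoid_scheme" and D :: "('d, 'g) gmodule" and M :: "('a, 'g) gmodule"
begin

lemma hom_module_simps:
  "carrier (hom_module G D M) = hom D M \<inter> extensional (carrier D)"
  "\<phi> \<otimes>\<^bsub>hom_module G D M\<^esub> \<psi> = (\<lambda>x\<in>carrier D. \<phi> x \<otimes>\<^bsub>M\<^esub> \<psi> x)"
  "\<one>\<^bsub>hom_module G D M\<^esub> = (\<lambda>x\<in>carrier D. \<one>\<^bsub>M\<^esub>)"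
  "act (hom_module G D M) g \<phi> = (\<lambda>x\<in>carrier D. act M g (\<phi> (act D (inv\<^bsub>G\<^esub> g) x)))"
  by (simp_all add: hom_module_def)

lemma hom_closed: "\<phi> \<in> hom D M \<Longrightarrow> x \<in> carrier D \<Longrightarrow> \<phi> x \<in> carrier M"
  by (rule hom_in_carrier)

lemma hom_mult': "\<phi> \<in> hom D M \<Longrightarrow> x \<in> carrier D \<Longrightarrow> y \<in> carrier D \<Longrightarrow> \<phi> (x \<otimes>\<^bsub>D\<^esub> y) = \<phi> x \<otimes>\<^bsub>M\<^esub> \<phi> y"
  by (simp add: hom_mult)

lemma comm_group_hom_module: "comm_group (hom_module G D M)"
proof (rule comm_groupI; unfold hom_module_simps)
  fix \<phi> assume \<phi>: "\<phi> \<in> hom D M \<inter> extensional (carrier D)"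
  then show "\<exists>\<psi>\<in>hom D M \<inter> extensional (carrier D).
      (\<lambda>x\<in>carrier D. \<psi> x \<otimes>\<^bsub>M\<^esub> \<phi> x) = (\<lambda>x\<in>carrier D. \<one>\<^bsub>M\<^esub>)"
    by (intro bexI[of _ "\<lambda>x\<in>carrier D. inv\<^bsub>M\<^esub> (\<phi> x)"])
      (auto intro!: homI restrict_ext simp: hom_closed hom_mult' M.inv_mult)
next
  fix \<phi> \<psi>
  assume "\<phi> \<in> hom D M \<inter> extensional (carrier D)" "\<psi> \<in> hom D M \<inter> extensional (carrier D)"
  then show "(\<lambda>x\<in>carrier D. \<phi> x \<otimes>\<^bsub>M\<^esub> \<psi> x) \<in> hom D M \<inter> extensional (carrier D)"
    by (auto intro!: homI simp: hom_closed hom_mult' M.m_ac)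
next
  fix \<phi> assume "\<phi> \<in> hom D M \<inter> extensional (carrier D)"
  then show "(\<lambda>x\<in>carrier D. (\<lambda>x\<in>carrier D. \<one>\<^bsub>M\<^esub>) x \<otimes>\<^bsub>M\<^esub> \<phi> x) = \<phi>"
    by (auto simp: fun_eq_iff extensional_def hom_closed)
qed (auto intro!: homI restrict_ext simp: hom_closed M.m_ac)

lemma act_hom_module_closed:
  assumes "g \<in> carrier G" "\<phi> \<in> hom D M"
  shows "(\<lambda>x\<in>carrier D. act M g (\<phi> (act D (inv\<^bsub>G\<^esub> g) x))) \<in> hom D M"
  using assms by (intro homI) (simp_all add: hom_closed hom_mult' D.act_mult M.act_mult)

sublocale H: G_module G "hom_module G D M"
proof -
  interpret C: comm_group "hom_module G D M" by (rule comm_group_hom_module)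
  show "G_module G (hom_module G D M)"
  proof
    fix g \<phi> assume *: "g \<in> carrier G" "\<phi> \<in> carrier (hom_module G D M)"
    show "act (hom_module G D M) g \<phi> \<in> carrier (hom_module G D M)"
      using * act_hom_module_closed by (simp add: hom_module_simps)
    fix \<psi> assume "\<psi> \<in> carrier (hom_module G D M)"
    then show "act (hom_module G D M) g (\<phi> \<otimes>\<^bsub>hom_module G D M\<^esub> \<psi>) =
        act (hom_module G D M) g \<phi> \<otimes>\<^bsub>hom_module G D M\<^esub> act (hom_module G D M) g \<psi>"
      using * by (auto simp: hom_module_simps hom_closed M.act_mult intro!: restrict_ext)
  next
    fix g h \<phi> assume *: "g \<in> carrier G" "h \<in> carrier G" "\<phi> \<in> carrier (hom_module G D M)"
    then show "act (hom_module G D M) (g \<otimes>\<^bsub>G\<^esub> h) \<phi> =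
        act (hom_module G D M) g (act (hom_module G D M) h \<phi>)"
      by (auto simp: hom_module_simps hom_closed M.act_act D.act_act D.G.inv_mult_group intro!: restrict_ext)
  qed
qed

end

section \<open>Homomorphisms out of an infinite cyclic module\<close>

locale infinite_cyclic_module = D: G_module G D
  for G :: "('g, 'x) monoid_scheme" and D :: "('d, 'g) gmodule" +
  fixes z :: 'd
  assumes z: "z \<in> carrier D"
    and gen: "carrier D = range (\<lambda>l::int. z [^]\<^bsub>D\<^esub> l)"
    and free: "\<And>l::int. z [^]\<^bsub>D\<^esub> l = \<one>\<^bsub>D\<^esub> \<Longrightarrow> l = 0"
    and trivial: "\<And>g y. g \<in> carrier G \<Longrightarrow> y \<in> carrier D \<Longrightarrow> act D g y = y"
begin

lemma pow_z_inj: "z [^]\<^bsub>D\<^esub> (k::int) = z [^]\<^bsub>D\<^esub> (l::int) \<longleftrightarrow> k = l"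
proof
  assume "z [^]\<^bsub>D\<^esub> k = z [^]\<^bsub>D\<^esub> l"
  then have "z [^]\<^bsub>D\<^esub> (k - l) = \<one>\<^bsub>D\<^esub>" using z by (simp add: D.int_pow_diff)
  then show "k = l" using free by fastforce
qed simp

definition exponent :: "'d \<Rightarrow> int" where "exponent x = (THE l. x = z [^]\<^bsub>D\<^esub> l)"

lemma exponent_pow [simp]: "exponent (z [^]\<^bsub>D\<^esub> l) = l"
  by (simp add: exponent_def pow_z_inj)

lemma torsion_free:
  assumes "x \<in> carrier D" "x [^]\<^bsub>D\<^esub> m = \<one>\<^bsub>D\<^esub>" "(m::nat) > 0"
  shows "x = \<one>\<^bsub>D\<^esub>"
proof -
  obtain l :: int where l: "x = z [^]\<^bsub>D\<^esub> l" using assms gen by auto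
  have "z [^]\<^bsub>D\<^esub> (l * int m) = x [^]\<^bsub>D\<^esub> int m" using l z by (simp add: D.int_pow_pow)
  also have "\<dots> = \<one>\<^bsub>D\<^esub>" using assms(2) by (simp add: int_pow_int)
  finally have "l * int m = 0" by (rule free)
  then show ?thesis using assms(3) l by simp
qed

end

locale cyclic_hom = infinite_cyclic_module G D z + M: G_module G M
  for G :: "('g, 'x) monoid_scheme" and D :: "('d, 'g) gmodule" and z and M :: "('a, 'g) gmodule"
begin

sublocale two_G_modules G D M ..

text \<open>The inverse of evaluation at the generator \<open>z\<close>.\<close>

definition lift :: "'a \<Rightarrow> 'd \<Rightarrow> 'a" where
  "lift w = (\<lambda>x\<in>carrier D. w [^]\<^bsub>M\<^esub> exponent x)"

lemma lift_closed: assumes "w \<in> carrier M" shows "lift w \<in> carrier (hom_module G D M)"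
proof -
  have "lift w \<in> hom D M"
  proof (rule homI)
    fix x y assume "x \<in> carrier D" "y \<in> carrier D"
    then obtain k l :: int where "x = z [^]\<^bsub>D\<^esub> k" "y = z [^]\<^bsub>D\<^esub> l" using gen by auto
    then show "lift w (x \<otimes>\<^bsub>D\<^esub> y) = lift w x \<otimes>\<^bsub>M\<^esub> lift w y"
      using z assms by (simp add: lift_def M.int_pow_mult D.int_pow_mult[symmetric])
  qed (simp add: lift_def assms)
  then show ?thesis by (simp add: hom_module_simps lift_def)
qed

lemma lift_z: "w \<in> carrier M \<Longrightarrow> lift w z = w"
  using z exponent_pow[of 1] by (simp add: lift_def)

lemma hom_module_eqI:
  assumes "\<phi> \<in> carrier (hom_module G D M)" "\<psi> \<in> carrier (hom_module G D M)" "\<phi> z = \<psi> z"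
  shows "\<phi> = \<psi>"
proof (rule extensionalityI[of _ "carrier D"])
  fix x assume "x \<in> carrier D"
  then obtain l :: int where "x = z [^]\<^bsub>D\<^esub> l" using gen by auto
  then show "\<phi> x = \<psi> x" using assms z hom_int_pow[of \<phi> D M z] hom_int_pow[of \<psi> D M z]
    by (simp add: hom_module_simps)
qed (use assms in \<open>auto simp: hom_module_simps\<close>)

text \<open>Evaluation at \<open>z\<close> is equivariant because \<open>G\<close> acts trivially on
  \<open>D\<close>. With \<open>hom_module_eqI\<close> it reduces every identity in a module of
  homomorphisms to one in \<open>M\<close>.\<close>

sublocale ev: G_module_hom G "hom_module G D M" M "\<lambda>\<phi>. \<phi> z"
  by (unfold_locales) (auto intro!: homI simp: hom_module_simps z trivial hom_closed)

end

locale cyclic_exact4_free = cyclic_exact4 G \<sigma> m A i B p C q D + infinite_cyclic_module G D z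
  for G :: "('g, 'x) monoid_scheme" and \<sigma> m and A :: "('a, 'g) gmodule" and i and B :: "('b, 'g) gmodule"
    and p and C :: "('c, 'g) gmodule" and q and D :: "('d, 'g) gmodule" and z
begin

sublocale hA: cyclic_hom G D z A ..
sublocale hB: cyclic_hom G D z B ..
sublocale hC: cyclic_hom G D z C ..
sublocale hD: cyclic_hom G D z D ..

end

lemma (in infinite_cyclic_module) G_module_hom_compose:
  assumes "G_module_hom G M N f"
  shows "G_module_hom G (hom_module G D M) (hom_module G D N) (compose (carrier D) f)"
proof -
  interpret f: G_module_hom G M N f by fact
  interpret M: cyclic_hom G D z M ..
  interpret N: cyclic_hom G D z N ..
  show ?thesis
  proof
    show "compose (carrier D) f \<in> hom (hom_module G D M) (hom_module G D N)"
      by (rule homI) (auto intro!: homI restrict_ext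
         simp: M.hom_module_simps N.hom_module_simps compose_def M.hom_closed M.hom_mult')
    fix g \<phi> assume "g \<in> carrier G" "\<phi> \<in> carrier (hom_module G D M)"
    then show "compose (carrier D) f (act (hom_module G D M) g \<phi>) =
      act (hom_module G D N) g (compose (carrier D) f \<phi>)"
      by (auto intro!: restrict_ext
         simp: M.hom_module_simps N.hom_module_simps compose_def M.hom_closed f.equivariant)
  qed
qed

context cyclic_exact4_free
begin

sublocale hi: G_module_hom G "hom_module G D A" "hom_module G D B" "compose (carrier D) i"
  by (rule G_module_hom_compose) unfold_locales
sublocale hp: G_module_hom G "hom_module G D B" "hom_module G D C" "compose (carrier D) p"
  by (rule G_module_hom_compose) unfold_locales
sublocale hq: G_module_hom G "hom_module G D C" "hom_module G D D" "compose (carrier D) q"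
  by (rule G_module_hom_compose) unfold_locales

lemma compose_z [simp]: "compose (carrier D) f \<phi> z = f (\<phi> z)"
  using z by (simp add: compose_def)

text \<open>Exactness survives \<open>Hom(D, -)\<close> because \<open>D\<close> is free on
  \<open>z\<close>: preimages are found for the value at \<open>z\<close> and extended by
  \<open>lift\<close>.\<close>

sublocale hom: cyclic_exact4 G \<sigma> m "hom_module G D A" "compose (carrier D) i" "hom_module G D B"
   "compose (carrier D) p" "hom_module G D C" "compose (carrier D) q" "hom_module G D D"
proof
  show "inj_on (compose (carrier D) i) (carrier (hom_module G D A))"
  proof (rule inj_onI)
    fix \<phi> \<psi> assume *: "\<phi> \<in> carrier (hom_module G D A)" "\<psi> \<in> carrier (hom_module G D A)"
      "compose (carrier D) i \<phi> = compose (carrier D) i \<psi>"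
    have "i (\<phi> z) = i (\<psi> z)" using fun_cong[OF *(3), of z] by simp
    then have "\<phi> z = \<psi> z" using inj * by (auto dest: inj_onD)
    then show "\<phi> = \<psi>" using * hA.hom_module_eqI by blast
  qed
  show "kernel (hom_module G D B) (hom_module G D C) (compose (carrier D) p) =
      compose (carrier D) i ` carrier (hom_module G D A)"
  proof (intro Set.set_eqI iffI)
    fix \<phi> assume "\<phi> \<in> kernel (hom_module G D B) (hom_module G D C) (compose (carrier D) p)"
    then have \<phi>: "\<phi> \<in> carrier (hom_module G D B)"
      "compose (carrier D) p \<phi> = \<one>\<^bsub>hom_module G D C\<^esub>" by (auto simp: kernel_def)
    have "p (\<phi> z) = \<one>\<^bsub>C\<^esub>" using fun_cong[OF \<phi>(2), of z] z by (simp add: hC.hom_module_simps)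
    then have "\<phi> z \<in> i ` carrier A" unfolding exact_B[symmetric] using \<phi> by (simp add: kernel_def)
    then obtain x where x: "x \<in> carrier A" "\<phi> z = i x" by auto
    have "\<phi> = compose (carrier D) i (hA.lift x)"
      using \<phi> x hA.lift_closed[OF x(1)] hA.lift_z[OF x(1)] by (intro hB.hom_module_eqI) auto
    then show "\<phi> \<in> compose (carrier D) i ` carrier (hom_module G D A)" using hA.lift_closed[OF x(1)] by blast
  next
    fix \<phi> assume "\<phi> \<in> compose (carrier D) i ` carrier (hom_module G D A)"
    then obtain \<psi> where \<psi>: "\<psi> \<in> carrier (hom_module G D A)" "\<phi> = compose (carrier D) i \<psi>" by auto
    have "p (i (\<psi> z)) = \<one>\<^bsub>C\<^esub>" using exact_B hA.ev.hom_closed[OF \<psi>(1)] by (auto simp: kernel_def)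
    then have "compose (carrier D) p \<phi> = \<one>\<^bsub>hom_module G D C\<^esub>"
      using \<psi> by (intro hC.hom_module_eqI) auto
    then show "\<phi> \<in> kernel (hom_module G D B) (hom_module G D C) (compose (carrier D) p)"
      using \<psi> by (simp add: kernel_def)
  qed
  show "kernel (hom_module G D C) (hom_module G D D) (compose (carrier D) q) =
      compose (carrier D) p ` carrier (hom_module G D B)"
  proof (intro Set.set_eqI iffI)
    fix \<phi> assume "\<phi> \<in> kernel (hom_module G D C) (hom_module G D D) (compose (carrier D) q)"
    then have \<phi>: "\<phi> \<in> carrier (hom_module G D C)"
      "compose (carrier D) q \<phi> = \<one>\<^bsub>hom_module G D D\<^esub>" by (auto simp: kernel_def)
    have "q (\<phi> z) = \<one>\<^bsub>D\<^esub>" using fun_cong[OF \<phi>(2), of z] z by (simp add: hD.hom_module_simps)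
    then have "\<phi> z \<in> p ` carrier B" unfolding exact_C[symmetric] using \<phi> by (simp add: kernel_def)
    then obtain x where x: "x \<in> carrier B" "\<phi> z = p x" by auto
    have "\<phi> = compose (carrier D) p (hB.lift x)"
      using \<phi> x hB.lift_closed[OF x(1)] hB.lift_z[OF x(1)] by (intro hC.hom_module_eqI) auto
    then show "\<phi> \<in> compose (carrier D) p ` carrier (hom_module G D B)" using hB.lift_closed[OF x(1)] by blast
  next
    fix \<phi> assume "\<phi> \<in> compose (carrier D) p ` carrier (hom_module G D B)"
    then obtain \<psi> where \<psi>: "\<psi> \<in> carrier (hom_module G D B)" "\<phi> = compose (carrier D) p \<psi>" by auto
    have "q (p (\<psi> z)) = \<one>\<^bsub>D\<^esub>" using exact_C hB.ev.hom_closed[OF \<psi>(1)] by (auto simp: kernel_def)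
    then have "compose (carrier D) q \<phi> = \<one>\<^bsub>hom_module G D D\<^esub>"
      using \<psi> by (intro hD.hom_module_eqI) auto
    then show "\<phi> \<in> kernel (hom_module G D C) (hom_module G D D) (compose (carrier D) q)"
      using \<psi> by (simp add: kernel_def)
  qed
  show "compose (carrier D) q ` carrier (hom_module G D C) = carrier (hom_module G D D)"
  proof (intro Set.set_eqI iffI)
    fix \<phi> assume \<phi>: "\<phi> \<in> carrier (hom_module G D D)"
    then have "\<phi> z \<in> q ` carrier C" using surj by simp
    then obtain x where x: "x \<in> carrier C" "\<phi> z = q x" by auto
    have "\<phi> = compose (carrier D) q (hC.lift x)"
      using \<phi> x hC.lift_closed[OF x(1)] hC.lift_z[OF x(1)] by (intro hD.hom_module_eqI) auto
    then show "\<phi> \<in> compose (carrier D) q ` carrier (hom_module G D C)" using hC.lift_closed[OF x(1)] by blast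
  qed auto
  fix g assume g: "g \<in> carrier G"
  show "act (hom_module G D A) g \<phi> = \<phi>" if "\<phi> \<in> carrier (hom_module G D A)" for \<phi>
    using that g by (intro hA.hom_module_eqI) (auto simp: hA.ev.equivariant trivial_A)
  show "act (hom_module G D D) g \<phi> = \<phi>" if "\<phi> \<in> carrier (hom_module G D D)" for \<phi>
    using that g by (intro hD.hom_module_eqI) (auto simp: hD.ev.equivariant trivial_D)
qed

text \<open>The identity of \<open>D\<close> is \<open>q\<close> composed with
  \<open>lift y\<close>, so the degree 0 case of the carry computation applies to the lifts of
  \<open>y\<close>, \<open>u\<close> and \<open>x\<close>. It gives the carry cochain of
  \<open>lift x\<close> in degree 2, and being an \<open>m\<close>-th power is tested by evaluating
  at \<open>z\<close>.\<close>

theorem torsor_obstruction_trivial_iff: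
  assumes "y \<in> carrier C" "q y = z" "u \<in> carrier G \<rightarrow> carrier B" "x \<in> carrier A"
    and u: "\<And>g. g \<in> carrier G \<Longrightarrow> p (u g) = act C g y \<otimes>\<^bsub>C\<^esub> inv\<^bsub>C\<^esub> y"
    and du: "\<And>g h. g \<in> carrier G \<Longrightarrow> h \<in> carrier G \<Longrightarrow>
      act B g (u h) \<otimes>\<^bsub>B\<^esub> inv\<^bsub>B\<^esub> (u (g \<otimes>\<^bsub>G\<^esub> h)) \<otimes>\<^bsub>B\<^esub> u g = i x [^]\<^bsub>B\<^esub> cyc.carry g h"
  shows "torsor_obstruction G A i B p C q D = \<one>\<^bsub>cohomology G (hom_module G D A) 2\<^esub>
     \<longleftrightarrow> (\<exists>w\<in>carrier A. x = w [^]\<^bsub>A\<^esub> m)"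
proof -
  have uc: "u g \<in> carrier B" if "g \<in> carrier G" for g using assms(3) that by auto
  note cl = hC.lift_closed[OF assms(1)] hA.lift_closed[OF assms(4)] hB.lift_closed[OF uc]
  note ev = hC.lift_z[OF assms(1)] hA.lift_z[OF assms(4)] hB.lift_z[OF uc]
  have id_closed: "(\<lambda>x\<in>carrier D. x) \<in> carrier (hom_module G D D)"
    by (auto simp: hD.hom_module_simps intro!: homI)
  have id: "compose (carrier D) q (hC.lift y) = (\<lambda>x\<in>carrier D. x)"
    using cl z assms(2) ev id_closed by (intro hD.hom_module_eqI) auto
  \<comment> \<open>As \<open>carries\<close> is 1 on the empty tuple, the identity as a 0-cocycle
    is its own carry cochain.\<close>
  have cc: "hom.D.carry_cochain (\<lambda>x\<in>carrier D. x) 0 = (\<lambda>gs\<in>tuples G 0. \<lambda>x\<in>carrier D. x)"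
    using id_closed by (auto simp: hom.D.carry_cochain_def fun_eq_iff)
  have "double_connecting G (hom_module G D A) (compose (carrier D) i) (hom_module G D B) (compose (carrier D) p)
     (hom_module G D C) (compose (carrier D) q) 0
       (cohomology_class G (hom_module G D D) 0 (hom.D.carry_cochain (compose (carrier D) q (hC.lift y)) 0)) =
     cohomology_class G (hom_module G D A) (0 + 2) (hom.A.carry_cochain (hA.lift x) (0 + 2))"
  proof (rule hom.double_connecting_carry_cochain[where u="\<lambda>g. hB.lift (u g)"])
    show "compose (carrier D) p (hB.lift (u g)) =
      act (hom_module G D C) g (hC.lift y) \<otimes>\<^bsub>hom_module G D C\<^esub> inv\<^bsub>hom_module G D C\<^esub> hC.lift y"
      if g: "g \<in> carrier G" for g
      using cl g by (intro hC.hom_module_eqI) (auto simp: hC.ev.equivariant ev u)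
    show "act (hom_module G D B) g (hB.lift (u h)) \<otimes>\<^bsub>hom_module G D B\<^esub>
        inv\<^bsub>hom_module G D B\<^esub> hB.lift (u (g \<otimes>\<^bsub>G\<^esub> h)) \<otimes>\<^bsub>hom_module G D B\<^esub> hB.lift (u g) =
       compose (carrier D) i (hA.lift x) [^]\<^bsub>hom_module G D B\<^esub> cyc.carry g h"
      if "g \<in> carrier G" "h \<in> carrier G" for g h
      using cl that by (intro hB.hom_module_eqI) (auto simp: hB.ev.equivariant hB.ev.hom_int_pow ev du)
  qed (use cl in auto)
  then have "torsor_obstruction G A i B p C q D =
      cohomology_class G (hom_module G D A) 2 (hom.A.carry_cochain (hA.lift x) 2)"
    by (simp add: torsor_obstruction_def id cc numeral_2_eq_2)
  then have "torsor_obstruction G A i B p C q D = \<one>\<^bsub>cohomology G (hom_module G D A) 2\<^esub> \<longleftrightarrow>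
     (\<exists>\<psi>\<in>carrier (hom_module G D A). hA.lift x = \<psi> [^]\<^bsub>hom_module G D A\<^esub> m)"
    using hom.A.carry_cochain_trivial_iff[of 2 "hA.lift x"] cl by simp
  also have "\<dots> \<longleftrightarrow> (\<exists>w\<in>carrier A. x = w [^]\<^bsub>A\<^esub> m)"
  proof
    assume "\<exists>\<psi>\<in>carrier (hom_module G D A). hA.lift x = \<psi> [^]\<^bsub>hom_module G D A\<^esub> m"
    then obtain \<psi> where \<psi>: "\<psi> \<in> carrier (hom_module G D A)" "hA.lift x = \<psi> [^]\<^bsub>hom_module G D A\<^esub> m" by auto
    have "x = \<psi> z [^]\<^bsub>A\<^esub> m" using fun_cong[OF \<psi>(2), of z] ev hA.ev.hom_nat_pow[OF \<psi>(1)] by simp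
    then show "\<exists>w\<in>carrier A. x = w [^]\<^bsub>A\<^esub> m" using hA.ev.hom_closed[OF \<psi>(1)] by blast
  next
    assume "\<exists>w\<in>carrier A. x = w [^]\<^bsub>A\<^esub> m"
    then obtain w where w: "w \<in> carrier A" "x = w [^]\<^bsub>A\<^esub> m" by auto
    have "hA.lift x = hA.lift w [^]\<^bsub>hom_module G D A\<^esub> m"
      using cl hA.lift_closed[OF w(1)] w ev
      by (intro hA.hom_module_eqI) (auto simp: hA.lift_z hA.ev.hom_nat_pow)
    then show "\<exists>\<psi>\<in>carrier (hom_module G D A). hA.lift x = \<psi> [^]\<^bsub>hom_module G D A\<^esub> m"
      using hA.lift_closed[OF w(1)] by blast
  qed
  finally show ?thesis .
qed

end

section \<open>Images of one group under two homomorphisms\<close>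

lemma (in group_hom) image_iso: "G Mod kernel G H h \<cong> H\<lparr>carrier := h ` carrier G\<rparr>"
proof -
  interpret I: group "H\<lparr>carrier := h ` carrier G\<rparr>"
    by (rule H.subgroup_imp_group[OF img_is_subgroup])
  interpret h: group_hom G "H\<lparr>carrier := h ` carrier G\<rparr>" h
    by unfold_locales (auto simp: hom_def)
  show ?thesis using h.FactGroup_iso by (simp add: kernel_def)
qed

text \<open>Both images are isomorphic to the quotient of \<open>Z\<close> by the common kernel.
  This replaces the construction of a map between cohomology classes and power classes.\<close>

lemma iso_of_images:
  assumes "group_hom Z X \<alpha>" "group_hom Z Y \<beta>"
    and "\<And>x. x \<in> carrier Z \<Longrightarrow> \<alpha> x = \<one>\<^bsub>X\<^esub> \<longleftrightarrow> \<beta> x = \<one>\<^bsub>Y\<^esub>"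
  shows "X\<lparr>carrier := \<alpha> ` carrier Z\<rparr> \<cong> Y\<lparr>carrier := \<beta> ` carrier Z\<rparr>"
proof -
  have "kernel Z X \<alpha> = kernel Z Y \<beta>" using assms(3) by (auto simp: kernel_def)
  moreover have "group (Z Mod kernel Z X \<alpha>)"
    using normal.factorgroup_is_group[OF group_hom.normal_kernel[OF assms(1)]] .
  ultimately show ?thesis
    using group_hom.image_iso[OF assms(1)] group_hom.image_iso[OF assms(2)]
    by (metis group.iso_sym iso_trans)
qed

section \<open>Evaluation of multivariate polynomials\<close>

lemma Const_0 [simp]: "Const 0 = 0"
  by (simp add: Const_def)

lemma Const_1 [simp]: "Const 1 = 1"
  by (simp add: Const_def)

lemma Const_add: "Const (a + b) = Const a + Const b"
  by (simp add: Const_def single_add)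

lemma Const_mult: "Const (a * b) = Const a * Const (b :: 'k::comm_semiring_1)"
  by (simp add: Const_def mult_single)

lemma Const_eq_iff [simp]: "Const a = Const b \<longleftrightarrow> a = b"
  unfolding Const_def by (metis lookup_single_eq)

lemma Const_eq_0_iff [simp]: "Const a = 0 \<longleftrightarrow> a = 0"
  using Const_eq_iff[of a 0] by simp

lemma Const_dvd_1: "c \<noteq> 0 \<Longrightarrow> Const (c :: 'k::field) dvd 1"
  by (rule dvdI[of _ _ "Const (inverse c)"]) (simp flip: Const_mult)

lemma Var_power: "Var i ^ n = Poly_Mapping.single (Poly_Mapping.single i n) (1 :: 'k::comm_semiring_1)"
  by (induction n) (simp_all add: Var_def mult_single flip: single_add single_one)

lemma prod_single_one:
  "finite I \<Longrightarrow> (\<Prod>i\<in>I. Poly_Mapping.single (f i :: nat \<Rightarrow>\<^sub>0 nat) (1 :: 'k::comm_semiring_1)) = Poly_Mapping.single (\<Sum>i\<in>I. f i) 1"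
  by (induction I rule: finite_induct) (simp_all add: mult_single)

lemma poly_mapping_expansion:
  "p = (\<Sum>t\<in>Poly_Mapping.keys p. Poly_Mapping.single t (Poly_Mapping.lookup p t))"
  by (rule poly_mapping_eqI) (simp add: lookup_sum lookup_single when_def in_keys_iff)

lemma mpoly_expansion:
  "p = (\<Sum>t\<in>Poly_Mapping.keys p. Const (Poly_Mapping.lookup p t) *
        (\<Prod>i\<in>Poly_Mapping.keys t. Var i ^ Poly_Mapping.lookup t i))" for p :: "'k::field mpoly"
proof -
  have "(\<Prod>i\<in>Poly_Mapping.keys t. Var i ^ Poly_Mapping.lookup t i) = Poly_Mapping.single t (1 :: 'k)"
    for t :: "nat \<Rightarrow>\<^sub>0 nat"
    using poly_mapping_expansion[of t] by (simp add: Var_power prod_single_one)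
  then show ?thesis using poly_mapping_expansion[of p] by (simp add: Const_def mult_single)
qed

lemma poly_carrier_0 [simp]: "0 \<in> poly_carrier m"
  by (simp add: poly_carrier_def)

lemma poly_carrier_Const [simp]: "Const c \<in> poly_carrier m"
  by (simp add: poly_carrier_def Const_def)

lemma poly_carrier_1 [simp]: "1 \<in> poly_carrier m"
  by (simp add: poly_carrier_def)

lemma poly_carrier_Var [simp]: "i < m \<Longrightarrow> Var i \<in> poly_carrier m"
  by (auto simp: poly_carrier_def Var_def)

lemma poly_carrier_add [simp]: "p \<in> poly_carrier m \<Longrightarrow> q \<in> poly_carrier m \<Longrightarrow> p + q \<in> poly_carrier m"
  unfolding poly_carrier_def using Poly_Mapping.keys_add[of p q] by auto

lemma poly_carrier_mult [simp]:
  "p \<in> poly_carrier m \<Longrightarrow> q \<in> poly_carrier m \<Longrightarrow> p * q \<in> poly_carrier m"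
proof -
  assume pq: "p \<in> poly_carrier m" "q \<in> poly_carrier m"
  have "Poly_Mapping.keys t \<subseteq> {..<m}" if t: "t \<in> Poly_Mapping.keys (p * q)" for t
  proof -
    obtain u v where "t = u + v" "u \<in> Poly_Mapping.keys p" "v \<in> Poly_Mapping.keys q"
      using subsetD[OF Poly_Mapping.keys_mult t] by blast
    then show ?thesis using pq Poly_Mapping.keys_add[of u v] unfolding poly_carrier_def by blast
  qed
  then show ?thesis by (simp add: poly_carrier_def)
qed

lemma poly_carrier_uminus [simp]:
  "p \<in> poly_carrier m \<Longrightarrow> - p \<in> poly_carrier m" for p :: "'k::field mpoly"
  by (simp add: poly_carrier_def in_keys_iff)

lemma poly_carrier_diff [simp]:
  "p \<in> poly_carrier m \<Longrightarrow> q \<in> poly_carrier m \<Longrightarrow> p - q \<in> poly_carrier m" for p :: "'k::field mpoly"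
  using poly_carrier_add[of p m "- q"] by simp

lemma poly_carrier_power [simp]: "p \<in> poly_carrier m \<Longrightarrow> p ^ n \<in> poly_carrier m"
  for p :: "'k::field mpoly"
  by (induction n) auto

lemma poly_carrier_sum: "(\<And>i. i \<in> I \<Longrightarrow> f i \<in> poly_carrier m) \<Longrightarrow> sum f I \<in> poly_carrier m"
  by (induction I rule: infinite_finite_induct) auto

lemma poly_carrier_mono: "m \<le> n \<Longrightarrow> poly_carrier m \<subseteq> poly_carrier n"
  by (force simp: poly_carrier_def)

lemma poly_carrier_exhaust: obtains m where "p \<in> poly_carrier m"
proof -
  have "finite (\<Union>t\<in>Poly_Mapping.keys p. Poly_Mapping.keys t)" by simp
  then obtain m where "\<forall>i\<in>(\<Union>t\<in>Poly_Mapping.keys p. Poly_Mapping.keys t). i < m"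
    using finite_nat_set_iff_bounded by blast
  then show ?thesis by (intro that[of m]) (auto simp: poly_carrier_def)
qed

lemma poly_carrier_induct [consumes 1, case_names Const Var add mult]:
  fixes p :: "'k::field mpoly"
  assumes "p \<in> poly_carrier m" and C: "\<And>c. P (Const c)" and V: "\<And>i. i < m \<Longrightarrow> P (Var i)"
    and A: "\<And>p q. p \<in> poly_carrier m \<Longrightarrow> q \<in> poly_carrier m \<Longrightarrow> P p \<Longrightarrow> P q \<Longrightarrow> P (p + q)"
    and M: "\<And>p q. p \<in> poly_carrier m \<Longrightarrow> q \<in> poly_carrier m \<Longrightarrow> P p \<Longrightarrow> P q \<Longrightarrow> P (p * q)"
  shows "P p"
proof -
  define Q where "Q p \<longleftrightarrow> p \<in> poly_carrier m \<and> P p" for p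
  have Q0: "Q 0" "Q 1" using C[of 0] C[of 1] by (auto simp: Q_def)
  have Qs: "(\<And>i. i \<in> I \<Longrightarrow> Q (f i)) \<Longrightarrow> Q (sum f I)" for f and I :: "(nat \<Rightarrow>\<^sub>0 nat) set"
    by (induction I rule: infinite_finite_induct) (auto simp: Q0, auto simp: Q_def A)
  have Qp: "(\<And>i. i \<in> I \<Longrightarrow> Q (f i)) \<Longrightarrow> Q (prod f I)" for f and I :: "nat set"
    by (induction I rule: infinite_finite_induct) (auto simp: Q0, auto simp: Q_def M)
  have Qe: "Q p \<Longrightarrow> Q (p ^ n)" for p n
    by (induction n) (auto simp: Q0, auto simp: Q_def M)
  have "Q (\<Sum>t\<in>Poly_Mapping.keys p. Const (Poly_Mapping.lookup p t) *
        (\<Prod>i\<in>Poly_Mapping.keys t. Var i ^ Poly_Mapping.lookup t i))"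
  proof (rule Qs)
    fix t assume "t \<in> Poly_Mapping.keys p"
    then have "i < m" if "i \<in> Poly_Mapping.keys t" for i
      using assms(1) that by (auto simp: poly_carrier_def)
    then have "Q (\<Prod>i\<in>Poly_Mapping.keys t. Var i ^ Poly_Mapping.lookup t i)"
      by (intro Qp Qe) (auto simp: Q_def V)
    then show "Q (Const (Poly_Mapping.lookup p t) * (\<Prod>i\<in>Poly_Mapping.keys t. Var i ^ Poly_Mapping.lookup t i))"
      by (auto simp: Q_def C M)
  qed
  then show ?thesis using mpoly_expansion[of p] by (simp add: Q_def)
qed

lemma mpoly_induct [case_names Const Var add mult]:
  fixes p :: "'k::field mpoly"
  assumes "\<And>c. P (Const c)" "\<And>i. P (Var i)" "\<And>p q. P p \<Longrightarrow> P q \<Longrightarrow> P (p + q)"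
    "\<And>p q. P p \<Longrightarrow> P q \<Longrightarrow> P (p * q)"
  shows "P p"
proof -
  obtain m where "p \<in> poly_carrier m" by (rule poly_carrier_exhaust)
  then show ?thesis by (induction rule: poly_carrier_induct) (use assms in auto)
qed

text \<open>\<open>split_var\<close>, \<open>grade\<close> and \<open>poly_subst\<close> are all
  determined by the images of coefficients and variables; the locale proves once that such a map is
  a ring homomorphism.\<close>

locale mpoly_eval =
  fixes \<iota> :: "'k::field \<Rightarrow> 'b::comm_ring_1" and s :: "nat \<Rightarrow> 'b"
  assumes \<iota>_1: "\<iota> 1 = 1" and \<iota>_add: "\<iota> (a + b) = \<iota> a + \<iota> b" and \<iota>_mult: "\<iota> (a * b) = \<iota> a * \<iota> b"
begin

definition eval :: "'k mpoly \<Rightarrow> 'b" where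
  "eval p = (\<Sum>t\<in>Poly_Mapping.keys p. \<iota> (Poly_Mapping.lookup p t) *
     (\<Prod>i\<in>Poly_Mapping.keys t. s i ^ Poly_Mapping.lookup t i))"

definition mono :: "(nat \<Rightarrow>\<^sub>0 nat) \<Rightarrow> 'b" where
  "mono t = (\<Prod>i\<in>Poly_Mapping.keys t. s i ^ Poly_Mapping.lookup t i)"

lemma \<iota>_0: "\<iota> 0 = 0"
  using \<iota>_add[of 0 0] by simp

lemma mono_superset:
  "finite I \<Longrightarrow> Poly_Mapping.keys t \<subseteq> I \<Longrightarrow> mono t = (\<Prod>i\<in>I. s i ^ Poly_Mapping.lookup t i)"
  unfolding mono_def by (rule prod.mono_neutral_left) (auto simp: in_keys_iff)

lemma mono_add: "mono (t + u) = mono t * mono u"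
proof -
  let ?I = "Poly_Mapping.keys t \<union> Poly_Mapping.keys u"
  have "Poly_Mapping.keys (t + u) \<subseteq> ?I" by (rule Poly_Mapping.keys_add)
  then show ?thesis
    by (simp add: mono_superset[of ?I] lookup_add power_add prod.distrib)
qed

lemma eval_superset:
  "finite T \<Longrightarrow> Poly_Mapping.keys p \<subseteq> T \<Longrightarrow> eval p = (\<Sum>t\<in>T. \<iota> (Poly_Mapping.lookup p t) * mono t)"
  unfolding eval_def mono_def by (rule sum.mono_neutral_left) (auto simp: in_keys_iff \<iota>_0)

lemma eval_add: "eval (p + q) = eval p + eval q"
proof -
  let ?T = "Poly_Mapping.keys p \<union> Poly_Mapping.keys q"
  have "Poly_Mapping.keys (p + q) \<subseteq> ?T" by (rule Poly_Mapping.keys_add)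
  then show ?thesis
    by (simp add: eval_superset[of ?T] lookup_add \<iota>_add distrib_right sum.distrib)
qed

lemma eval_0 [simp]: "eval 0 = 0"
  by (simp add: eval_def)

lemma eval_sum: "eval (sum f I) = (\<Sum>i\<in>I. eval (f i))"
  by (induction I rule: infinite_finite_induct) (auto simp: eval_add)

lemma eval_single: "eval (Poly_Mapping.single t c) = \<iota> c * mono t"
  using eval_superset[of "{t}" "Poly_Mapping.single t c"] by simp

lemma eval_mult: "eval (p * q) = eval p * eval q"
proof -
  have "eval (p * q) = eval ((\<Sum>t\<in>Poly_Mapping.keys p. Poly_Mapping.single t (Poly_Mapping.lookup p t)) *
     (\<Sum>u\<in>Poly_Mapping.keys q. Poly_Mapping.single u (Poly_Mapping.lookup q u)))"
    using poly_mapping_expansion[of p] poly_mapping_expansion[of q] by simp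
  also have "\<dots> = (\<Sum>t\<in>Poly_Mapping.keys p. \<iota> (Poly_Mapping.lookup p t) * mono t) *
     (\<Sum>u\<in>Poly_Mapping.keys q. \<iota> (Poly_Mapping.lookup q u) * mono u)"
    by (simp add: sum_product mult_single eval_sum eval_single \<iota>_mult mono_add mult_ac)
  also have "\<dots> = eval p * eval q" by (simp add: eval_superset[of "Poly_Mapping.keys p"] eval_superset[of "Poly_Mapping.keys q"])
  finally show ?thesis .
qed

lemma eval_Const [simp]: "eval (Const c) = \<iota> c"
  by (simp add: Const_def eval_single mono_def)

lemma eval_1 [simp]: "eval 1 = 1"
  using eval_Const[of 1] by (simp add: \<iota>_1)

lemma eval_Var [simp]: "eval (Var i) = s i"
  by (simp add: Var_def eval_single mono_def \<iota>_1)

lemma eval_uminus: "eval (- p) = - eval p"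
  using eval_add[of p "- p"] by (simp add: minus_unique)

lemma eval_diff: "eval (p - q) = eval p - eval q"
  using eval_add[of p "- q"] by (simp add: eval_uminus)

lemma eval_power: "eval (p ^ n) = eval p ^ n"
  by (induction n) (auto simp: eval_mult)

end

section \<open>Unique factorization\<close>

text \<open>\<open>split_var n\<close> regards a polynomial as a polynomial in the variable number \<open>n\<close>.\<close>

global_interpretation split: mpoly_eval "\<lambda>c::'k::field. [:Const c:]"
    "\<lambda>i. if i = n then [:0, 1:] else [:Var i:]" for n
  defines split_var = split.eval
  by unfold_locales (auto simp: Const_add Const_mult one_pCons)

text \<open>\<open>grade\<close> multiplies every variable by a new variable, so a form of degree \<open>d\<close> becomes a monomial
  of degree \<open>d\<close>.\<close>

global_interpretation grade: mpoly_eval "\<lambda>c::'k::field. [:Const c:]" "\<lambda>i. [:0, Var i:]"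
  defines grade = grade.eval
  by unfold_locales (auto simp: Const_add Const_mult one_pCons)

lemma poly_split_var [simp]: "poly (split_var n p) (Var n) = p"
  by (induction p rule: mpoly_induct) (auto simp: split.eval_add split.eval_mult)

lemma split_var_eq_iff: "split_var n p = split_var n q \<longleftrightarrow> p = q"
  by (metis poly_split_var)

lemma split_var_eq_0_iff [simp]: "split_var n p = 0 \<longleftrightarrow> p = 0"
  using split_var_eq_iff[of n p 0] by simp

lemma split_var_lower: "p \<in> poly_carrier n \<Longrightarrow> split_var n p = [:p:]"
  by (induction rule: poly_carrier_induct) (auto simp: split.eval_add split.eval_mult mult.commute)

lemma coeff_split_var: "p \<in> poly_carrier (Suc n) \<Longrightarrow> coeff (split_var n p) i \<in> poly_carrier n"
proof (induction arbitrary: i rule: poly_carrier_induct)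
  case (Const c) then show ?case by (auto simp: coeff_pCons split: nat.splits)
next
  case (Var j) then show ?case by (auto simp: coeff_pCons split: nat.splits)
next
  case (add p q) then show ?case by (simp add: split.eval_add)
next
  case (mult p q) then show ?case by (auto simp: split.eval_mult coeff_mult intro!: poly_carrier_sum)
qed

lemma degree_split_var_eq_0D:
  assumes "p \<in> poly_carrier (Suc n)" "degree (split_var n p) = 0"
  shows "p \<in> poly_carrier n"
proof -
  obtain c where c: "split_var n p = [:c:]" using assms(2) by (rule degree_eq_zeroE)
  then have "p = c" using poly_split_var[of n p] by simp
  then show ?thesis using coeff_split_var[OF assms(1), of 0] c by simp
qed

text \<open>Both factors lie in finitely many variables. If the product does not involve the last of
  these, the degrees in that variable add up to 0, so neither factor involves it; descending reaches
  \<open>n\<close>.\<close>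

lemma poly_carrier_factor:
  fixes a b :: "'k::field mpoly"
  assumes "a * b \<in> poly_carrier n" "a * b \<noteq> 0"
  shows "a \<in> poly_carrier n"
proof -
  have *: "a \<in> poly_carrier k \<and> b \<in> poly_carrier k"
    if "a \<in> poly_carrier (Suc k) \<and> b \<in> poly_carrier (Suc k)" "k \<ge> n" for k
  proof -
    have "a * b \<in> poly_carrier k" using assms poly_carrier_mono[OF that(2)] by auto
    then have "degree (split_var k a * split_var k b) = 0"
      by (simp add: split_var_lower flip: split.eval_mult)
    then have "degree (split_var k a) = 0" "degree (split_var k b) = 0"
      using assms(2) by (auto simp: degree_mult_eq)
    then show ?thesis using that degree_split_var_eq_0D by blast
  qed
  obtain A where "a \<in> poly_carrier A" by (rule poly_carrier_exhaust)
  moreover obtain B where "b \<in> poly_carrier B" by (rule poly_carrier_exhaust)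
  ultimately have "a \<in> poly_carrier (max n (max A B)) \<and> b \<in> poly_carrier (max n (max A B))"
    using poly_carrier_mono[of A "max n (max A B)"] poly_carrier_mono[of B "max n (max A B)"]
    by (meson in_mono max.cobounded1 max.cobounded2 order_trans)
  moreover have "a \<in> poly_carrier (n + j) \<and> b \<in> poly_carrier (n + j) \<Longrightarrow> a \<in> poly_carrier n" for j
  proof (induction j)
    case (Suc j)
    then show ?case using *[of "n + j"] by (simp only: add_Suc_right le_add1)
  qed simp
  ultimately show ?thesis by (metis le_add_diff_inverse max.cobounded1)
qed

lemma poly_carrier_dvd: "a dvd b \<Longrightarrow> b \<in> poly_carrier n \<Longrightarrow> b \<noteq> 0 \<Longrightarrow> a \<in> poly_carrier n"
  for a b :: "'k::field mpoly"
  by (auto intro: poly_carrier_factor elim!: dvdE)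

section \<open>Total degree, units and irreducible factors\<close>

definition total_degree :: "'k::field mpoly \<Rightarrow> nat" where "total_degree p = degree (grade p)"

lemma poly_grade_1 [simp]: "poly (grade p) 1 = p"
  by (induction p rule: mpoly_induct) (auto simp: grade.eval_add grade.eval_mult)

lemma grade_eq_0_iff [simp]: "grade p = 0 \<longleftrightarrow> p = 0"
  by (metis poly_grade_1 grade.eval_0 poly_0)

text \<open>Setting the grading variable to 0 kills all variables and keeps the constant term, so a
  polynomial of total degree 0 is a constant.\<close>

lemma poly_grade_0: "\<exists>c. poly (grade p) 0 = Const c"
proof (induction p rule: mpoly_induct)
  case (add p q) then show ?case by (metis Const_add grade.eval_add poly_add)
next
  case (mult p q) then show ?case by (metis Const_mult grade.eval_mult poly_mult)
qed (auto intro: exI[of _ 0])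

lemma total_degree_mult: "p \<noteq> 0 \<Longrightarrow> q \<noteq> 0 \<Longrightarrow> total_degree (p * q) = total_degree p + total_degree q"
  by (simp add: total_degree_def grade.eval_mult degree_mult_eq)

lemma total_degree_eq_0D: assumes "total_degree p = 0" obtains c where "p = Const c"
proof -
  obtain a where a: "grade p = [:a:]" using assms unfolding total_degree_def by (rule degree_eq_zeroE)
  then have "p = a" using poly_grade_1[of p] by simp
  moreover obtain c where "poly (grade p) 0 = Const c" using poly_grade_0 by blast
  ultimately show ?thesis using a that by simp
qed

lemma total_degree_Const [simp]: "total_degree (Const c) = 0"
  by (simp add: total_degree_def)

lemma total_degree_1 [simp]: "total_degree 1 = 0"
  using total_degree_Const[of 1] by (simp only: Const_1)

lemma is_unit_mpoly_iff: "p dvd 1 \<longleftrightarrow> p \<noteq> 0 \<and> total_degree p = 0" for p :: "'k::field mpoly"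
proof
  assume "p dvd 1"
  then obtain q where q: "1 = p * q" by (auto elim: dvdE)
  then have "total_degree p + total_degree q = total_degree (1 :: 'k mpoly)"
    using total_degree_mult[of p q] by (metis mult_zero_left mult_zero_right zero_neq_one)
  then show "p \<noteq> 0 \<and> total_degree p = 0" using q total_degree_Const[of "1 :: 'k"] by auto
next
  assume "p \<noteq> 0 \<and> total_degree p = 0"
  then show "p dvd 1" using Const_dvd_1 by (metis Const_0 total_degree_eq_0D)
qed

lemma irreducible_factor_exists:
  fixes a :: "'k::field mpoly"
  assumes "a \<noteq> 0" "\<not> a dvd 1"
  obtains p where "irreducible p" "p dvd a"
  using assms
proof (induction "total_degree a" arbitrary: a thesis rule: less_induct)
  case less
  show ?case
  proof (cases "irreducible a")
    case True then show ?thesis using less.prems(1)[of a] by simp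
  next
    case False
    then obtain b c where bc: "a = b * c" "\<not> b dvd 1" "\<not> c dvd 1" using less.prems by (auto simp: irreducible_def)
    then have "b \<noteq> 0" "c \<noteq> 0" using less.prems by auto
    moreover from this have "total_degree b < total_degree a"
      using bc by (auto simp: total_degree_mult is_unit_mpoly_iff)
    ultimately obtain p where "irreducible p" "p dvd b" using less.hyps[of b] bc by metis
    then show ?thesis using less.prems(1)[of p] bc by auto
  qed
qed

section \<open>Primality by induction on the number of variables\<close>

definition prime_in :: "nat \<Rightarrow> 'k::field mpoly \<Rightarrow> bool" where
  "prime_in n p \<longleftrightarrow> p \<in> poly_carrier n \<and> p \<noteq> 0 \<and> \<not> p dvd 1 \<and>
     (\<forall>a\<in>poly_carrier n. \<forall>b\<in>poly_carrier n. p dvd a * b \<longrightarrow> p dvd a \<or> p dvd b)"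

lemma prime_inD: "prime_in n p \<Longrightarrow> p dvd a * b \<Longrightarrow> a \<in> poly_carrier n \<Longrightarrow> b \<in> poly_carrier n \<Longrightarrow> p dvd a \<or> p dvd b"
  by (auto simp: prime_in_def)

lemma dvd_iff_dvd_coeffs:
  assumes "p \<in> poly_carrier n"
  shows "p dvd a \<longleftrightarrow> (\<forall>i. p dvd coeff (split_var n a) i)"
proof
  assume "p dvd a"
  then obtain b where "a = p * b" by (auto elim: dvdE)
  then have "split_var n a = smult p (split_var n b)" using assms by (simp add: split.eval_mult split_var_lower)
  then show "\<forall>i. p dvd coeff (split_var n a) i" by simp
next
  assume "\<forall>i. p dvd coeff (split_var n a) i"
  then have "p dvd poly (split_var n a) (Var n)" unfolding poly_altdef by (intro dvd_sum) auto
  then show "p dvd a" by simp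
qed

text \<open>Gauss's lemma: \<open>p\<close> divides a polynomial iff it divides all coefficients
  with respect to the new variable, so a product of two polynomials not divisible by
  \<open>p\<close> is tested at the first coefficients that \<open>p\<close> fails to
  divide.\<close>

lemma prime_in_Suc:
  assumes p: "prime_in n p"
  shows "prime_in (Suc n) p"
proof -
  have pn: "p \<in> poly_carrier n" using p by (simp add: prime_in_def)
  have "p dvd a \<or> p dvd b" if ab: "a \<in> poly_carrier (Suc n)" "b \<in> poly_carrier (Suc n)" "p dvd a * b" for a b
  proof (rule ccontr)
    let ?a = "coeff (split_var n a)" and ?b = "coeff (split_var n b)"
    assume "\<not> (p dvd a \<or> p dvd b)"
    then have ex: "\<exists>i. \<not> p dvd ?a i" "\<exists>j. \<not> p dvd ?b j" using dvd_iff_dvd_coeffs[OF pn, of a] dvd_iff_dvd_coeffs[OF pn, of b] by blast+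
    define i j where "i = (LEAST i. \<not> p dvd ?a i)" and "j = (LEAST j. \<not> p dvd ?b j)"
    have i: "\<not> p dvd ?a i" "\<And>k. k < i \<Longrightarrow> p dvd ?a k"
      unfolding i_def using LeastI_ex[OF ex(1)] not_less_Least by blast+
    have j: "\<not> p dvd ?b j" "\<And>k. k < j \<Longrightarrow> p dvd ?b k"
      unfolding j_def using LeastI_ex[OF ex(2)] not_less_Least by blast+
    have "p dvd coeff (split_var n a * split_var n b) (i + j)"
      using ab(3) unfolding dvd_iff_dvd_coeffs[OF pn, of "a * b"] split.eval_mult by blast
    \<comment> \<open>In every summand other than the one at \<open>i\<close>, one of the two
      indices lies below its minimum, so \<open>p\<close> divides that summand.\<close>
    also have "coeff (split_var n a * split_var n b) (i + j) =
        ?a i * ?b j + (\<Sum>k\<in>{..i + j} - {i}. ?a k * ?b (i + j - k))"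
      unfolding coeff_mult by (subst sum.remove[of _ i]) auto
    finally have "p dvd ?a i * ?b j + (\<Sum>k\<in>{..i + j} - {i}. ?a k * ?b (i + j - k))" .
    moreover have "p dvd (\<Sum>k\<in>{..i + j} - {i}. ?a k * ?b (i + j - k))"
    proof (rule dvd_sum)
      fix k assume "k \<in> {..i + j} - {i}"
      then consider "k < i" | "i + j - k < j" by (cases "k < i") auto
      then show "p dvd ?a k * ?b (i + j - k)" using i(2) j(2) by cases auto
    qed
    ultimately have "p dvd ?a i * ?b j" by (simp add: dvd_add_left_iff)
    then show False using i(1) j(1) prime_inD[OF p] coeff_split_var[OF ab(1)] coeff_split_var[OF ab(2)] by blast
  qed
  moreover have "p \<in> poly_carrier (Suc n)" using pn poly_carrier_mono[of n "Suc n"] by auto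
  ultimately show ?thesis using p unfolding prime_in_def by blast
qed

text \<open>Division with remainder in the last variable. Multiplying by the leading coefficient of
  \<open>d\<close> instead of dividing by it keeps everything polynomial, at the price of the factor
  \<open>c\<close>.\<close>

lemma pseudo_division:
  assumes d: "d \<in> poly_carrier (Suc n)" "d \<noteq> 0" and g: "g \<in> poly_carrier (Suc n)"
  obtains c q r where "c \<in> poly_carrier n" "c \<noteq> 0" "q \<in> poly_carrier (Suc n)" "r \<in> poly_carrier (Suc n)"
    "c * g = q * d + r" "r = 0 \<or> degree (split_var n r) < degree (split_var n d)"
  using g
proof (induction "degree (split_var n g)" arbitrary: g thesis rule: less_induct)
  case less
  let ?deg = "\<lambda>g. degree (split_var n g)"
  show ?case
  proof (cases "g = 0 \<or> ?deg g < ?deg d")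
    case True
    then show ?thesis using less.prems(1)[of 1 0 g] less.prems(2) by auto
  next
    case False
    define lg where "lg = lead_coeff (split_var n g)"
    define ld where "ld = lead_coeff (split_var n d)"
    define e where "e = ?deg g - ?deg d"
    have l: "lg \<in> poly_carrier n" "ld \<in> poly_carrier n" "ld \<noteq> 0" "lg \<noteq> 0"
      unfolding lg_def ld_def using False d less.prems coeff_split_var by auto
    have l': "lg \<in> poly_carrier (Suc n)" "ld \<in> poly_carrier (Suc n)"
      using l poly_carrier_mono[of n "Suc n"] by auto
    define h where "h = lg * Var n ^ e * d"
    define g' where "g' = ld * g - h"
    have h: "h \<in> poly_carrier (Suc n)" unfolding h_def using l' d by simp
    have g': "g' \<in> poly_carrier (Suc n)" unfolding g'_def using l' less.prems h by simp
    have sh: "split_var n h = monom lg e * split_var n d"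
      unfolding h_def using l by (simp add: split.eval_mult split.eval_power split_var_lower monom_altdef)
    have sg: "split_var n (ld * g) = smult ld (split_var n g)"
      using l by (simp add: split.eval_mult split_var_lower)
    have deg: "degree (split_var n h) = ?deg g" "degree (split_var n (ld * g)) = ?deg g"
      unfolding sh sg using l False d by (simp_all add: degree_mult_eq degree_monom_eq e_def)
    have "lead_coeff (split_var n h) = lg * ld"
      unfolding sh lead_coeff_mult by (simp add: ld_def degree_monom_eq[OF l(4)])
    then have "coeff (split_var n g') (?deg g) = 0"
      unfolding g'_def split.eval_diff sg using deg by (simp add: lg_def)
    moreover have "?deg g' \<le> ?deg g"
      unfolding g'_def split.eval_diff using deg by (intro degree_diff_le) auto
    ultimately have "g' = 0 \<or> ?deg g' < ?deg g"
      using leading_coeff_0_iff le_neq_implies_less split_var_eq_0_iff by metis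
    then show ?thesis
    proof
      assume "g' = 0"
      then show ?thesis using less.prems(1)[of ld "lg * Var n ^ e" 0] l l' by (auto simp: g'_def h_def)
    next
      assume "?deg g' < ?deg g"
      then obtain c q r where cqr: "c \<in> poly_carrier n" "c \<noteq> 0" "q \<in> poly_carrier (Suc n)" "r \<in> poly_carrier (Suc n)"
          "c * g' = q * d + r" "r = 0 \<or> ?deg r < ?deg d"
        using less.hyps[OF _ _ g'] by metis
      show ?thesis
      proof (rule less.prems(1)[of "c * ld" "q + c * lg * Var n ^ e" r])
        show "c * ld * g = (q + c * lg * Var n ^ e) * d + r"
          using cqr(5) unfolding g'_def h_def by (simp add: algebra_simps)
        have "c \<in> poly_carrier (Suc n)" using cqr(1) poly_carrier_mono[of n "Suc n"] by auto
        then show "q + c * lg * Var n ^ e \<in> poly_carrier (Suc n)" using cqr l' by simp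
      qed (use cqr l in auto)
    qed
  qed
qed

lemma irreducible_dvd: "irreducible f \<Longrightarrow> p dvd f \<Longrightarrow> \<not> p dvd 1 \<Longrightarrow> f dvd p"
  for f :: "'a::idom"
proof (elim dvdE)
  fix k assume *: "irreducible f" "\<not> p dvd 1" "f = p * k"
  then have "k dvd 1" by (auto simp: irreducible_def)
  then obtain l where "1 = k * l" by (auto elim: dvdE)
  then have "p = f * l" using * by (simp add: mult.assoc)
  then show "f dvd p" by simp
qed

context
  fixes n :: nat
  assumes IH: "\<And>f :: 'k::field mpoly. f \<in> poly_carrier n \<Longrightarrow> irreducible f \<Longrightarrow> prime_in n f"
begin

lemma prime_factor_in:
  assumes "c \<in> poly_carrier n" "c \<noteq> 0" "\<not> c dvd 1"
  obtains p c' where "prime_in (Suc n) p" "p \<in> poly_carrier n" "c = p * c'" "c' \<in> poly_carrier n" "c' \<noteq> (0 :: 'k mpoly)"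
    "total_degree c' < total_degree c"
proof -
  obtain p where p: "irreducible p" "p dvd c" using irreducible_factor_exists assms by blast
  then obtain c' where c': "c = p * c'" by (auto elim: dvdE)
  have "c' dvd c" using c' by simp
  then have pn: "p \<in> poly_carrier n" "c' \<in> poly_carrier n"
    using poly_carrier_dvd[OF _ assms(1,2)] p by blast+
  have "p \<noteq> 0" "c' \<noteq> 0" using c' assms by auto
  moreover have "total_degree p > 0" using p \<open>p \<noteq> 0\<close> is_unit_mpoly_iff[of p] by (auto simp: irreducible_def)
  ultimately show ?thesis
    using that[OF prime_in_Suc[OF IH[OF pn(1) p(1)]] pn(1) c' pn(2)] by (simp add: c' total_degree_mult)
qed

text \<open>The primes of \<open>c\<close> are removed one at a time. None of them divides
  \<open>f\<close>, since an irreducible \<open>f\<close> would then be associated to a polynomial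
  without the last variable; so each divides the cofactor and cancels.\<close>

lemma irreducible_dvd_cancel:
  fixes f :: "'k mpoly"
  assumes f: "f \<in> poly_carrier (Suc n)" "irreducible f" "degree (split_var n f) > 0"
    and "c \<in> poly_carrier n" "c \<noteq> 0" "h \<in> poly_carrier (Suc n)" "f dvd c * h"
  shows "f dvd h"
  using assms(4-7)
proof (induction "total_degree c" arbitrary: c rule: less_induct)
  case less
  show ?case
  proof (cases "c dvd 1 \<or> h = 0")
    case True
    then show ?thesis
    proof
      assume "c dvd 1"
      then obtain d where "1 = c * d" by (auto elim: dvdE)
      then have "h = c * h * d" by (simp add: mult.commute mult.left_commute)
      then show ?thesis using less.prems(4) by (metis dvd_mult2)
    qed simp
  next
    case False
    then obtain p c' where p: "prime_in (Suc n) p" "p \<in> poly_carrier n" "c = p * c'" "c' \<in> poly_carrier n" "c' \<noteq> 0"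
        "total_degree c' < total_degree c" using prime_factor_in less.prems by metis
    obtain k where k: "c * h = f * k" using less.prems(4) by (auto elim: dvdE)
    have "c \<in> poly_carrier (Suc n)" using less.prems(1) poly_carrier_mono[of n "Suc n"] by auto
    then have "c * h \<in> poly_carrier (Suc n)" "c * h \<noteq> 0" using less.prems False by auto
    then have kc: "k \<in> poly_carrier (Suc n)" using k poly_carrier_dvd[of k "c * h" "Suc n"] by auto
    have "p dvd f * k" using p(3) k[symmetric] by simp
    then have "p dvd f \<or> p dvd k" using prime_inD[OF p(1)] f(1) kc by blast
    moreover have "\<not> p dvd f"
    proof
      assume "p dvd f"
      moreover have "\<not> p dvd 1" "p \<noteq> 0" using p(1) by (auto simp: prime_in_def)
      ultimately have "f \<in> poly_carrier n"
        using poly_carrier_dvd[OF irreducible_dvd[OF f(2)] p(2)] by blast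
      then show False using f(3) by (simp add: split_var_lower)
    qed
    ultimately obtain k' where "k = p * k'" by (auto elim: dvdE)
    then have "p * (c' * h) = p * (f * k')" using k p(3) by (simp add: mult_ac)
    then have "c' * h = f * k'" using p(1) by (simp add: prime_in_def)
    then show ?thesis using less.hyps[OF p(6) p(4,5) less.prems(3)] by simp
  qed
qed

text \<open>A factorization of \<open>f\<close> up to a denominator \<open>c\<close> becomes an
  honest one: each prime factor of \<open>c\<close> divides \<open>a\<close> or \<open>b\<close> and
  is cancelled there. The cancelled factors \<open>e1\<close> and \<open>e2\<close> stay in the
  smaller ring.\<close>

lemma factor_clear_denominator:
  fixes f :: "'k mpoly"
  assumes "f \<in> poly_carrier (Suc n)" "f \<noteq> 0"
    and "c \<in> poly_carrier n" "c \<noteq> 0" "a \<in> poly_carrier (Suc n)" "b \<in> poly_carrier (Suc n)" "c * f = a * b"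
  obtains a' b' e1 e2 where "f = a' * b'" "a = e1 * a'" "b = e2 * b'" "e1 \<in> poly_carrier n" "e2 \<in> poly_carrier n"
  using assms(3-7)
proof (induction "total_degree c" arbitrary: c a b thesis rule: less_induct)
  case less
  show ?case
  proof (cases "c dvd 1")
    case True
    then obtain d where d: "1 = c * d" by (auto elim: dvdE)
    have "f = c * d * f" using d by simp
    also have "\<dots> = d * (c * f)" by (simp add: mult_ac)
    also have "\<dots> = d * a * b" unfolding less.prems(6) by (simp add: mult_ac)
    finally have "f = d * a * b" .
    then show ?thesis using less.prems(1)[of "d * a" b c 1] less.prems d
      by (auto simp flip: mult.assoc)
  next
    case False
    then obtain p c' where p: "prime_in (Suc n) p" "p \<in> poly_carrier n" "c = p * c'" "c' \<in> poly_carrier n" "c' \<noteq> 0"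
        "total_degree c' < total_degree c" using prime_factor_in less.prems by metis
    have p0: "p \<noteq> 0" using p(1) by (auto simp: prime_in_def)
    have ab0: "a * b \<noteq> 0" using less.prems assms(2) by (metis mult_eq_0_iff)
    have "p dvd a * b" using p(3) less.prems(6)[symmetric] by simp
    then have "p dvd a \<or> p dvd b" using prime_inD[OF p(1)] less.prems by blast
    then show ?thesis
    proof
      assume "p dvd a"
      then obtain a0 where a0: "a = p * a0" by (auto elim: dvdE)
      have "a0 \<in> poly_carrier (Suc n)" using poly_carrier_dvd[of a0 a "Suc n"] a0 less.prems ab0 by auto
      moreover have "c' * f = a0 * b" using less.prems(6) p0 unfolding a0 p(3) by (simp add: mult.assoc)
      ultimately obtain a' b' e1 e2 where *: "f = a' * b'" "a0 = e1 * a'" "b = e2 * b'" "e1 \<in> poly_carrier n" "e2 \<in> poly_carrier n"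
        using less.hyps[OF p(6) _ p(4,5) _ less.prems(5)] by metis
      then show ?thesis using less.prems(1)[of a' b' "p * e1" e2] a0 p(2) by (simp add: mult.assoc)
    next
      assume "p dvd b"
      then obtain b0 where b0: "b = p * b0" by (auto elim: dvdE)
      have "b0 \<in> poly_carrier (Suc n)" using poly_carrier_dvd[of b0 b "Suc n"] b0 less.prems ab0 by auto
      moreover have "c' * f = a * b0" using less.prems(6) p0 unfolding b0 p(3) by (simp add: mult_ac)
      ultimately obtain a' b' e1 e2 where *: "f = a' * b'" "a = e1 * a'" "b0 = e2 * b'" "e1 \<in> poly_carrier n" "e2 \<in> poly_carrier n"
        using less.hyps[OF p(6) _ p(4,5) less.prems(4)] by metis
      then show ?thesis using less.prems(1)[of a' b' e1 "p * e2"] b0 p(2) by (simp add: mult.assoc)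
    qed
  qed
qed

text \<open>A nonzero combination \<open>d\<close> of \<open>f\<close> and \<open>g\<close> of minimal degree divides both up to a factor in the
  smaller ring; irreducibility of \<open>f\<close> forces \<open>f\<close> to divide \<open>d\<close> (hence \<open>g\<close>) or \<open>d\<close> to be constant
  in the last variable (hence \<open>f\<close> divides \<open>h\<close>).\<close>

lemma irreducible_prime_in_Suc:
  fixes f :: "'k mpoly"
  assumes f: "f \<in> poly_carrier (Suc n)" "irreducible f"
  shows "prime_in (Suc n) f"
proof (cases "degree (split_var n f) = 0")
  case True
  then show ?thesis using IH prime_in_Suc degree_split_var_eq_0D f by blast
next
  case False
  then have deg: "degree (split_var n f) > 0" by simp
  have f0: "f \<noteq> 0" "\<not> f dvd 1" using f(2) by (auto simp: irreducible_def)
  have "f dvd g \<or> f dvd h" if gh: "g \<in> poly_carrier (Suc n)" "h \<in> poly_carrier (Suc n)" "f dvd g * h" for g h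
  proof -
    define I where "I = {a * f + b * g | a b. a \<in> poly_carrier (Suc n) \<and> b \<in> poly_carrier (Suc n)} - {0}"
    have "1 * f + 0 * g \<in> I" unfolding I_def using f0 by auto (metis add.right_neutral mult_1 mult_zero_left poly_carrier_0 poly_carrier_1)
    then obtain d where d: "d \<in> I" "\<And>e. e \<in> I \<Longrightarrow> degree (split_var n d) \<le> degree (split_var n e)"
      using ex_has_least_nat[of "\<lambda>x. x \<in> I" _ "\<lambda>x. degree (split_var n x)"] by blast
    then obtain a b where ab: "a \<in> poly_carrier (Suc n)" "b \<in> poly_carrier (Suc n)" "d = a * f + b * g" and d0: "d \<noteq> 0"
      unfolding I_def by auto
    have dc: "d \<in> poly_carrier (Suc n)" using ab f gh by simp
    have div: "\<exists>c q. c \<in> poly_carrier n \<and> c \<noteq> 0 \<and> q \<in> poly_carrier (Suc n) \<and> c * (x * f + y * g) = q * d"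
      if "x \<in> poly_carrier (Suc n)" "y \<in> poly_carrier (Suc n)" for x y
    proof -
      have "x * f + y * g \<in> poly_carrier (Suc n)" using that f gh by simp
      then obtain c q r where cqr: "c \<in> poly_carrier n" "c \<noteq> 0" "q \<in> poly_carrier (Suc n)" "r \<in> poly_carrier (Suc n)"
        "c * (x * f + y * g) = q * d + r" "r = 0 \<or> degree (split_var n r) < degree (split_var n d)"
        using pseudo_division[OF dc d0] by metis
      have c': "c \<in> poly_carrier (Suc n)" using cqr(1) poly_carrier_mono[of n "Suc n"] by auto
      \<comment> \<open>The remainder is again a combination of \<open>f\<close> and
        \<open>g\<close> and has smaller degree than \<open>d\<close>, so minimality of
        \<open>d\<close> forces it to vanish.\<close>
      have "r = (c * x - q * a) * f + (c * y - q * b) * g"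
        using cqr(5) unfolding ab(3) by (simp add: algebra_simps)
      moreover have "c * x - q * a \<in> poly_carrier (Suc n)" "c * y - q * b \<in> poly_carrier (Suc n)"
        using c' that cqr ab by auto
      ultimately have "r = 0 \<or> r \<in> I" unfolding I_def by blast
      then have "r = 0" using cqr(6) d(2)[of r] by auto
      then show ?thesis using cqr by auto
    qed
    obtain c1 q1 where 1: "c1 \<in> poly_carrier n" "c1 \<noteq> 0" "q1 \<in> poly_carrier (Suc n)" "c1 * f = q1 * d"
      using div[of 1 0] by auto
    obtain c2 q2 where 2: "c2 \<in> poly_carrier n" "c2 \<noteq> 0" "q2 \<in> poly_carrier (Suc n)" "c2 * g = q2 * d"
      using div[of 0 1] by auto
    obtain a' b' e1 e2 where fac: "f = a' * b'" "q1 = e1 * a'" "d = e2 * b'" "e1 \<in> poly_carrier n" "e2 \<in> poly_carrier n"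
      using factor_clear_denominator[OF f(1) f0(1) 1(1,2,3) dc 1(4)] by metis
    have "a' dvd 1 \<or> b' dvd 1" using f(2) fac(1) by (auto simp: irreducible_def)
    then show ?thesis
    proof
      assume "a' dvd 1"
      then obtain l where "1 = a' * l" by (auto elim: dvdE)
      then have "b' = f * l" unfolding fac(1) by (simp add: mult_ac)
      then have "f dvd c2 * g" unfolding 2(4) fac(3) by simp
      then show ?thesis using irreducible_dvd_cancel[OF f deg 2(1,2) gh(1)] by simp
    next
      assume "b' dvd 1"
      then have "b' \<in> poly_carrier n" using poly_carrier_dvd[of b' 1 n] by simp
      then have "d \<in> poly_carrier n" using fac by simp
      moreover have "f dvd d * h" unfolding ab(3) using gh(3) by (simp add: distrib_right mult.assoc)
      ultimately show ?thesis using irreducible_dvd_cancel[OF f deg _ d0 gh(2)] by simp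
    qed
  qed
  then show ?thesis using f f0 by (auto simp: prime_in_def)
qed

end

lemma irreducible_prime_in: "f \<in> poly_carrier n \<Longrightarrow> irreducible f \<Longrightarrow> prime_in n f" for f :: "'k::field mpoly"
proof (induction n arbitrary: f)
  case 0
  from 0(1) have "grade f = [:f:]"
    by (induction f rule: poly_carrier_induct) (auto simp: grade.eval_add grade.eval_mult mult.commute)
  then have "f = 0 \<or> f dvd 1" by (simp add: is_unit_mpoly_iff total_degree_def)
  then show ?case using 0 by (auto simp: irreducible_def)
next
  case (Suc n) then show ?case using irreducible_prime_in_Suc by blast
qed

text \<open>Only finitely many variables occur in \<open>f\<close>, \<open>a\<close> and
  \<open>b\<close>, so the primality relative to a common finite set of variables applies.\<close>

theorem irreducible_mpoly_imp_prime_elem: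
  fixes f :: "'k::field mpoly"
  assumes "irreducible f" shows "prime_elem f"
proof (rule prime_elemI)
  fix a b assume dvd: "f dvd a * b"
  obtain F where F: "f \<in> poly_carrier F" by (rule poly_carrier_exhaust)
  obtain A where A: "a \<in> poly_carrier A" by (rule poly_carrier_exhaust)
  obtain B where B: "b \<in> poly_carrier B" by (rule poly_carrier_exhaust)
  let ?N = "max F (max A B)"
  have "F \<le> ?N" "A \<le> ?N" "B \<le> ?N" by simp_all
  then have "f \<in> poly_carrier ?N" "a \<in> poly_carrier ?N" "b \<in> poly_carrier ?N"
    using F A B poly_carrier_mono by blast+
  then show "f dvd a \<or> f dvd b" using irreducible_prime_in[of f ?N] assms prime_inD dvd by blast
qed (use assms in \<open>auto simp: irreducible_def\<close>)

lemma prime_factor_exists: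
  fixes a :: "'k::field mpoly"
  assumes "a \<noteq> 0" "total_degree a > 0"
  obtains p where "prime_elem p" "p dvd a"
proof -
  have "\<not> a dvd 1" using assms by (simp add: is_unit_mpoly_iff)
  then show ?thesis using irreducible_factor_exists[OF assms(1)] irreducible_mpoly_imp_prime_elem that by blast
qed

section \<open>Forms\<close>

text \<open>Reversing coefficients turns a monomial into a constant. Hence the reversal of
  \<open>p\<close> is constant, and \<open>p\<close> consists of its leading term only.\<close>

lemma monom_factor:
  fixes p q :: "'a::idom poly"
  assumes "p * q = monom c d" "c \<noteq> 0"
  obtains e where "p = monom (lead_coeff p) e"
proof (rule that)
  have nz: "p \<noteq> 0" "q \<noteq> 0" using assms by auto
  have "reflect_poly (monom c d) = [:c:]"
    using assms(2) by (intro poly_eqI) (auto simp: coeff_reflect_poly degree_monom_eq coeff_pCons split: nat.splits)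
  then have "reflect_poly p * reflect_poly q = [:c:]"
    using assms by (simp flip: reflect_poly_mult)
  then have "degree (reflect_poly p * reflect_poly q) = 0" by simp
  then have deg: "degree (reflect_poly p) = 0" using nz by (simp add: degree_mult_eq)
  show "p = monom (lead_coeff p) (degree p)"
  proof (rule poly_eqI)
    fix i
    show "coeff p i = coeff (monom (lead_coeff p) (degree p)) i"
    proof (cases "i < degree p")
      case True
      then have "coeff p i = coeff (reflect_poly p) (degree p - i)" by (simp add: coeff_reflect_poly)
      also have "\<dots> = 0" using deg True by (intro coeff_eq_0) simp
      finally show ?thesis using True by simp
    next
      case False then show ?thesis by (cases "i = degree p") (auto simp: coeff_eq_0)
    qed
  qed
qed

lemma grade_expansion:
  "grade p = (\<Sum>t\<in>Poly_Mapping.keys p. monom (Poly_Mapping.single t (Poly_Mapping.lookup p t))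
     (\<Sum>i\<in>Poly_Mapping.keys t. Poly_Mapping.lookup t i))"
proof -
  have m: "(\<Prod>i\<in>Poly_Mapping.keys t. [:0, Var i:] ^ Poly_Mapping.lookup t i) =
     monom (Poly_Mapping.single t (1::'a)) (\<Sum>i\<in>Poly_Mapping.keys t. Poly_Mapping.lookup t i)" for t
  proof -
    have *: "[:0, Var i:] ^ n = monom (Var i ^ n) n" for i n
      by (induction n) (simp_all add: monom_Suc one_pCons[symmetric] monom_0 smult_monom)
    have "finite I \<Longrightarrow> (\<Prod>i\<in>I. monom (f i) (g i)) = monom (\<Prod>i\<in>I. f i) (\<Sum>i\<in>I. g i)"
      for I and f :: "nat \<Rightarrow> 'a mpoly" and g
      by (induction I rule: finite_induct) (auto simp: mult_monom one_pCons monom_0)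
    then show ?thesis using poly_mapping_expansion[of t] by (simp add: * Var_power prod_single_one)
  qed
  have "[:Const c:] * monom (Poly_Mapping.single t (1::'a)) n = monom (Poly_Mapping.single t c) n" for c t n
    by (simp add: smult_monom Const_def mult_single)
  then show ?thesis unfolding grade.eval_def m by simp
qed

text \<open>Turns a condition on exponents into an equation for the ring homomorphism
  \<open>grade\<close>, from which the behaviour of forms under sums and products is
  immediate.\<close>

lemma homogeneous_iff: "homogeneous d p \<longleftrightarrow> grade p = monom p d"
proof
  assume "homogeneous d p"
  then have "grade p = (\<Sum>t\<in>Poly_Mapping.keys p. monom (Poly_Mapping.single t (Poly_Mapping.lookup p t)) d)"
    unfolding grade_expansion homogeneous_def by (intro sum.cong) auto
  also have "\<dots> = monom (\<Sum>t\<in>Poly_Mapping.keys p. Poly_Mapping.single t (Poly_Mapping.lookup p t)) d"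
    by (induction "Poly_Mapping.keys p" rule: infinite_finite_induct) (auto simp: monom_sum)
  finally show "grade p = monom p d" using poly_mapping_expansion[of p] by simp
next
  assume g: "grade p = monom p d"
  show "homogeneous d p"
    unfolding homogeneous_def
  proof (rule ballI, rule ccontr)
    fix t assume t: "t \<in> Poly_Mapping.keys p"
    let ?w = "\<lambda>t. \<Sum>i\<in>Poly_Mapping.keys t. Poly_Mapping.lookup t i"
    assume ne: "?w t \<noteq> d"
    have "coeff (grade p) (?w t) = 0" using ne unfolding g by simp
    then have "0 = (\<Sum>u\<in>Poly_Mapping.keys p. if ?w u = ?w t then Poly_Mapping.single u (Poly_Mapping.lookup p u) else 0)"
      unfolding grade_expansion coeff_sum by simp
    then have "0 = Poly_Mapping.lookup (\<Sum>u\<in>Poly_Mapping.keys p. if ?w u = ?w t then Poly_Mapping.single u (Poly_Mapping.lookup p u) else 0) t"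
      by (metis lookup_zero)
    also have "\<dots> = (\<Sum>u\<in>Poly_Mapping.keys p. if u = t then Poly_Mapping.lookup p u else 0)"
      unfolding lookup_sum by (intro sum.cong) (auto simp: lookup_single when_def)
    also have "\<dots> = Poly_Mapping.lookup p t" using t by simp
    finally show False using t by (simp add: in_keys_iff)
  qed
qed

lemma homogeneous_0 [simp]: "homogeneous d 0"
  by (simp add: homogeneous_def)

lemma homogeneous_1 [simp]: "homogeneous 0 (1 :: 'k::field mpoly)"
  by (simp add: homogeneous_iff one_pCons monom_0)

lemma homogeneous_mult: "homogeneous d p \<Longrightarrow> homogeneous e q \<Longrightarrow> homogeneous (d + e) (p * q)"
  for p q :: "'k::field mpoly"
  by (simp add: homogeneous_iff grade.eval_mult mult_monom)

lemma homogeneous_unique: "homogeneous d p \<Longrightarrow> p \<noteq> 0 \<Longrightarrow> total_degree p = d"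
  by (simp add: homogeneous_iff total_degree_def degree_monom_eq)

lemma homogeneous_power: "homogeneous d p \<Longrightarrow> homogeneous (n * d) (p ^ n)" for p :: "'k::field mpoly"
  by (induction n) (auto simp: homogeneous_mult)

lemma homogeneous_Var [simp]: "homogeneous 1 (Var i :: 'k::field mpoly)"
  by (simp add: homogeneous_iff monom_Suc monom_0)

lemma homogeneous_Const [simp]: "homogeneous 0 (Const c :: 'k::field mpoly)"
  by (simp add: homogeneous_iff monom_0)

definition form :: "nat \<Rightarrow> 'k::field mpoly \<Rightarrow> bool" where
  "form m p \<longleftrightarrow> p \<in> poly_carrier m \<and> p \<noteq> 0 \<and> homogeneous (total_degree p) p"

lemma formI: "p \<in> poly_carrier m \<Longrightarrow> p \<noteq> 0 \<Longrightarrow> homogeneous d p \<Longrightarrow> form m p"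
  using homogeneous_unique by (auto simp: form_def)

lemma formD: "form m p \<Longrightarrow> p \<in> poly_carrier m" "form m p \<Longrightarrow> p \<noteq> 0" "form m p \<Longrightarrow> homogeneous (total_degree p) p"
  by (auto simp: form_def)

text \<open>The image of a form under \<open>grade\<close> is a monomial, and over a domain the
  factors of a monomial are monomials.\<close>

lemma form_factor: assumes "form m (p * q)" shows "form m p"
proof -
  have nz: "p * q \<noteq> 0" "p * q \<in> poly_carrier m" using assms by (auto simp: form_def)
  have "grade p * grade q = monom (p * q) (total_degree (p * q))"
    using assms by (simp add: form_def homogeneous_iff grade.eval_mult)
  then obtain e where e: "grade p = monom (lead_coeff (grade p)) e" using monom_factor nz(1) by blast
  then have "p = lead_coeff (grade p)" by (metis poly_grade_1 poly_monom power_one mult.right_neutral)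
  then have "homogeneous e p" using e by (simp add: homogeneous_iff)
  then show ?thesis using nz poly_carrier_factor by (auto intro: formI)
qed

lemma form_mult_iff: "form m (p * q) \<longleftrightarrow> form m p \<and> form m q"
proof
  assume "form m (p * q)"
  then show "form m p \<and> form m q" using form_factor[of m p q] form_factor[of m q p] by (simp add: mult.commute)
next
  assume "form m p \<and> form m q"
  then show "form m (p * q)" by (intro formI[OF _ _ homogeneous_mult]) (auto simp: form_def)
qed

lemma Var_neq_0 [simp]: "Var i \<noteq> 0"
  by (metis Var_def lookup_single_eq lookup_zero zero_neq_one)

lemma form_Var [simp]: "i < m \<Longrightarrow> form m (Var i)"
  by (rule formI[OF _ _ homogeneous_Var]) auto

lemma total_degree_Var [simp]: "total_degree (Var i :: 'k::field mpoly) = 1"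
  using homogeneous_unique[OF homogeneous_Var, of i] by simp

lemma form_Const [simp]: "c \<noteq> 0 \<Longrightarrow> form m (Const c)"
  by (intro formI[of _ _ 0]) auto

lemma form_1 [simp]: "form m 1"
  by (rule formI[of _ _ 0]) auto

section \<open>Prime forms and their multiplicities\<close>

lemma prime_elem_imp_irreducible_idom: "prime_elem p \<Longrightarrow> irreducible p" for p :: "'a::idom"
proof (rule irreducibleI)
  assume p: "prime_elem p"
  then show "p \<noteq> 0" "\<not> p dvd 1" by (auto simp: prime_elem_def)
  fix a b assume ab: "p = a * b"
  have *: "y dvd 1" if xy: "p = x * y" "p dvd x" for x y
  proof -
    obtain k where k: "x = p * k" using xy(2) by (rule dvdE)
    have "p * 1 = x * y" using xy(1) by simp
    also have "\<dots> = p * (k * y)" by (simp only: k mult.assoc)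
    finally have "1 = k * y" using \<open>p \<noteq> 0\<close> mult_left_cancel by blast
    then show ?thesis by (metis dvd_triv_right)
  qed
  have "p dvd a * b" by (simp flip: ab)
  then have "p dvd a \<or> p dvd b" using p unfolding prime_elem_def by blast
  then show "a dvd 1 \<or> b dvd 1" using *[OF ab] *[OF trans[OF ab mult.commute]] by blast
qed

definition prime_form :: "nat \<Rightarrow> 'k::field mpoly \<Rightarrow> bool" where
  "prime_form m q \<longleftrightarrow> form m q \<and> prime_elem q"

lemma prime_form_total_degree: "prime_form m q \<Longrightarrow> total_degree q > 0"
  using is_unit_mpoly_iff[of q] by (auto simp: prime_form_def prime_elem_def)

lemma prime_formD: "prime_form m q \<Longrightarrow> form m q" "prime_form m q \<Longrightarrow> q \<noteq> 0"
   "prime_form m q \<Longrightarrow> q \<in> poly_carrier m" "prime_form m q \<Longrightarrow> \<not> q dvd 1"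
   "prime_form m q \<Longrightarrow> q dvd a * b \<longleftrightarrow> q dvd a \<or> q dvd b"
  by (auto simp: prime_form_def form_def prime_elem_def)

lemma prime_form_power: "prime_form m q \<Longrightarrow> q dvd a ^ n \<Longrightarrow> q dvd a"
  by (induction n) (auto simp: prime_formD)

text \<open>Factorization into primes as an induction rule. A prime factor of a form and its
  cofactor are again forms, and splitting it off lowers the total degree.\<close>

lemma form_induct [consumes 1, case_names Const prime]:
  assumes "form m a" and C: "\<And>c. c \<noteq> 0 \<Longrightarrow> P (Const c)"
    and M: "\<And>q a. prime_form m q \<Longrightarrow> form m a \<Longrightarrow> P a \<Longrightarrow> P (q * a)"
  shows "P a"
  using assms(1)
proof (induction "total_degree a" arbitrary: a rule: less_induct)
  case less
  show ?case
  proof (cases "total_degree a = 0")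
    case True
    then obtain c where "a = Const c" by (rule total_degree_eq_0D)
    then show ?thesis using C less.prems by (auto simp: form_def)
  next
    case False
    then obtain q where q: "prime_elem q" "q dvd a" using prime_factor_exists[of a] less.prems by (auto simp: form_def)
    then obtain a' where a': "a = q * a'" by (auto elim: dvdE)
    then have f: "prime_form m q" "form m a'" using less.prems q by (auto simp: prime_form_def form_mult_iff)
    then have "total_degree a' < total_degree a"
      using prime_form_total_degree[OF f(1)] by (simp add: a' total_degree_mult formD prime_formD)
    then show ?thesis using less.hyps f M a' by blast
  qed
qed

lemma prime_form_associated:
  assumes "prime_form m q" "prime_form m p" "q dvd p"
  obtains c where "c \<noteq> 0" "p = Const c * q"
proof -
  obtain k where k: "p = q * k" using assms(3) by (auto elim: dvdE)
  have "irreducible p" using assms(2) prime_elem_imp_irreducible_idom by (auto simp: prime_form_def)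
  then have "k dvd 1" using k prime_formD(4)[OF assms(1)] by (auto simp: irreducible_def)
  then obtain c where "k = Const c" "c \<noteq> 0" using is_unit_mpoly_iff[of k] by (metis Const_0 total_degree_eq_0D)
  then show ?thesis using that k by (simp add: mult.commute)
qed

lemma mult_exponent_exists:
  assumes q: "prime_form m q" and "a \<noteq> 0"
  obtains n h where "a = q ^ n * h" "\<not> q dvd h"
  using assms(2)
proof (induction "total_degree a" arbitrary: a thesis rule: less_induct)
  case less
  show ?case
  proof (cases "q dvd a")
    case True
    then obtain a' where a': "a = q * a'" by (auto elim: dvdE)
    then have "a' \<noteq> 0" using less.prems by auto
    moreover from this have "total_degree a' < total_degree a"
      using prime_form_total_degree[OF q] prime_formD(2)[OF q] by (simp add: a' total_degree_mult)
    ultimately obtain n h where "a' = q ^ n * h" "\<not> q dvd h" using less.hyps by metis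
    then show ?thesis using less.prems(1)[of "Suc n" h] a' by (simp add: mult.assoc)
  next
    case False then show ?thesis using less.prems(1)[of 0 a] by simp
  qed
qed

lemma mult_exponent_unique:
  assumes q: "prime_form m q" and "q ^ n * h = q ^ n' * h'" "\<not> q dvd h" "\<not> q dvd h'"
  shows "n = n'"
proof -
  have *: "n \<le> n'" if "q ^ n * h = q ^ n' * h'" "\<not> q dvd h'" for n n' h h'
  proof (rule ccontr)
    assume "\<not> n \<le> n'"
    then have "q ^ n' * (q ^ (n - n') * h) = q ^ n' * h'" using that(1) by (simp flip: power_add mult.assoc)
    then have "h' = q ^ (n - n') * h" using prime_formD(2)[OF q] by simp
    then show False using that(2) \<open>\<not> n \<le> n'\<close> by (simp add: dvd_power)
  qed
  show ?thesis using *[of n h n' h'] *[of n' h' n h] assms by auto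
qed

definition mult_exponent :: "'k::field mpoly \<Rightarrow> 'k mpoly \<Rightarrow> nat" where
  "mult_exponent q a = (THE n. \<exists>h. a = q ^ n * h \<and> \<not> q dvd h)"

lemma mult_exponent_eqI: "prime_form m q \<Longrightarrow> a = q ^ n * h \<Longrightarrow> \<not> q dvd h \<Longrightarrow> mult_exponent q a = n"
  unfolding mult_exponent_def by (rule the_equality) (auto dest: mult_exponent_unique)

lemma mult_exponent_decomp:
  assumes "prime_form m q" "a \<noteq> 0"
  obtains h where "a = q ^ mult_exponent q a * h" "\<not> q dvd h"
  using mult_exponent_exists[OF assms] mult_exponent_eqI[OF assms(1)] by metis

lemma mult_exponent_mult:
  assumes "prime_form m q" "a \<noteq> 0" "b \<noteq> 0"
  shows "mult_exponent q (a * b) = mult_exponent q a + mult_exponent q b"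
proof -
  define k l where "k = mult_exponent q a" and "l = mult_exponent q b"
  obtain h where h: "a = q ^ k * h" "\<not> q dvd h" unfolding k_def using mult_exponent_decomp assms by blast
  obtain h' where h': "b = q ^ l * h'" "\<not> q dvd h'" unfolding l_def using mult_exponent_decomp assms by blast
  have "a * b = q ^ (k + l) * (h * h')"
    unfolding h(1) h'(1) by (simp add: power_add mult_ac)
  then show ?thesis using assms(1) h(2) h'(2) unfolding k_def[symmetric] l_def[symmetric]
    by (intro mult_exponent_eqI[where h="h * h'"]) (auto simp: prime_formD)
qed

lemma mult_exponent_not_dvd: "prime_form m q \<Longrightarrow> \<not> q dvd a \<Longrightarrow> mult_exponent q a = 0"
  by (rule mult_exponent_eqI[where h=a]) auto

lemma mult_exponent_associated: "prime_form m q \<Longrightarrow> c \<noteq> 0 \<Longrightarrow> mult_exponent q (Const c * q) = 1"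
proof (rule mult_exponent_eqI[where h="Const c"])
  assume q: "prime_form m q" and c: "c \<noteq> 0"
  show "\<not> q dvd Const c" using prime_formD(4)[OF q] Const_dvd_1[OF c] dvd_trans by blast
qed (auto simp: mult.commute)

section \<open>Prime divisors\<close>

lemma poly_ring_simps [simp]:
  "carrier (poly_ring m) = poly_carrier m" "x \<otimes>\<^bsub>poly_ring m\<^esub> y = x * y" "\<one>\<^bsub>poly_ring m\<^esub> = 1"
  "\<zero>\<^bsub>poly_ring m\<^esub> = 0" "x \<oplus>\<^bsub>poly_ring m\<^esub> y = x + y"
  by (simp_all add: poly_ring_def)

lemma cring_poly_ring: "cring (poly_ring m)"
proof -
  have "\<exists>q\<in>poly_carrier m. q + p = 0" if "p \<in> poly_carrier m" for p :: "'a mpoly"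
    using that by (intro bexI[of _ "- p"]) auto
  then show ?thesis
    by (intro cringI abelian_groupI comm_monoidI) (auto simp: algebra_simps)
qed

definition pideal :: "nat \<Rightarrow> 'k::field mpoly \<Rightarrow> 'k mpoly set" where
  "pideal m q = {p \<in> poly_carrier m. q dvd p}"

lemma ideal_poly_ringI:
  assumes "I \<subseteq> poly_carrier m" "0 \<in> I" "\<And>a b. a \<in> I \<Longrightarrow> b \<in> I \<Longrightarrow> a + b \<in> I"
    "\<And>a r. a \<in> I \<Longrightarrow> r \<in> poly_carrier m \<Longrightarrow> a * r \<in> I"
  shows "ideal I (poly_ring m)"
proof (rule idealI)
  interpret cring "poly_ring m" by (rule cring_poly_ring)
  show "ring (poly_ring m)" ..
  have neg: "- a \<in> I" if "a \<in> I" for a using assms(4)[OF that, of "- 1"] by simp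
  have "\<ominus>\<^bsub>poly_ring m\<^esub> a = - a" if "a \<in> I" for a
    using that neg assms(1) minus_equality[of "- a" a] by auto
  then show "subgroup I (add_monoid (poly_ring m))"
    using assms neg by (intro add.subgroupI) auto
qed (use assms(4) in \<open>auto simp: mult.commute\<close>)

lemma ideal_pideal: "q \<in> poly_carrier m \<Longrightarrow> ideal (pideal m q) (poly_ring m)"
  by (rule ideal_poly_ringI) (auto simp: pideal_def)

lemma ideal_poly_ringD:
  assumes "ideal I (poly_ring m)"
  shows "I \<subseteq> poly_carrier m" "0 \<in> I" "a \<in> I \<Longrightarrow> r \<in> poly_carrier m \<Longrightarrow> a * r \<in> I"
proof -
  interpret ideal I "poly_ring m" by fact
  show "I \<subseteq> poly_carrier m" using a_subset by simp
  show "0 \<in> I" using additive_subgroup.zero_closed[OF is_additive_subgroup] by simp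
  show "a \<in> I \<Longrightarrow> r \<in> poly_carrier m \<Longrightarrow> a * r \<in> I" using I_r_closed[of a r] by simp
qed

lemma primeideal_poly_ringD:
  assumes "primeideal I (poly_ring m)"
  shows "ideal I (poly_ring m)" "1 \<notin> I"
    "a \<in> poly_carrier m \<Longrightarrow> b \<in> poly_carrier m \<Longrightarrow> a * b \<in> I \<Longrightarrow> a \<in> I \<or> b \<in> I"
proof -
  interpret primeideal I "poly_ring m" by fact
  show "ideal I (poly_ring m)" ..
  show "1 \<notin> I" using one_imp_carrier I_notcarr by auto
  show "a \<in> poly_carrier m \<Longrightarrow> b \<in> poly_carrier m \<Longrightarrow> a * b \<in> I \<Longrightarrow> a \<in> I \<or> b \<in> I"
    using I_prime[of a b] by simp
qed

lemma primeideal_pideal: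
  assumes "prime_form m q" shows "primeideal (pideal m q) (poly_ring m)"
proof (rule primeidealI)
  show "ideal (pideal m q) (poly_ring m)" using ideal_pideal assms prime_formD(3) by blast
  show "cring (poly_ring m)" by (rule cring_poly_ring)
  have "1 \<in> poly_carrier m - pideal m q" using assms by (auto simp: pideal_def prime_formD)
  then show "carrier (poly_ring m) \<noteq> pideal m q" by auto
qed (use assms in \<open>auto simp: pideal_def prime_formD\<close>)

lemma genideal_pideal:
  assumes "prime_form m q"
  shows "genideal (poly_ring m) {p \<in> pideal m q. \<exists>d. homogeneous d p} = pideal m q"
proof
  show "genideal (poly_ring m) {p \<in> pideal m q. \<exists>d. homogeneous d p} \<subseteq> pideal m q"
    unfolding genideal_def using ideal_pideal[OF prime_formD(3)[OF assms]] by auto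
  show "pideal m q \<subseteq> genideal (poly_ring m) {p \<in> pideal m q. \<exists>d. homogeneous d p}"
    unfolding genideal_def
  proof (intro Inter_greatest subsetI)
    fix I p assume I: "I \<in> {I. ideal I (poly_ring m) \<and> {p \<in> pideal m q. \<exists>d. homogeneous d p} \<subseteq> I}" and p: "p \<in> pideal m q"
    have "q \<in> {p \<in> pideal m q. \<exists>d. homogeneous d p}"
      using assms by (auto simp: pideal_def prime_form_def form_def)
    then have q: "q \<in> I" using I by auto
    have "q dvd p" using p by (simp add: pideal_def)
    then obtain r where r: "p = q * r" by (rule dvdE)
    show "p \<in> I"
    proof (cases "p = 0")
      case True then show ?thesis using I ideal_poly_ringD(2) by auto
    next
      case False
      then have "r \<in> poly_carrier m" using p r poly_carrier_factor[of r q m] by (simp add: pideal_def mult.commute)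
      then show ?thesis using I q r ideal_poly_ringD(3) by auto
    qed
  qed
qed

lemma Const_mult_Var_eq: 
  assumes "Const c * Var i = Const c' * (Var j :: 'k::field mpoly)" "c \<noteq> 0" shows "i = j"
proof -
  have "Poly_Mapping.single (Poly_Mapping.single i (1::nat)) c = Poly_Mapping.single (Poly_Mapping.single j 1) c'"
    using assms(1) by (simp add: Const_def Var_def mult_single)
  then have "Poly_Mapping.lookup (Poly_Mapping.single (Poly_Mapping.single j (1::nat)) c') (Poly_Mapping.single i 1) = c"
    by (metis lookup_single_eq)
  then have "Poly_Mapping.single i (1::nat) = Poly_Mapping.single j 1" using assms(2)
    by (auto simp: lookup_single when_def split: if_splits)
  then have "Poly_Mapping.lookup (Poly_Mapping.single j (1::nat)) i = 1" by (metis lookup_single_eq)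
  then show ?thesis by (auto simp: lookup_single when_def split: if_splits)
qed

text \<open>A prime form dividing both the variables 0 and 1 would be a scalar multiple of each of
  them. The variable obtained here is a local unit used to build functions of degree 0.\<close>

lemma Var_not_all_dvd:
  assumes "m \<ge> 2" "prime_form m q"
  obtains j where "j < m" "\<not> q dvd Var j"
proof -
  have "\<exists>c. c \<noteq> 0 \<and> Var j = Const c * q" if j: "q dvd Var j" for j
  proof -
    obtain k where k: "Var j = q * k" using j by (rule dvdE)
    have kn: "k \<noteq> 0" "q \<noteq> 0" using k Var_neq_0[of j, where 'a='a] by auto
    have "total_degree q + total_degree k = 1" using k total_degree_mult[OF kn(2,1)] total_degree_Var[of j, where 'k='a] by simp
    then have "total_degree k = 0" using prime_form_total_degree[OF assms(2)] by simp
    then obtain c where "k = Const c" by (rule total_degree_eq_0D)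
    then show ?thesis using k kn by (auto simp: mult.commute)
  qed
  then have "\<not> (q dvd Var 0 \<and> q dvd Var 1)"
  proof (intro notI)
    assume *: "\<And>j. q dvd Var j \<Longrightarrow> \<exists>c. c \<noteq> 0 \<and> Var j = Const c * q" "q dvd Var 0 \<and> q dvd Var 1"
    obtain c where c: "c \<noteq> 0" "Var 0 = Const c * q" using * by blast
    obtain d where d: "d \<noteq> 0" "Var 1 = Const d * q" using * by blast
    have "Const d * Var 0 = Const c * Var 1" unfolding c d by (simp add: mult_ac)
    then show False using Const_mult_Var_eq[of d 0 c 1] d by auto
  qed
  then show ?thesis using that[of 0] that[of 1] assms by auto
qed

lemma pideal_in_proj_points:
  assumes "m \<ge> 2" "prime_form m q" shows "pideal m q \<in> proj_points m"
proof -
  obtain j where "j < m" "\<not> q dvd Var j" using Var_not_all_dvd[OF assms] by blast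
  then have "\<not> Var ` {..<m} \<subseteq> pideal m q" by (auto simp: pideal_def)
  then show ?thesis unfolding proj_points_def
    using primeideal_pideal[OF assms(2)] genideal_pideal[OF assms(2)] by simp
qed

text \<open>For minimality, take a nonzero element of a smaller point \<open>Q\<close> and write it
  as a power of \<open>q\<close> times some \<open>h\<close> prime to \<open>q\<close>. Since
  \<open>h\<close> lies outside \<open>Q\<close>, the prime ideal \<open>Q\<close> contains
  \<open>q\<close>.\<close>

lemma pideal_in_prime_divisors:
  assumes "m \<ge> 2" "prime_form m q" shows "pideal m q \<in> prime_divisors m"
proof -
  have "q \<in> pideal m q" using assms by (auto simp: pideal_def prime_formD)
  then have "pideal m q \<noteq> {0}" using assms prime_formD(2) by auto
  moreover have "Q = pideal m q" if Q: "Q \<in> proj_points m" "Q \<subseteq> pideal m q" "Q \<noteq> {0}" for Q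
  proof -
    have pr: "primeideal Q (poly_ring m)" using Q by (auto simp: proj_points_def)
    note D = primeideal_poly_ringD[OF pr]
    note D1 = ideal_poly_ringD[OF D(1)]
    obtain g where g: "g \<in> Q" "g \<noteq> 0" using Q(3) D1 by auto
    have gc: "g \<in> poly_carrier m" using g D1 by auto
    obtain n h where nh: "g = q ^ n * h" "\<not> q dvd h" using mult_exponent_exists[OF assms(2) g(2)] by blast
    have hc: "h \<in> poly_carrier m" using poly_carrier_factor[of h "q ^ n" m] nh g gc by (simp add: mult.commute)
    have qc: "q \<in> poly_carrier m" using assms by (simp add: prime_formD)
    have "h \<notin> Q" using nh Q(2) by (auto simp: pideal_def)
    then have "q ^ n \<in> Q" using D(3)[of "q ^ n" h] nh g hc qc by auto
    then have "q \<in> Q"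
    proof (induction n)
      case 0 then show ?case using D(2) by simp
    next
      case (Suc n) then show ?case using D(3)[of q "q ^ n"] qc by auto
    qed
    have "p \<in> Q" if p: "p \<in> pideal m q" for p
    proof -
      have "q dvd p" using p by (simp add: pideal_def)
      then obtain r where r: "p = q * r" by (rule dvdE)
      show ?thesis
      proof (cases "p = 0")
        case False
        then have "r \<in> poly_carrier m" using p r poly_carrier_factor[of r q m] by (simp add: pideal_def mult.commute)
        then show ?thesis using \<open>q \<in> Q\<close> r D1(3) by auto
      qed (use D1 in simp)
    qed
    then show ?thesis using Q(2) by auto
  qed
  ultimately show ?thesis unfolding prime_divisors_def using pideal_in_proj_points[OF assms] by auto
qed

text \<open>A nonzero ideal generated by homogeneous elements contains a form, and if it is prime it
  contains one of the prime factors \<open>q\<close> of that form. Minimality then forces it to be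
  the ideal of \<open>q\<close>.\<close>

lemma prime_divisors_eq:
  assumes "m \<ge> 2"
  shows "prime_divisors m = (pideal m ` {q. prime_form m q} :: 'k::field mpoly set set)"
proof
  show "pideal m ` {q. prime_form m q} \<subseteq> (prime_divisors m :: 'k mpoly set set)" using pideal_in_prime_divisors assms by auto
  show "(prime_divisors m :: 'k mpoly set set) \<subseteq> pideal m ` {q. prime_form m q}"
  proof
    fix P :: "'k mpoly set" assume P: "P \<in> prime_divisors m"
    then have pr: "primeideal P (poly_ring m)" and gen: "genideal (poly_ring m) {p \<in> P. \<exists>d. homogeneous d p} = P"
      and nz: "P \<noteq> {0}" and min: "\<And>Q. Q \<in> proj_points m \<Longrightarrow> Q \<subseteq> P \<Longrightarrow> Q = {0} \<or> Q = P"
      by (auto simp: prime_divisors_def proj_points_def)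
    note D = primeideal_poly_ringD[OF pr]
    note D1 = ideal_poly_ringD[OF D(1)]
    have "\<exists>g\<in>P. form m g"
    proof (rule ccontr)
      assume "\<not> (\<exists>g\<in>P. form m g)"
      then have "{p \<in> P. \<exists>d. homogeneous d p} \<subseteq> {0}" using D1(1) formI by blast
      moreover have "ideal {0} (poly_ring m :: 'k mpoly ring)" by (rule ideal_poly_ringI) auto
      ultimately have "genideal (poly_ring m) {p \<in> P. \<exists>d. homogeneous d p} \<subseteq> {0}"
        unfolding genideal_def by blast
      then show False using gen nz D1(2) by auto
    qed
    then obtain g where g: "g \<in> P" "form m g" by auto
    from g(2,1) have "\<exists>q\<in>P. prime_form m q"
    proof (induction rule: form_induct)
      case (Const c)
      then have "Const c * Const (inverse c) \<in> P" by (intro D1) auto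
      then show ?case using Const D(2) by (simp flip: Const_mult)
    next
      case (prime q a)
      then have "q \<in> P \<or> a \<in> P" using D(3)[of q a] formD prime_formD(3) by blast
      then show ?case using prime by auto
    qed
    then obtain q where q: "q \<in> P" "prime_form m q" by auto
    have "pideal m q \<subseteq> P"
    proof
      fix p assume p: "p \<in> pideal m q"
      then have "q dvd p" by (simp add: pideal_def)
      then obtain r where r: "p = q * r" by (rule dvdE)
      show "p \<in> P"
      proof (cases "p = 0")
        case False
        then have "r \<in> poly_carrier m" using p r poly_carrier_factor[of r q m] by (simp add: pideal_def mult.commute)
        then show ?thesis using q r D1(3) by auto
      qed (use D1 in simp)
    qed
    moreover have "q \<in> pideal m q" using prime_formD(3)[OF q(2)] by (simp add: pideal_def)
    then have "pideal m q \<noteq> {0}" using prime_formD(2)[OF q(2)] by auto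
    ultimately show "P \<in> pideal m ` {q. prime_form m q}"
      using min[OF pideal_in_proj_points[OF assms q(2)]] q by auto
  qed
qed

lemma pideal_associated: "c \<noteq> 0 \<Longrightarrow> pideal m (Const c * q) = pideal m q"
proof -
  assume c: "c \<noteq> 0"
  have "q = Const (inverse c) * (Const c * q)" using c by (simp flip: Const_mult mult.assoc)
  then have "Const c * q dvd q" by (metis dvd_triv_right)
  moreover have "q dvd Const c * q" by simp
  ultimately show ?thesis unfolding pideal_def using dvd_trans by blast
qed

lemma pideal_eqI: "prime_form m q \<Longrightarrow> prime_form m p \<Longrightarrow> q dvd p \<Longrightarrow> pideal m q = pideal m p"
  by (metis pideal_associated prime_form_associated)

lemma dvd_if_pideal_eq:
  assumes "prime_form m p" "pideal m q = pideal m p" shows "q dvd p"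
proof -
  have "p \<in> pideal m p" using prime_formD(3)[OF assms(1)] by (simp add: pideal_def)
  then show ?thesis unfolding assms(2)[symmetric] by (simp add: pideal_def)
qed

section \<open>Valuations\<close>

text \<open>Two uniformizers of a local ring differ by a unit, so the exponent in \<open>u t\<^sup>n\<close> is unique.\<close>

lemma uniformizer_exponent_le:
  fixes L :: "'f::field set"
  assumes mult: "\<And>x y. x \<in> L \<Longrightarrow> y \<in> L \<Longrightarrow> x * y \<in> L" and one: "1 \<in> L"
    and t: "(\<lambda>h. t * h) ` L = (\<lambda>h. t' * h) ` L" "1 \<notin> (\<lambda>h. t * h) ` L" "t \<noteq> 0" "t \<in> L"
    and u: "inverse u' \<in> L" "u \<in> L" "inverse u \<in> L" "u' \<in> L" "u \<noteq> 0" "u' \<noteq> 0"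
    and eq: "u * t powi n = u' * t' powi n'"
  shows "n \<le> n'"
proof (rule ccontr)
  assume "\<not> n \<le> n'"
  then have "n' < n" by simp
  then obtain k where k: "n = n' + int (Suc k)" by (auto simp: zless_iff_Suc_zadd)
  have pow: "x ^ j \<in> L" if "x \<in> L" for x j using that by (induction j) (auto simp: one mult)
  have "t' * 1 \<in> (\<lambda>h. t * h) ` L" unfolding t(1) using one by blast
  then obtain v where v: "v \<in> L" "t' = t * v" by auto
  have "t * 1 \<in> (\<lambda>h. t' * h) ` L" unfolding t(1)[symmetric] using one by blast
  then obtain v' where v': "v' \<in> L" "t = t' * v'" by auto
  have "t * 1 = t * (v * v')" using v'(2) unfolding v(2) by (simp add: mult.assoc)
  then have vv: "v * v' = 1" using t(3) by simp
  then have v0: "v \<noteq> 0" and inv: "inverse v = v'" by (auto intro: inverse_unique)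
  have "t powi n = t powi n' * t ^ Suc k"
    unfolding k using t(3) by (subst power_int_add) (auto simp del: power_Suc of_nat_Suc)
  then have "(u * t ^ Suc k) * t powi n' = (u' * v powi n') * t powi n'"
    using eq unfolding v(2) by (simp add: power_int_mult_distrib mult_ac)
  moreover have "t powi n' \<noteq> 0" using t(3) by simp
  ultimately have e: "u * t ^ Suc k = u' * v powi n'" using mult_right_cancel by blast
  have vn: "v powi (- n') \<in> L"
  proof (cases "n' \<le> 0")
    case True
    then have "v powi (- n') = v ^ nat (- n')" by (simp add: power_int_def)
    then show ?thesis using pow v by simp
  next
    case False
    then have "v powi (- n') = v' ^ nat n'" by (simp add: power_int_def inv)
    then show ?thesis using pow v' by simp
  qed
  \<comment> \<open>If \<open>n\<close> exceeded \<open>n'\<close>, then 1 would be a multiple of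
    the uniformizer \<open>t\<close> inside \<open>L\<close>.\<close>
  have "t * (t ^ k * (u * inverse u' * v powi (- n'))) = (u * t ^ Suc k) * (inverse u' * v powi (- n'))"
    by (simp add: mult_ac)
  also have "\<dots> = (u' * inverse u') * (v powi n' * v powi (- n'))" unfolding e by (simp add: mult_ac)
  also have "\<dots> = 1" using u(6) v0 by (simp flip: power_int_add)
  finally have "1 = t * (t ^ k * (u * inverse u' * v powi (- n')))" ..
  moreover have "t ^ k * (u * inverse u' * v powi (- n')) \<in> L"
    using pow[OF t(4)] vn u by (intro mult)
  ultimately show False using t(2) by blast
qed

lemma local_ringI:
  "p \<in> poly_carrier m \<Longrightarrow> s \<in> poly_carrier m \<Longrightarrow> \<not> q dvd s \<Longrightarrow> homogeneous d p \<Longrightarrow> homogeneous d s \<Longrightarrow>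
    Fract p s \<in> local_ring m (pideal m q)"
  unfolding local_ring_def pideal_def by blast

lemma local_ringE:
  assumes "x \<in> local_ring m (pideal m q)"
  obtains p s d where "x = Fract p s" "p \<in> poly_carrier m" "s \<in> poly_carrier m" "\<not> q dvd s"
    "homogeneous d p" "homogeneous d s" "s \<noteq> 0"
proof -
  obtain p s d where *: "x = Fract p s" "p \<in> poly_carrier m" "s \<in> poly_carrier m - pideal m q"
    "homogeneous d p" "homogeneous d s"
    using assms unfolding local_ring_def by blast
  then have "\<not> q dvd s" "s \<noteq> 0" by (auto simp: pideal_def)
  then show ?thesis using that * by blast
qed

lemma local_maxI:
  "p \<in> poly_carrier m \<Longrightarrow> q dvd p \<Longrightarrow> s \<in> poly_carrier m \<Longrightarrow> \<not> q dvd s \<Longrightarrow> homogeneous d p \<Longrightarrow> homogeneous d s \<Longrightarrow>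
    Fract p s \<in> local_max m (pideal m q)"
  unfolding local_max_def pideal_def by blast

lemma local_maxE:
  assumes "x \<in> local_max m (pideal m q)"
  obtains p s d where "x = Fract p s" "p \<in> poly_carrier m" "q dvd p" "s \<in> poly_carrier m" "\<not> q dvd s"
    "homogeneous d p" "homogeneous d s" "s \<noteq> 0"
proof -
  obtain p s d where *: "x = Fract p s" "p \<in> pideal m q" "s \<in> poly_carrier m - pideal m q"
    "homogeneous d p" "homogeneous d s"
    using assms unfolding local_max_def by blast
  then have "p \<in> poly_carrier m" "q dvd p" "s \<in> poly_carrier m" "\<not> q dvd s" "s \<noteq> 0" by (auto simp: pideal_def)
  then show ?thesis using that *(1,4,5) by blast
qed

lemma local_max_subset: "local_max m (pideal m q) \<subseteq> local_ring m (pideal m q)"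
  by (auto elim!: local_maxE intro: local_ringI)

lemma Fract_not_local_max:
  assumes q: "prime_form m q" and "\<not> q dvd x" "y \<noteq> 0"
  shows "Fract x y \<notin> local_max m (pideal m q)"
proof
  assume "Fract x y \<in> local_max m (pideal m q)"
  then obtain p s where ps: "Fract x y = Fract p s" "q dvd p" "\<not> q dvd s" "s \<noteq> 0"
    by (rule local_maxE)
  then have "x * s = p * y" using assms(3) by (simp add: eq_fract)
  then have "q dvd x * s" using ps(2) by simp
  then show False using ps assms prime_formD(5)[OF q] by blast
qed

lemma local_ring_mult:
  assumes "prime_form m q" "x \<in> local_ring m (pideal m q)" "y \<in> local_ring m (pideal m q)"
  shows "x * y \<in> local_ring m (pideal m q)"
proof -
  obtain p s d where p: "x = Fract p s" "p \<in> poly_carrier m" "s \<in> poly_carrier m" "\<not> q dvd s"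
    "homogeneous d p" "homogeneous d s" using assms(2) by (rule local_ringE)
  obtain p' s' d' where p': "y = Fract p' s'" "p' \<in> poly_carrier m" "s' \<in> poly_carrier m" "\<not> q dvd s'"
    "homogeneous d' p'" "homogeneous d' s'" using assms(3) by (rule local_ringE)
  show ?thesis unfolding p(1) p'(1) mult_fract
    using p p' prime_formD(5)[OF assms(1)] by (intro local_ringI[where d="d + d'"]) (auto simp: homogeneous_mult)
qed

lemma local_ring_one: "prime_form m q \<Longrightarrow> 1 \<in> local_ring m (pideal m q)"
  unfolding One_fract_def by (rule local_ringI[where d=0]) (auto simp: prime_formD)

lemma local_ring_inverse:
  assumes "u \<in> local_ring m (pideal m q) - local_max m (pideal m q)"
  shows "inverse u \<in> local_ring m (pideal m q)"
proof -
  have "u \<in> local_ring m (pideal m q)" using assms by simp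
  then obtain p s d where p: "u = Fract p s" "p \<in> poly_carrier m" "s \<in> poly_carrier m" "\<not> q dvd s"
    "homogeneous d p" "homogeneous d s" by (rule local_ringE)
  then have "\<not> q dvd p" using assms local_maxI by blast
  then show ?thesis unfolding p(1) inverse_fract using p by (intro local_ringI)
qed

lemma Fract_power: "Fract a b ^ n = Fract (a ^ n) (b ^ n)"
  by (induction n) (auto simp: One_fract_def)

lemma Fract_eq_0_iff: "b \<noteq> 0 \<Longrightarrow> Fract a b = 0 \<longleftrightarrow> a = 0"
  by (simp add: Zero_fract_def eq_fract)

lemma total_degree_power: "p \<noteq> 0 \<Longrightarrow> total_degree (p ^ n) = n * total_degree p"
proof (induction n)
  case 0 then show ?case using total_degree_Const[of 1] by simp
qed (simp add: total_degree_mult)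

text \<open>Dividing \<open>q\<close> by a power of a variable that is a unit at the point gives a
  function of degree 0, the uniformizer. The same power of the variable restores the degree of the
  cofactor.\<close>

lemma local_max_principal:
  fixes q :: "'k::field mpoly"
  assumes q: "prime_form m q" and j: "j < m" "\<not> q dvd Var j"
  shows "local_max m (pideal m q) =
    (\<lambda>h. Fract q (Var j ^ total_degree q) * h) ` local_ring m (pideal m q)" (is "_ = (\<lambda>h. ?t * h) ` _")
proof
  let ?X = "Var j ^ total_degree q :: 'k mpoly"
  have qh: "q \<in> poly_carrier m" "q \<noteq> 0" "homogeneous (total_degree q) q" using q by (auto simp: prime_form_def form_def)
  have X: "?X \<in> poly_carrier m" "homogeneous (total_degree q) ?X" "\<not> q dvd ?X"
    using j homogeneous_power[OF homogeneous_Var[of j], of "total_degree q"] prime_form_power[OF q] by auto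
  show "local_max m (pideal m q) \<subseteq> (\<lambda>h. ?t * h) ` local_ring m (pideal m q)"
  proof
    fix x assume "x \<in> local_max m (pideal m q)"
    then obtain p s d where p: "x = Fract p s" "p \<in> poly_carrier m" "q dvd p" "s \<in> poly_carrier m" "\<not> q dvd s"
      "homogeneous d p" "homogeneous d s" "s \<noteq> 0" by (rule local_maxE)
    show "x \<in> (\<lambda>h. ?t * h) ` local_ring m (pideal m q)"
    proof (cases "p = 0")
      case True
      have "Fract 0 s \<in> local_ring m (pideal m q)" using p by (intro local_ringI) auto
      moreover have "x = ?t * Fract 0 s" using p True by (simp add: eq_fract)
      ultimately show ?thesis by blast
    next
      case False
      obtain p' where p': "p = q * p'" using p(3) by (rule dvdE)
      have "form m p" using p False by (intro formI)
      then have f: "form m p'" by (simp add: p' form_mult_iff)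
      have "total_degree q + total_degree p' = d"
        using homogeneous_unique[OF p(6) False] formD(2)[OF f] qh by (simp add: p' total_degree_mult)
      then have "homogeneous d (p' * ?X)"
        using homogeneous_mult[OF formD(3)[OF f] X(2)] by (simp add: add.commute)
      then have "Fract (p' * ?X) s \<in> local_ring m (pideal m q)"
        using f X p by (intro local_ringI) (auto simp: form_def)
      moreover have "x = ?t * Fract (p' * ?X) s" using p by (simp add: p' eq_fract mult_ac)
      ultimately show ?thesis by blast
    qed
  qed
  show "(\<lambda>h. ?t * h) ` local_ring m (pideal m q) \<subseteq> local_max m (pideal m q)"
  proof (rule image_subsetI)
    fix x assume "x \<in> local_ring m (pideal m q)"
    then obtain p s d where p: "x = Fract p s" "p \<in> poly_carrier m" "s \<in> poly_carrier m" "\<not> q dvd s"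
      "homogeneous d p" "homogeneous d s" by (rule local_ringE)
    show "?t * x \<in> local_max m (pideal m q)"
      unfolding p(1) mult_fract using p qh X prime_formD(5)[OF q]
      by (intro local_maxI[where d="total_degree q + d"]) (auto simp: homogeneous_mult)
  qed
qed

text \<open>Splitting the powers of \<open>q\<close> off numerator and denominator exhibits a unit
  times a power of the uniformizer. Comparison with any other presentation in both directions gives
  uniqueness.\<close>

lemma ord_at_Fract:
  assumes m: "m \<ge> 2" and q: "prime_form m q" and ab: "form m a" "form m b" "total_degree a = total_degree b"
  shows "ord_at m (pideal m q) (Fract a b) = int (mult_exponent q a) - int (mult_exponent q b)"
proof -
  obtain j where j: "j < m" "\<not> q dvd Var j" using Var_not_all_dvd[OF m q] by blast
  let ?L = "local_ring m (pideal m q)" and ?M = "local_max m (pideal m q)"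
  define e where "e = total_degree q"
  define \<alpha> \<beta> where "\<alpha> = mult_exponent q a" and "\<beta> = mult_exponent q b"
  have nz: "a \<noteq> 0" "b \<noteq> 0" "q \<noteq> 0" using ab prime_formD(2)[OF q] by (auto simp: form_def)
  obtain a' where a': "a = q ^ \<alpha> * a'" "\<not> q dvd a'" unfolding \<alpha>_def using mult_exponent_decomp[OF q nz(1)] by blast
  obtain b' where b': "b = q ^ \<beta> * b'" "\<not> q dvd b'" unfolding \<beta>_def using mult_exponent_decomp[OF q nz(2)] by blast
  have fa: "form m a'" "form m b'" using ab a' b' by (auto simp: form_mult_iff)
  define t where "t = Fract q (Var j ^ e)"
  \<comment> \<open>The powers of \<open>Var j\<close> compensate those in the denominator of
    \<open>t\<close> and make numerator and denominator forms of equal degree.\<close>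
  define u where "u = Fract (a' * Var j ^ (\<alpha> * e)) (b' * Var j ^ (\<beta> * e))"
  have M: "?M = (\<lambda>h. t * h) ` ?L" unfolding t_def e_def by (rule local_max_principal[OF q j])
  have da: "total_degree a = \<alpha> * e + total_degree a'" "total_degree b = \<beta> * e + total_degree b'"
    unfolding a'(1) b'(1) e_def using nz fa by (simp_all add: total_degree_mult total_degree_power form_def)
  have Xn: "homogeneous n (Var j ^ n :: 'a mpoly)" for n using homogeneous_power[OF homogeneous_Var[of j], of n] by simp
  have nd: "\<not> q dvd x * Var j ^ n" if "\<not> q dvd x" for x n
    using that j(2) prime_formD(5)[OF q] prime_form_power[OF q] by blast
  have "homogeneous (total_degree a) (a' * Var j ^ (\<alpha> * e))" "homogeneous (total_degree a) (b' * Var j ^ (\<beta> * e))"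
    using homogeneous_mult[OF formD(3)[OF fa(1)] Xn, of "\<alpha> * e"] homogeneous_mult[OF formD(3)[OF fa(2)] Xn, of "\<beta> * e"] da ab(3)
    by (simp_all add: add.commute)
  then have uL: "u \<in> ?L" unfolding u_def
    using fa j nd[OF b'(2)] by (intro local_ringI) (auto simp: form_def)
  have uM: "u \<notin> ?M" unfolding u_def using Fract_not_local_max[OF q nd[OF a'(2)]] fa by (simp add: form_def)
  have t0: "t \<noteq> 0" unfolding t_def using nz by (simp add: Fract_eq_0_iff)
  have "Fract a b * t ^ \<beta> = u * t ^ \<alpha>"
    unfolding t_def u_def Fract_power mult_fract
    using nz fa by (subst eq_fract) (auto simp: a'(1) b'(1) form_def power_mult power_mult_distrib mult_ac simp flip: power_mult)
  then have "Fract a b = u * t ^ \<alpha> / t ^ \<beta>" using t0 by (simp add: field_simps)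
  then have f: "Fract a b = u * t powi (int \<alpha> - int \<beta>)" using t0 by (simp add: power_int_diff)
  have oneM: "1 \<notin> ?M" unfolding One_fract_def using prime_formD(4)[OF q] by (intro Fract_not_local_max[OF q]) auto
  note mult = local_ring_mult[OF q] and one = local_ring_one[OF q]
  show ?thesis
    unfolding ord_at_def \<alpha>_def[symmetric] \<beta>_def[symmetric]
  proof (rule the_equality)
    show "\<exists>t u. ?M = (\<lambda>h. t * h) ` ?L \<and> u \<in> ?L - ?M \<and> Fract a b = u * t powi (int \<alpha> - int \<beta>)"
      using M uL uM f by blast
    fix n assume "\<exists>t u. ?M = (\<lambda>h. t * h) ` ?L \<and> u \<in> ?L - ?M \<and> Fract a b = u * t powi n"
    then obtain t' u' where M': "?M = (\<lambda>h. t' * h) ` ?L" and u': "u' \<in> ?L - ?M" and f': "Fract a b = u' * t' powi n"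
      by blast
    have "t * 1 \<in> ?M" "t' * 1 \<in> ?M" using imageI[OF one, of "\<lambda>h. t * h"] imageI[OF one, of "\<lambda>h. t' * h"]
      by (simp_all flip: M M')
    then have tM: "t \<in> ?M" "t' \<in> ?M" by simp_all
    then have tL: "t \<in> ?L" "t' \<in> ?L" using local_max_subset by blast+
    have "t' \<noteq> 0" using tM(1) t0 unfolding M' by auto
    have "u \<noteq> 0" "u' \<noteq> 0" using f f' nz by (auto simp: Fract_eq_0_iff)
    moreover have "inverse u \<in> ?L" "inverse u' \<in> ?L" using local_ring_inverse uL uM u' by blast+
    ultimately show "n = int \<alpha> - int \<beta>"
      using uniformizer_exponent_le[of ?L t t' u' u "int \<alpha> - int \<beta>" n]
        uniformizer_exponent_le[of ?L t' t u u' n "int \<alpha> - int \<beta>"]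
        mult one M M' oneM t0 \<open>t' \<noteq> 0\<close> tL u' uL f f' by simp
  qed
qed

section \<open>Divisors of forms\<close>

text \<open>Two prime forms with the same ideal differ by a nonzero scalar. The multiplicity
  therefore depends only on the prime divisor, which permits the arbitrary choice made in
  \<open>gen\<close>.\<close>

lemma mult_exponent_cong:
  assumes q: "prime_form m q" "prime_form m p" "pideal m q = pideal m p" and a: "a \<noteq> 0"
  shows "mult_exponent p a = mult_exponent q a"
proof -
  have qp: "q dvd p" using dvd_if_pideal_eq q by blast
  obtain c where c: "c \<noteq> 0" "p = Const c * q"
    using prime_form_associated[OF q(1,2) qp] by blast
  define n where "n = mult_exponent q a"
  obtain h where h: "a = q ^ n * h" "\<not> q dvd h" unfolding n_def using mult_exponent_decomp[OF q(1) a] by blast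
  define k where "k = Const (inverse c) ^ n"
  have k: "Const c ^ n * k = 1" unfolding k_def using c(1) by (simp flip: power_mult_distrib Const_mult)
  have "p ^ n * (k * h) = (Const c ^ n * k) * (q ^ n * h)"
    unfolding c(2) power_mult_distrib by (simp only: mult_ac)
  also have "\<dots> = a" unfolding k by (simp flip: h(1))
  finally have "a = p ^ n * (k * h)" ..
  moreover have "\<not> q dvd k" using k prime_formD(4)[OF q(1)] by (metis dvd_mult)
  then have "\<not> p dvd k * h" using h(2) qp prime_formD(5)[OF q(1)] dvd_trans by blast
  ultimately show ?thesis unfolding n_def[symmetric] using mult_exponent_eqI[OF q(2)] by blast
qed

definition gen :: "nat \<Rightarrow> 'k::field mpoly set \<Rightarrow> 'k mpoly" where
  "gen m P = (SOME q. prime_form m q \<and> P = pideal m q)"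

lemma gen:
  assumes "m \<ge> 2" "P \<in> prime_divisors m"
  shows "prime_form m (gen m P)" "pideal m (gen m P) = P"
proof -
  have "\<exists>q. prime_form m q \<and> P = pideal m q" using assms(2) prime_divisors_eq[OF assms(1)] by auto
  then have "prime_form m (gen m P) \<and> P = pideal m (gen m P)" unfolding gen_def by (rule someI_ex)
  then show "prime_form m (gen m P)" "pideal m (gen m P) = P" by auto
qed

text \<open>A form is not a rational function, but it has an effective divisor, and functions are
  handled as differences of two of these.\<close>

definition form_divisor :: "nat \<Rightarrow> 'k::field mpoly \<Rightarrow> ('k mpoly set \<Rightarrow>\<^sub>0 int)" where
  "form_divisor m a =
     Abs_poly_mapping (\<lambda>P. if P \<in> prime_divisors m then int (mult_exponent (gen m P) a) else 0)"

text \<open>Each prime factor contributes one divisor. Finiteness is what gives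
  \<open>Abs_poly_mapping\<close> in \<open>form_divisor\<close> its intended coefficients.\<close>

lemma finite_prime_divisors_form:
  assumes "m \<ge> 2" "form m a"
  shows "finite {P \<in> prime_divisors m. a \<in> P}"
  using assms(2)
proof (induction rule: form_induct)
  case (Const c)
  have "\<not> q dvd Const c" if "prime_form m q" for q
    using Const_dvd_1[OF Const] prime_formD(4)[OF that] dvd_trans by blast
  then have "{P \<in> prime_divisors m. Const c \<in> P} = {}"
    by (auto simp: prime_divisors_eq[OF assms(1)] pideal_def)
  then show ?case by (simp only: finite.emptyI)
next
  case (prime q a)
  have "{P \<in> prime_divisors m. q * a \<in> P} \<subseteq> insert (pideal m q) {P \<in> prime_divisors m. a \<in> P}"
  proof
    fix P assume "P \<in> {P \<in> prime_divisors m. q * a \<in> P}"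
    then obtain p where p: "prime_form m p" "P = pideal m p" "p dvd q * a" "P \<in> prime_divisors m"
      by (auto simp: prime_divisors_eq[OF assms(1)] pideal_def)
    then have "p dvd q \<or> p dvd a" using prime_formD(5)[OF p(1)] by blast
    then show "P \<in> insert (pideal m q) {P \<in> prime_divisors m. a \<in> P}"
    proof
      assume "p dvd q"
      then show ?thesis using pideal_eqI[OF p(1) prime(1)] p(2) by simp
    next
      assume "p dvd a"
      then show ?thesis using p(2,4) prime(2) by (simp add: pideal_def form_def)
    qed
  qed
  then show ?case using prime finite_subset by blast
qed

lemma lookup_form_divisor:
  assumes "m \<ge> 2" "form m a"
  shows "Poly_Mapping.lookup (form_divisor m a) P =
     (if P \<in> prime_divisors m then int (mult_exponent (gen m P) a) else 0)"
proof -
  have "{P. (if P \<in> prime_divisors m then int (mult_exponent (gen m P) a) else 0) \<noteq> 0} \<subseteq>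
     {P \<in> prime_divisors m. a \<in> P}"
  proof
    fix P assume "P \<in> {P. (if P \<in> prime_divisors m then int (mult_exponent (gen m P) a) else 0) \<noteq> 0}"
    then have P: "P \<in> prime_divisors m" "mult_exponent (gen m P) a \<noteq> 0" by (auto split: if_splits)
    have "gen m P dvd a"
      using mult_exponent_not_dvd[OF gen(1)[OF assms(1) P(1)], of a] P(2) by auto
    then have "a \<in> pideal m (gen m P)" using assms(2) by (simp add: pideal_def form_def)
    then show "P \<in> {P \<in> prime_divisors m. a \<in> P}" using gen(2)[OF assms(1) P(1)] P(1) by simp
  qed
  then have "finite {P. (if P \<in> prime_divisors m then int (mult_exponent (gen m P) a) else 0) \<noteq> 0}"
    using finite_prime_divisors_form[OF assms] finite_subset by blast
  then show ?thesis unfolding form_divisor_def by (simp add: Abs_poly_mapping_inverse)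
qed

lemma keys_form_divisor:
  assumes "m \<ge> 2" "form m a" shows "Poly_Mapping.keys (form_divisor m a) \<subseteq> prime_divisors m"
  by (auto simp: in_keys_iff lookup_form_divisor[OF assms] split: if_splits)

lemma form_divisor_mult:
  assumes "m \<ge> 2" "form m a" "form m b"
  shows "form_divisor m (a * b) = form_divisor m a + form_divisor m b"
proof (rule poly_mapping_eqI)
  fix P
  have ab: "form m (a * b)" using assms by (simp add: form_mult_iff)
  show "Poly_Mapping.lookup (form_divisor m (a * b)) P = Poly_Mapping.lookup (form_divisor m a + form_divisor m b) P"
    using mult_exponent_mult[OF gen(1)[OF assms(1)], of P a b] formD(2)[OF assms(2)] formD(2)[OF assms(3)]
    by (simp add: lookup_add lookup_form_divisor[OF assms(1)] ab assms)
qed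

lemma form_divisor_Const:
  assumes "m \<ge> 2" "c \<noteq> 0" shows "form_divisor m (Const c) = 0"
proof (rule poly_mapping_eqI)
  fix P
  have "\<not> gen m P dvd Const c" if "P \<in> prime_divisors m"
    using prime_formD(4)[OF gen(1)[OF assms(1) that]] Const_dvd_1[OF assms(2)] dvd_trans by blast
  then show "Poly_Mapping.lookup (form_divisor m (Const c)) P = Poly_Mapping.lookup 0 P"
    using mult_exponent_not_dvd[OF gen(1)[OF assms(1)], of P "Const c"]
    by (simp add: lookup_form_divisor[OF assms(1)] assms)
qed

lemma form_divisor_prime:
  assumes "m \<ge> 2" "prime_form m q" shows "form_divisor m q = frag_of (pideal m q)"
proof (rule poly_mapping_eqI)
  fix P
  have nz: "q \<noteq> 0" using prime_formD(2)[OF assms(2)] .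
  have 1: "mult_exponent (gen m P) q = 1" if P: "P \<in> prime_divisors m" "P = pideal m q"
  proof -
    have "mult_exponent (gen m P) q = mult_exponent q q"
      using mult_exponent_cong[OF assms(2) gen(1)[OF assms(1) P(1)] _ nz] gen(2)[OF assms(1) P(1)] P(2) by simp
    also have "\<dots> = 1" using mult_exponent_associated[OF assms(2), of 1] by simp
    finally show ?thesis .
  qed
  have 2: "mult_exponent (gen m P) q = 0" if P: "P \<in> prime_divisors m" "P \<noteq> pideal m q"
    using mult_exponent_not_dvd[OF gen(1)[OF assms(1) P(1)]] pideal_eqI[OF gen(1)[OF assms(1) P(1)] assms(2)]
      gen(2)[OF assms(1) P(1)] P(2) by metis
  have "pideal m q \<in> prime_divisors m" by (rule pideal_in_prime_divisors[OF assms])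
  then show "Poly_Mapping.lookup (form_divisor m q) P = Poly_Mapping.lookup (frag_of (pideal m q)) P"
    using 1 2 prime_formD(1)[OF assms(2)]
    by (cases "P = pideal m q") (auto simp: lookup_form_divisor[OF assms(1)] lookup_single when_def)
qed

lemma divisor_of_Fract:
  assumes "m \<ge> 2" "form m a" "form m b" "total_degree a = total_degree b"
  shows "divisor_of m (Fract a b) = form_divisor m a - form_divisor m b"
proof -
  have "(\<lambda>P. if P \<in> prime_divisors m then ord_at m P (Fract a b) else 0) =
    Poly_Mapping.lookup (form_divisor m a - form_divisor m b)"
  proof
    fix P
    show "(if P \<in> prime_divisors m then ord_at m P (Fract a b) else 0) =
      Poly_Mapping.lookup (form_divisor m a - form_divisor m b) P"
      using ord_at_Fract[OF assms(1) gen(1)[OF assms(1)] assms(2-4), of P] gen(2)[OF assms(1), of P]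
      by (simp add: lookup_minus lookup_form_divisor[OF assms(1)] assms)
  qed
  then show ?thesis unfolding divisor_of_def by simp
qed

section \<open>The degree of a divisor\<close>

text \<open>The free abelian group on \<open>()\<close> stands for the integers, so that
  \<open>frag_extend\<close> gives additivity; the coefficient at \<open>()\<close> is the
  degree.\<close>

definition div_degree :: "nat \<Rightarrow> ('k::field mpoly set \<Rightarrow>\<^sub>0 int) \<Rightarrow> int" where
  "div_degree m D = Poly_Mapping.lookup
     (frag_extend (\<lambda>P. frag_cmul (int (total_degree (gen m P))) (frag_of ())) D) ()"

lemma div_degree_0 [simp]: "div_degree m 0 = 0"
  by (simp add: div_degree_def)

lemma div_degree_add: "div_degree m (D + E) = div_degree m D + div_degree m E"
  by (simp add: div_degree_def frag_extend_add lookup_add)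

lemma div_degree_diff: "div_degree m (D - E) = div_degree m D - div_degree m E"
  by (simp add: div_degree_def frag_extend_diff lookup_minus)

lemma div_degree_prime:
  assumes "m \<ge> 2" "prime_form m q"
  shows "div_degree m (frag_of (pideal m q)) = int (total_degree q)"
proof -
  have P: "pideal m q \<in> prime_divisors m" by (rule pideal_in_prime_divisors[OF assms])
  have "q dvd gen m (pideal m q)"
    using dvd_if_pideal_eq gen[OF assms(1) P] by blast
  then obtain c where c: "c \<noteq> 0" "gen m (pideal m q) = Const c * q"
    using prime_form_associated[OF assms(2) gen(1)[OF assms(1) P]] by blast
  have "total_degree (gen m (pideal m q)) = total_degree q"
    unfolding c(2) using c(1) prime_formD(2)[OF assms(2)] by (simp add: total_degree_mult)
  then show ?thesis by (simp add: div_degree_def)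
qed

lemma div_degree_form_divisor:
  assumes "m \<ge> 2" "form m a" shows "div_degree m (form_divisor m a) = int (total_degree a)"
  using assms(2)
proof (induction rule: form_induct)
  case (Const c) then show ?case by (simp add: form_divisor_Const[OF assms(1)])
next
  case (prime q a)
  then show ?case using assms(1) prime_formD(1,2)[OF prime(1)] formD(2)[OF prime(2)]
    by (simp add: form_divisor_mult div_degree_add form_divisor_prime div_degree_prime total_degree_mult)
qed

text \<open>Prime divisors are divisors of prime forms, and differences of divisors correspond to
  cross products of forms. Questions about divisors thus become questions about pairs of
  forms.\<close>

lemma divisor_eq_form_divisor_diff:
  assumes "m \<ge> 2" "Poly_Mapping.keys D \<subseteq> prime_divisors m"
  shows "\<exists>a b. form m a \<and> form m b \<and> D = form_divisor m a - form_divisor m b"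
  using assms(2)
proof (induction rule: frag_induction)
  case zero
  show ?case by (intro exI[of _ 1] conjI) auto
next
  case (one P)
  note g = gen[OF assms(1) one]
  have "form_divisor m (Const 1) = 0" by (rule form_divisor_Const[OF assms(1)]) simp
  then have "frag_of P = form_divisor m (gen m P) - form_divisor m (Const 1)"
    using form_divisor_prime[OF assms(1) g(1)] g(2) by simp
  moreover have "form m (Const 1)" by (rule form_Const) simp
  ultimately show ?case using prime_formD(1)[OF g(1)] by blast
next
  case (diff D E)
  obtain a b where ab: "form m a" "form m b" "D = form_divisor m a - form_divisor m b" using diff(1) by blast
  obtain c d where cd: "form m c" "form m d" "E = form_divisor m c - form_divisor m d" using diff(2) by blast
  have "D - E = form_divisor m (a * d) - form_divisor m (b * c)" "form m (a * d)" "form m (b * c)"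
    using ab cd by (simp_all add: form_divisor_mult[OF assms(1)] form_mult_iff)
  then show ?case by blast
qed

text \<open>Equal multiplicities let the prime factors of \<open>a\<close> be cancelled from
  \<open>b\<close> one at a time; once they are exhausted, the degree forces the rest of
  \<open>b\<close> to be constant. This gives the kernel of the divisor map.\<close>

lemma form_divisor_eqD:
  assumes "m \<ge> 2" "form m a" "form m b" "form_divisor m a = form_divisor m b"
  shows "\<exists>c. c \<noteq> 0 \<and> a = Const c * b"
  using assms(2-4)
proof (induction arbitrary: b rule: form_induct)
  case (Const c)
  have "total_degree b = 0"
    using div_degree_form_divisor[OF assms(1) Const(2)] Const(3) form_divisor_Const[OF assms(1) Const(1)] by simp
  then obtain d where d: "b = Const d" by (rule total_degree_eq_0D)
  then have "d \<noteq> 0" using Const(2) by (auto simp: form_def)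
  then show ?case using Const(1) d by (intro exI[of _ "c / d"]) (simp flip: Const_mult)
next
  case (prime q a)
  let ?P = "pideal m q"
  have P: "?P \<in> prime_divisors m" by (rule pideal_in_prime_divisors[OF assms(1) prime(1)])
  have qa: "form m (q * a)" using prime by (simp add: form_mult_iff prime_formD)
  note g = gen[OF assms(1) P]
  have cong: "mult_exponent (gen m ?P) x = mult_exponent q x" if "x \<noteq> 0" for x
    using mult_exponent_cong[OF prime(1) g(1) _ that] g(2) by simp
  have "mult_exponent q (q * a) = mult_exponent q b"
  proof -
    have "Poly_Mapping.lookup (form_divisor m (q * a)) ?P = Poly_Mapping.lookup (form_divisor m b) ?P"
      using prime(5) by simp
    then show ?thesis
      unfolding lookup_form_divisor[OF assms(1) qa] lookup_form_divisor[OF assms(1) prime(4)]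
      using P cong[OF formD(2)[OF qa]] cong[OF formD(2)[OF prime(4)]] by simp
  qed
  moreover have "mult_exponent q (q * a) = Suc (mult_exponent q a)"
    using mult_exponent_mult[OF prime(1) prime_formD(2)[OF prime(1)] formD(2)[OF prime(2)]]
      mult_exponent_associated[OF prime(1), of 1] by simp
  ultimately have "q dvd b" using mult_exponent_not_dvd[OF prime(1), of b] by auto
  then obtain b' where b': "b = q * b'" by (rule dvdE)
  have fb: "form m b'" using prime(4) by (simp add: b' form_mult_iff)
  have "form_divisor m a = form_divisor m b'"
    using prime(5) form_divisor_mult[OF assms(1) prime_formD(1)[OF prime(1)] prime(2)]
      form_divisor_mult[OF assms(1) prime_formD(1)[OF prime(1)] fb] b' by simp
  then obtain c where "c \<noteq> 0" "a = Const c * b'" using prime(3)[OF fb] by blast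
  then show ?case unfolding b' by (intro exI[of _ c]) (simp add: mult_ac)
qed

lemma function_fieldE:
  assumes "f \<in> function_field m - {0}"
  obtains a b where "form m a" "form m b" "total_degree a = total_degree b" "f = Fract a b"
proof -
  obtain a b d where *: "f = Fract a b" "a \<in> poly_carrier m" "b \<in> poly_carrier m"
     "homogeneous d a" "homogeneous d b" "b \<noteq> 0" using assms unfolding function_field_def by blast
  then have "a \<noteq> 0" using assms by (auto simp: Fract_eq_0_iff)
  then show ?thesis using that[of a b] * formI homogeneous_unique by blast
qed

lemma function_fieldI:
  "form m a \<Longrightarrow> form m b \<Longrightarrow> total_degree a = total_degree b \<Longrightarrow> Fract a b \<in> function_field m - {0}"
  unfolding function_field_def form_def by (auto simp: Fract_eq_0_iff)

text \<open>A divisor is a difference of divisors of two forms, and degree 0 means that these forms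
  have equal degree, so their quotient is a rational function. Hence the class of a divisor is its
  degree.\<close>

lemma principal_divisors_eq:
  assumes "m \<ge> 2"
  shows "principal_divisors m = {D. Poly_Mapping.keys D \<subseteq> prime_divisors m \<and> div_degree m D = 0}"
proof (intro Set.set_eqI iffI)
  fix D :: "'a mpoly set \<Rightarrow>\<^sub>0 int"
  assume "D \<in> principal_divisors m"
  then obtain f where f: "f \<in> function_field m - {0}" "D = divisor_of m f" unfolding principal_divisors_def by blast
  obtain a b where ab: "form m a" "form m b" "total_degree a = total_degree b" "f = Fract a b"
    using f(1) by (rule function_fieldE)
  have D: "D = form_divisor m a - form_divisor m b" using f(2) ab divisor_of_Fract[OF assms] by simp
  have "Poly_Mapping.keys D \<subseteq> prime_divisors m"
    unfolding D using keys_diff[of "form_divisor m a" "form_divisor m b"]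
      keys_form_divisor[OF assms ab(1)] keys_form_divisor[OF assms ab(2)] by blast
  then show "D \<in> {D. Poly_Mapping.keys D \<subseteq> prime_divisors m \<and> div_degree m D = 0}"
    unfolding D using ab by (simp add: div_degree_diff div_degree_form_divisor[OF assms])
next
  fix D :: "'a mpoly set \<Rightarrow>\<^sub>0 int"
  assume "D \<in> {D. Poly_Mapping.keys D \<subseteq> prime_divisors m \<and> div_degree m D = 0}"
  then have D: "Poly_Mapping.keys D \<subseteq> prime_divisors m" "div_degree m D = 0" by auto
  obtain a b where ab: "form m a" "form m b" "D = form_divisor m a - form_divisor m b"
    using divisor_eq_form_divisor_diff[OF assms D(1)] by blast
  then have deg: "total_degree a = total_degree b"
    using D(2) by (simp add: div_degree_diff div_degree_form_divisor[OF assms])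
  then have "D = divisor_of m (Fract a b)" using divisor_of_Fract[OF assms ab(1,2) deg] ab(3) by simp
  then show "D \<in> principal_divisors m" unfolding principal_divisors_def using function_fieldI[OF ab(1,2) deg] by (rule image_eqI)
qed

section \<open>Automorphisms of projective space\<close>

interpretation subst: mpoly_eval Const s for s :: "nat \<Rightarrow> 'k::field mpoly"
  by unfold_locales (auto simp: Const_add Const_mult)

lemma poly_subst_eval: "poly_subst s p = subst.eval s p"
  by (simp add: poly_subst_def subst.eval_def)

lemma homogeneous_add: "homogeneous d p \<Longrightarrow> homogeneous d q \<Longrightarrow> homogeneous d (p + q)"
  for p q :: "'k::field mpoly"
  by (simp add: homogeneous_iff grade.eval_add add_monom)

lemma homogeneous_sum: "(\<And>i. i \<in> I \<Longrightarrow> homogeneous d (f i)) \<Longrightarrow> homogeneous d (sum f I)"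
  for f :: "'a \<Rightarrow> 'k::field mpoly"
  by (induction I rule: infinite_finite_induct) (auto intro: homogeneous_add)

lemma homogeneous_prod: "(\<And>i. i \<in> I \<Longrightarrow> homogeneous (d i) (f i)) \<Longrightarrow> homogeneous (sum d I) (prod f I)"
  for f :: "'a \<Rightarrow> 'k::field mpoly"
  by (induction I rule: infinite_finite_induct) (auto intro: homogeneous_mult)

lemma homogeneous_poly_subst:
  fixes p :: "'k::field mpoly"
  assumes "\<And>i. homogeneous 1 (s i)" "homogeneous d p"
  shows "homogeneous d (poly_subst s p)"
  unfolding poly_subst_def
proof (rule homogeneous_sum)
  fix t assume "t \<in> Poly_Mapping.keys p"
  then have d: "d = 0 + (\<Sum>i\<in>Poly_Mapping.keys t. Poly_Mapping.lookup t i)" using assms(2) by (simp add: homogeneous_def)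
  show "homogeneous d (Const (Poly_Mapping.lookup p t) * (\<Prod>i\<in>Poly_Mapping.keys t. s i ^ Poly_Mapping.lookup t i))"
    unfolding d using homogeneous_power[OF assms(1)]
    by (intro homogeneous_mult homogeneous_prod) (auto simp del: One_nat_def)
qed

text \<open>\<open>S\<close> and \<open>T\<close> are mutually inverse only on polynomials in the
  first \<open>m\<close> variables: the substitution sends all later variables to multiples of
  \<open>Var 0\<close>.\<close>

locale form_automorphism =
  fixes m :: nat and S T :: "'k::field mpoly \<Rightarrow> 'k mpoly"
  assumes S_add: "S (p + q) = S p + S q" and S_mult: "S (p * q) = S p * S q" and S_Const: "S (Const c) = Const c"
    and T_mult: "T (p * q) = T p * T q" and T_Const: "T (Const c) = Const c"
    and S_closed: "p \<in> poly_carrier m \<Longrightarrow> S p \<in> poly_carrier m"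
    and T_closed: "p \<in> poly_carrier m \<Longrightarrow> T p \<in> poly_carrier m"
    and TS: "p \<in> poly_carrier m \<Longrightarrow> T (S p) = p" and ST: "p \<in> poly_carrier m \<Longrightarrow> S (T p) = p"
    and S_homogeneous: "homogeneous d p \<Longrightarrow> homogeneous d (S p)"
begin

lemma S_1: "S 1 = 1" and T_1: "T 1 = 1"
  using S_Const[of 1] T_Const[of 1] by auto

lemma S_eq_0_iff: "p \<in> poly_carrier m \<Longrightarrow> S p = 0 \<longleftrightarrow> p = 0"
  using TS[of p] S_Const[of 0] T_Const[of 0] by auto

lemma S_dvd: "p dvd q \<Longrightarrow> S p dvd S q"
  by (auto elim!: dvdE simp: S_mult)

lemma T_dvd: "p dvd q \<Longrightarrow> T p dvd T q"
  by (auto elim!: dvdE simp: T_mult)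

lemma S_form: assumes "form m p" shows "form m (S p)" "total_degree (S p) = total_degree p"
proof -
  have *: "S p \<in> poly_carrier m" "S p \<noteq> 0" "homogeneous (total_degree p) (S p)"
    using assms S_closed S_eq_0_iff S_homogeneous by (auto simp: form_def)
  then show "form m (S p)" "total_degree (S p) = total_degree p"
    using formI homogeneous_unique by auto
qed

text \<open>Irreducibility is carried over by pulling factorizations back along \<open>T\<close>,
  and primality then follows from factoriality.\<close>

lemma S_prime_form: assumes "prime_form m q" shows "prime_form m (S q)"
proof -
  have q: "q \<in> poly_carrier m" "q \<noteq> 0" "irreducible q" "form m q"
    using assms prime_elem_imp_irreducible_idom by (auto simp: prime_form_def form_def)
  have "irreducible (S q)"
  proof (rule irreducibleI)
    show "S q \<noteq> 0" using q S_eq_0_iff by simp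
    show "\<not> S q dvd 1"
    proof
      assume "S q dvd 1"
      then have "T (S q) dvd T 1" by (rule T_dvd)
      then show False using q TS T_1 by (simp add: irreducible_def)
    qed
    fix x y assume xy: "S q = x * y"
    then have c: "x \<in> poly_carrier m" "y \<in> poly_carrier m"
      using poly_carrier_factor[of x y m] poly_carrier_factor[of y x m] S_closed[OF q(1)] \<open>S q \<noteq> 0\<close>
      by (auto simp: mult.commute)
    have "q = T x * T y" using TS[OF q(1)] xy by (simp add: T_mult)
    then have "T x dvd 1 \<or> T y dvd 1" using q(3) unfolding irreducible_def by blast
    then show "x dvd 1 \<or> y dvd 1" using S_dvd[of "T x" 1] S_dvd[of "T y" 1] c ST S_1 by auto
  qed
  then show ?thesis using irreducible_mpoly_imp_prime_elem S_form(1)[OF q(4)] by (simp add: prime_form_def)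
qed

lemma S_pideal: assumes "q \<in> poly_carrier m" shows "S ` pideal m q = pideal m (S q)"
proof
  show "S ` pideal m q \<subseteq> pideal m (S q)" using S_closed S_dvd by (auto simp: pideal_def)
  show "pideal m (S q) \<subseteq> S ` pideal m q"
  proof
    fix p assume p: "p \<in> pideal m (S q)"
    then have "T (S q) dvd T p" by (intro T_dvd) (simp add: pideal_def)
    then have "T p \<in> pideal m q" using p T_closed TS[OF assms] by (simp add: pideal_def)
    moreover have "p = S (T p)" using p ST by (simp add: pideal_def)
    ultimately show "p \<in> S ` pideal m q" by blast
  qed
qed

lemma S_form_divisor:
  assumes "m \<ge> 2" "form m a"
  shows "form_divisor m (S a) = frag_extend (\<lambda>P. frag_of (S ` P)) (form_divisor m a)"
  using assms(2)
proof (induction rule: form_induct)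
  case (Const c) then show ?case by (simp add: S_Const form_divisor_Const[OF assms(1)])
next
  case (prime q a)
  then show ?case
    using S_form[OF prime(2)] S_form[OF prime_formD(1)[OF prime(1)]] S_prime_form[OF prime(1)]
    by (simp add: S_mult form_divisor_mult[OF assms(1)] prime_formD(1) form_divisor_prime[OF assms(1)]
        frag_extend_add S_pideal prime_formD(3))
qed

end

lemma form_automorphism_funpow:
  assumes "form_automorphism m S T" shows "form_automorphism m (S ^^ k) (T ^^ k)"
proof (induction k)
  case 0 then show ?case by unfold_locales auto
next
  case (Suc k)
  interpret a: form_automorphism m S T by fact
  interpret k: form_automorphism m "S ^^ k" "T ^^ k" by fact
  show ?case
  proof
    show "(T ^^ Suc k) ((S ^^ Suc k) p) = p" "(S ^^ Suc k) ((T ^^ Suc k) p) = p" if "p \<in> poly_carrier m" for p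
      using that by (simp_all add: funpow_swap1 a.TS a.ST k.TS k.ST a.S_closed a.T_closed k.S_closed k.T_closed)
  qed (simp_all add: a.S_add k.S_add a.S_mult k.S_mult a.S_Const k.S_Const a.T_mult k.T_mult a.T_Const k.T_Const
      a.S_closed k.S_closed a.T_closed k.T_closed a.S_homogeneous k.S_homogeneous)
qed

section \<open>The substitution and its powers\<close>

definition sigma_inv :: "nat \<Rightarrow> 'k::field \<Rightarrow> 'k mpoly \<Rightarrow> 'k mpoly" where
  "sigma_inv m b = poly_subst (\<lambda>i. if i = 0 then Const (inverse b) * Var (m - 1) else Var (i - 1))"

lemma sigma_Var: "sigma_poly m b (Var i) = (if i < m - 1 then Var (i + 1) else Const b * Var 0)"
  by (simp add: sigma_poly_def poly_subst_eval)

lemma sigma_inv_Var: "sigma_inv m b (Var i) = (if i = 0 then Const (inverse b) * Var (m - 1) else Var (i - 1))"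
  by (simp add: sigma_inv_def poly_subst_eval)

lemma sigma_simps:
  "sigma_poly m b (p + q) = sigma_poly m b p + sigma_poly m b q"
  "sigma_poly m b (p * q) = sigma_poly m b p * sigma_poly m b q" "sigma_poly m b (Const c) = Const c"
  by (simp_all add: sigma_poly_def poly_subst_eval subst.eval_add subst.eval_mult)

lemma sigma_inv_simps:
  "sigma_inv m b (p + q) = sigma_inv m b p + sigma_inv m b q"
  "sigma_inv m b (p * q) = sigma_inv m b p * sigma_inv m b q" "sigma_inv m b (Const c) = Const c"
  by (simp_all add: sigma_inv_def poly_subst_eval subst.eval_add subst.eval_mult)

lemma form_automorphism_sigma:
  assumes "m \<ge> 2" "(b::'k::field) \<noteq> 0"
  shows "form_automorphism m (sigma_poly m b) (sigma_inv m b)"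
proof
  fix p q :: "'k mpoly" and c d
  show "sigma_poly m b p \<in> poly_carrier m" if "p \<in> poly_carrier m"
    using that assms by (induction rule: poly_carrier_induct) (auto simp: sigma_simps sigma_Var)
  show "sigma_inv m b p \<in> poly_carrier m" if "p \<in> poly_carrier m"
    using that assms by (induction rule: poly_carrier_induct) (auto simp: sigma_inv_simps sigma_inv_Var)
  show "sigma_inv m b (sigma_poly m b p) = p" if "p \<in> poly_carrier m"
    using that
  proof (induction rule: poly_carrier_induct)
    case (Var i)
    then have "i = m - 1" if "\<not> i < m - 1" using that by simp
    then show ?case using assms by (auto simp: sigma_simps sigma_inv_simps sigma_Var sigma_inv_Var simp flip: Const_mult mult.assoc)
  qed (simp_all add: sigma_simps sigma_inv_simps)
  show "sigma_poly m b (sigma_inv m b p) = p" if "p \<in> poly_carrier m"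
    using that
  proof (induction rule: poly_carrier_induct)
    case (Var i)
    then show ?case using assms by (auto simp: sigma_simps sigma_inv_simps sigma_Var sigma_inv_Var simp flip: Const_mult mult.assoc)
  qed (simp_all add: sigma_simps sigma_inv_simps)
  have h: "homogeneous 1 (Const c * Var i :: 'k mpoly)" for c i
    using homogeneous_mult[OF homogeneous_Const homogeneous_Var, of c i] by simp
  show "homogeneous d (sigma_poly m b p)" if "homogeneous d p"
    unfolding sigma_poly_def using that h homogeneous_Var[where 'k='k]
    by (intro homogeneous_poly_subst) (auto simp del: One_nat_def)
qed (simp_all add: sigma_simps sigma_inv_simps)

locale proj_sigma =
  fixes m :: nat and b :: "'k::field"
  assumes m2: "m \<ge> 2" and b0: "b \<noteq> 0"
begin

abbreviation "S k \<equiv> sigma_poly m b ^^ k"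

sublocale S: form_automorphism m "S k" "sigma_inv m b ^^ k" for k
  by (rule form_automorphism_funpow[OF form_automorphism_sigma[OF m2 b0]])

lemma S_Var: "i < m \<Longrightarrow> k \<le> m \<Longrightarrow> S k (Var i) = (if i + k < m then Var (i + k) else Const b * Var (i + k - m))"
proof (induction k)
  case (Suc k)
  consider "i + k < m - 1" | "i + k = m - 1" | "i + k \<ge> m" by linarith
  then show ?case using Suc m2 by cases (auto simp: sigma_simps sigma_Var Suc_diff_le)
qed simp

text \<open>A full turn sends every variable to \<open>b\<close> times itself, which is the grading
  homomorphism evaluated at \<open>b\<close>.\<close>

lemma S_m: "p \<in> poly_carrier m \<Longrightarrow> S m p = poly (grade p) (Const b)"
  by (induction rule: poly_carrier_induct) (auto simp: S.S_Const S_Var S.S_add S.S_mult grade.eval_add grade.eval_mult)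

lemma S_m_form: "form m p \<Longrightarrow> S m p = Const (b ^ total_degree p) * p"
proof -
  assume p: "form m p"
  have "Const b ^ n = Const (b ^ n)" for n by (induction n) (simp_all add: Const_mult)
  then show ?thesis using p by (simp add: S_m form_def homogeneous_iff poly_monom mult.commute)
qed

end

section \<open>The equivariant sequence of projective space\<close>

locale proj_cyclic = cyclic_group G \<sigma> m for G :: "('g, 'x) monoid_scheme" (structure) and \<sigma> m +
  fixes b :: "'k::field"
  assumes b0: "b \<noteq> 0"
begin

sublocale proj: proj_sigma m b
  using m_gt_1 b0 by unfold_locales auto

abbreviation "A \<equiv> const_units :: ('k, 'g) gmodule"
abbreviation "B \<equiv> rational_units G \<sigma> m b"
abbreviation "C \<equiv> Div G \<sigma> m b"
abbreviation "D \<equiv> Pic G \<sigma> m b"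
abbreviation "const_fn \<equiv> \<lambda>c::'k. Fract (Const c) 1"
abbreviation "ap \<equiv> act_poly G \<sigma> m b"

lemma act_poly_eq: "ap g = proj.S (idx g)"
  by (simp add: act_poly_def idx_def)

text \<open>When the exponents wrap around, the extra \<open>m\<close>-th power of the substitution
  multiplies the form by \<open>b\<close> to its degree. On polynomials \<open>G\<close> thus acts
  only up to the scalars recorded by the carry.\<close>

lemma act_poly_act_poly:
  assumes "g \<in> carrier G" "h \<in> carrier G" "form m p"
  shows "ap g (ap h p) = Const (b ^ (total_degree p * nat (carry g h))) * ap (g \<otimes> h) p"
proof -
  have "ap g (ap h p) = proj.S (idx g + idx h) p" by (simp add: act_poly_eq funpow_add)
  also have "\<dots> = Const (b ^ (total_degree p * nat (carry g h))) * ap (g \<otimes> h) p"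
  proof (rule carry_cases[OF assms(1,2)])
    assume "idx g + idx h < m" "carry g h = 0" "idx (g \<otimes> h) = idx g + idx h"
    then show ?thesis by (simp add: act_poly_eq)
  next
    assume *: "m \<le> idx g + idx h" "carry g h = 1" "idx (g \<otimes> h) = idx g + idx h - m"
    then have "idx g + idx h = idx (g \<otimes> h) + m" by simp
    then have "proj.S (idx g + idx h) p = proj.S (idx (g \<otimes> h)) (proj.S m p)"
      by (simp only: funpow_add o_apply)
    then show ?thesis using *(2) assms(3) by (simp add: proj.S_m_form proj.S.S_mult proj.S.S_Const act_poly_eq)
  qed
  finally show ?thesis .
qed

text \<open>Evaluates the definite description in \<open>act_fract\<close>: the substitution is
  multiplicative and injective on the polynomials in \<open>m\<close> variables, so equality of
  fractions is preserved.\<close>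

lemma act_fract_Fract:
  assumes "p \<in> poly_carrier m" "q \<in> poly_carrier m" "q \<noteq> 0"
  shows "act_fract G \<sigma> m b g (Fract p q) = Fract (ap g p) (ap g q)"
  unfolding act_fract_def
proof (rule the_equality)
  show "\<exists>p'\<in>poly_carrier m. \<exists>q'\<in>poly_carrier m. q' \<noteq> 0 \<and> Fract p q = Fract p' q' \<and>
     Fract (ap g p) (ap g q) = Fract (ap g p') (ap g q')" using assms by blast
  fix h assume "\<exists>p'\<in>poly_carrier m. \<exists>q'\<in>poly_carrier m. q' \<noteq> 0 \<and> Fract p q = Fract p' q' \<and>
     h = Fract (ap g p') (ap g q')"
  then obtain p' q' where *: "p' \<in> poly_carrier m" "q' \<in> poly_carrier m" "q' \<noteq> 0" "Fract p q = Fract p' q'"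
     "h = Fract (ap g p') (ap g q')" by blast
  have "p * q' = p' * q" using * assms by (simp add: eq_fract)
  then have "ap g p * ap g q' = ap g p' * ap g q" unfolding act_poly_eq by (simp flip: proj.S.S_mult)
  moreover have "ap g q \<noteq> 0" "ap g q' \<noteq> 0" using assms * proj.S.S_eq_0_iff by (simp_all add: act_poly_eq)
  ultimately show "h = Fract (ap g p) (ap g q)" using *(5) by (simp add: eq_fract)
qed

lemma act_form: "form m p \<Longrightarrow> form m (ap g p)" "form m p \<Longrightarrow> total_degree (ap g p) = total_degree p"
  by (simp_all add: act_poly_eq proj.S.S_form)

lemma A_simps: "carrier A = - {0}" "x \<otimes>\<^bsub>A\<^esub> y = x * y" "\<one>\<^bsub>A\<^esub> = 1" "act A g x = x"
  by (simp_all add: const_units_def)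

lemma B_simps: "carrier B = function_field m - {0}" "x \<otimes>\<^bsub>B\<^esub> y = x * y" "\<one>\<^bsub>B\<^esub> = 1" "act B g x = act_fract G \<sigma> m b g x"
  by (simp_all add: rational_units_def)

lemma C_simps: "carrier C = {E. Poly_Mapping.keys E \<subseteq> prime_divisors m}" "x \<otimes>\<^bsub>C\<^esub> y = x + y" "\<one>\<^bsub>C\<^esub> = 0"
  "act C g x = act_divisor G \<sigma> m b g x"
  by (simp_all add: Div_def monoid.defs free_Abelian_group_def)

sublocale A: trivial_cyclic_module G \<sigma> m A
proof -
  interpret A: comm_group A
  proof (rule comm_groupI; unfold A_simps)
    fix x :: 'k assume "x \<in> - {0}"
    then show "\<exists>y\<in>- {0}. y * x = 1" by (intro bexI[of _ "inverse x"]) auto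
  qed auto
  show "trivial_cyclic_module G \<sigma> m A"
    by unfold_locales (auto simp: A_simps)
qed

sublocale B: cyclic_module G \<sigma> m B
proof -
  interpret B: comm_group B
  proof (rule comm_groupI; unfold B_simps)
    fix x y assume "x \<in> function_field m - {0 :: 'k mpoly fract}" "y \<in> function_field m - {0 :: 'k mpoly fract}"
    then obtain p q r s where pq: "form m p" "form m q" "total_degree p = total_degree q" "x = Fract p q"
      and rs: "form m r" "form m s" "total_degree r = total_degree s" "y = Fract r s" by (meson function_fieldE)
    show "x * y \<in> function_field m - {0}"
      unfolding pq(4) rs(4) mult_fract using pq rs
      by (intro function_fieldI) (simp_all add: form_mult_iff total_degree_mult formD)
  next
    show "1 \<in> function_field m - {0 :: 'k mpoly fract}"
      unfolding One_fract_def by (intro function_fieldI) auto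
  next
    fix x assume "x \<in> function_field m - {0 :: 'k mpoly fract}"
    then obtain p q where pq: "form m p" "form m q" "total_degree p = total_degree q" "x = Fract p q" by (rule function_fieldE)
    then have "Fract q p * x = 1" by (simp add: One_fract_def eq_fract formD)
    then show "\<exists>y\<in>function_field m - {0}. y * x = 1" using pq by (intro bexI[of _ "Fract q p"] function_fieldI) auto
  qed auto
  show "cyclic_module G \<sigma> m B"
  proof
    fix g x assume g: "g \<in> carrier G" and x: "x \<in> carrier B"
    obtain p q where pq: "form m p" "form m q" "total_degree p = total_degree q" "x = Fract p q"
      using x unfolding B_simps by (rule function_fieldE)
    then have ax: "act B g x = Fract (ap g p) (ap g q)" for g by (simp add: B_simps act_fract_Fract formD)
    show "act B g x \<in> carrier B" unfolding ax unfolding B_simps using pq by (intro function_fieldI) (auto simp: act_form)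
    fix y assume y: "y \<in> carrier B"
    obtain r s where rs: "form m r" "form m s" "total_degree r = total_degree s" "y = Fract r s"
      using y unfolding B_simps by (rule function_fieldE)
    show "act B g (x \<otimes>\<^bsub>B\<^esub> y) = act B g x \<otimes>\<^bsub>B\<^esub> act B g y"
      unfolding ax using pq rs by (simp add: B_simps act_fract_Fract formD act_poly_eq proj.S.S_mult)
  next
    fix g h x assume g: "g \<in> carrier G" and h: "h \<in> carrier G" and x: "x \<in> carrier B"
    obtain p q where pq: "form m p" "form m q" "total_degree p = total_degree q" "x = Fract p q"
      using x unfolding B_simps by (rule function_fieldE)
    have "act B g (act B h x) = Fract (ap g (ap h p)) (ap g (ap h q))"
      using pq act_form(1)[OF pq(1)] act_form(1)[OF pq(2)] by (simp add: B_simps act_fract_Fract form_def)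
    \<comment> \<open>Numerator and denominator have the same degree, so they acquire the same power
      of \<open>b\<close>, and it cancels.\<close>
    also have "\<dots> = Fract (ap (g \<otimes> h) p) (ap (g \<otimes> h) q)"
      unfolding act_poly_act_poly[OF g h pq(1)] act_poly_act_poly[OF g h pq(2)] pq(3)
      using b0 by (intro mult_fract_cancel) simp
    also have "\<dots> = act B (g \<otimes> h) x" using pq by (simp add: B_simps act_fract_Fract formD)
    finally show "act B (g \<otimes> h) x = act B g (act B h x)" by simp
  qed
qed

section \<open>Divisors and the Picard group as modules\<close>

lemma form_divisor_closed: "form m p \<Longrightarrow> form_divisor m p \<in> carrier C"
  using keys_form_divisor[OF proj.m2] by (simp add: C_simps)

lemma carrier_CE:
  assumes "E \<in> carrier C"
  obtains p q where "form m p" "form m q" "E = form_divisor m p - form_divisor m q"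
  using divisor_eq_form_divisor_diff[OF proj.m2] assms unfolding C_simps by blast

lemma act_divisor_form:
  "form m p \<Longrightarrow> form m q \<Longrightarrow> act_divisor G \<sigma> m b g (form_divisor m p - form_divisor m q) =
     form_divisor m (ap g p) - form_divisor m (ap g q)"
  by (simp add: act_divisor_def frag_extend_diff act_poly_eq proj.S.S_form_divisor[OF proj.m2])

lemma form_divisor_Const_mult: "c \<noteq> 0 \<Longrightarrow> form m p \<Longrightarrow> form_divisor m (Const c * p) = form_divisor m p"
  using form_divisor_mult[OF proj.m2 form_Const[of c m]] form_divisor_Const[OF proj.m2, of c] by simp

sublocale C: cyclic_module G \<sigma> m C
proof -
  interpret C: comm_group C
  proof (rule comm_groupI; unfold C_simps)
    fix x y :: "'k mpoly set \<Rightarrow>\<^sub>0 int"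
    assume "x \<in> {E. Poly_Mapping.keys E \<subseteq> prime_divisors m}" "y \<in> {E. Poly_Mapping.keys E \<subseteq> prime_divisors m}"
    then show "x + y \<in> {E. Poly_Mapping.keys E \<subseteq> prime_divisors m}" using Poly_Mapping.keys_add[of x y] by auto
  next
    fix x :: "'k mpoly set \<Rightarrow>\<^sub>0 int"
    assume "x \<in> {E. Poly_Mapping.keys E \<subseteq> prime_divisors m}"
    then show "\<exists>y\<in>{E. Poly_Mapping.keys E \<subseteq> prime_divisors m}. y + x = 0"
      by (intro bexI[of _ "- x"]) auto
  qed (auto simp: add_ac)
  show "cyclic_module G \<sigma> m C"
  proof
    fix g x assume g: "g \<in> carrier G" and x: "x \<in> carrier C"
    obtain p q where pq: "form m p" "form m q" "x = form_divisor m p - form_divisor m q" using x by (rule carrier_CE)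
    have "Poly_Mapping.keys (form_divisor m (ap g p) - form_divisor m (ap g q)) \<subseteq> prime_divisors m"
      using keys_diff[of "form_divisor m (ap g p)" "form_divisor m (ap g q)"]
        keys_form_divisor[OF proj.m2 act_form(1)[OF pq(1)]] keys_form_divisor[OF proj.m2 act_form(1)[OF pq(2)]] by blast
    then show "act C g x \<in> carrier C" using pq by (simp add: C_simps act_divisor_form)
    show "act C g (x \<otimes>\<^bsub>C\<^esub> y) = act C g x \<otimes>\<^bsub>C\<^esub> act C g y" for y
      by (simp add: C_simps act_divisor_def frag_extend_add)
  next
    fix g h x assume g: "g \<in> carrier G" and h: "h \<in> carrier G" and x: "x \<in> carrier C"
    obtain p q where pq: "form m p" "form m q" "x = form_divisor m p - form_divisor m q" using x by (rule carrier_CE)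
    have "act C g (act C h x) = form_divisor m (ap g (ap h p)) - form_divisor m (ap g (ap h q))"
      using pq by (simp add: C_simps act_divisor_form act_form)
    \<comment> \<open>The scalars coming from the wrap-around do not change the divisor of a
      form.\<close>
    also have "\<dots> = form_divisor m (ap (g \<otimes> h) p) - form_divisor m (ap (g \<otimes> h) q)"
      using pq b0 by (simp add: act_poly_act_poly[OF g h] form_divisor_Const_mult act_form)
    also have "\<dots> = act C (g \<otimes> h) x" using pq by (simp add: C_simps act_divisor_form)
    finally show "act C (g \<otimes> h) x = act C g (act C h x)" by simp
  qed
qed

lemma degree_act: assumes "E \<in> carrier C" shows "div_degree m (act C g E) = div_degree m E"
proof -
  obtain p q where pq: "form m p" "form m q" "E = form_divisor m p - form_divisor m q" using assms by (rule carrier_CE)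
  then show ?thesis
    by (simp add: C_simps act_divisor_form div_degree_diff div_degree_form_divisor[OF proj.m2] act_form)
qed

lemma act_one_C: assumes "E \<in> carrier C" shows "act C \<one> E = E"
proof -
  obtain p q where pq: "form m p" "form m q" "E = form_divisor m p - form_divisor m q" using assms by (rule carrier_CE)
  moreover have "idx \<one> = 0" using idx_pow[of 0] by simp
  ultimately show ?thesis by (simp add: C_simps act_divisor_form act_poly_eq)
qed

lemma divisor_class_eq:
  assumes "E \<in> carrier C"
  shows "divisor_class m E = {F \<in> carrier C. div_degree m F = div_degree m E}"
proof (intro Set.set_eqI iffI)
  fix F assume "F \<in> divisor_class m E"
  then obtain P where P: "P \<in> principal_divisors m" "F = P + E" by (auto simp: divisor_class_def r_coset_def)
  then show "F \<in> {F \<in> carrier C. div_degree m F = div_degree m E}"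
    using assms C.m_closed[of P E] by (simp add: principal_divisors_eq[OF proj.m2] C_simps div_degree_add)
next
  fix F assume F: "F \<in> {F \<in> carrier C. div_degree m F = div_degree m E}"
  then have "F - E \<in> principal_divisors m"
    using assms keys_diff[of F E] by (auto simp: principal_divisors_eq[OF proj.m2] C_simps div_degree_diff)
  then have "(F - E) + E \<in> divisor_class m E" unfolding divisor_class_def r_coset_def
    by (auto intro!: bexI[of _ "F - E"])
  then show "F \<in> divisor_class m E" by simp
qed

lemma divisor_class_eq_iff:
  assumes "E \<in> carrier C" "F \<in> carrier C"
  shows "divisor_class m E = divisor_class m F \<longleftrightarrow> div_degree m E = div_degree m F"
  using assms by (auto simp: divisor_class_eq)

abbreviation "Fr \<equiv> free_Abelian_group (prime_divisors m :: 'k mpoly set set)"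

lemma carrier_Fr: "carrier Fr = carrier C"
  by (simp add: C_simps free_Abelian_group_def)

lemma normal_principal: "normal (principal_divisors m) Fr"
proof -
  interpret Fr: comm_group Fr by (rule abelian_free_Abelian_group)
  have "subgroup (principal_divisors m) Fr"
  proof (rule Fr.subgroupI)
    have "(0 :: 'k mpoly set \<Rightarrow>\<^sub>0 int) \<in> principal_divisors m" by (simp add: principal_divisors_eq[OF proj.m2])
    then show "(principal_divisors m :: ('k mpoly set \<Rightarrow>\<^sub>0 int) set) \<noteq> {}" by auto
    fix P :: "'k mpoly set \<Rightarrow>\<^sub>0 int" assume P: "P \<in> principal_divisors m"
    then show "inv\<^bsub>Fr\<^esub> P \<in> principal_divisors m"
      using div_degree_diff[of m 0 P] by (simp add: principal_divisors_eq[OF proj.m2])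
    fix Q :: "'k mpoly set \<Rightarrow>\<^sub>0 int" assume Q: "Q \<in> principal_divisors m"
    show "P \<otimes>\<^bsub>Fr\<^esub> Q \<in> principal_divisors m"
      using P Q Poly_Mapping.keys_add[of P Q] by (auto simp: principal_divisors_eq[OF proj.m2] div_degree_add)
  qed (auto simp: principal_divisors_eq[OF proj.m2])
  then show ?thesis by (rule Fr.subgroup_imp_normal)
qed

lemma D_simps: "carrier D = divisor_class m ` carrier C" "x \<otimes>\<^bsub>D\<^esub> y = x <#>\<^bsub>Fr\<^esub> y" "\<one>\<^bsub>D\<^esub> = principal_divisors m"
  "act D g x = act_divisor G \<sigma> m b g ` x"
  by (simp_all add: Pic_def monoid.defs carrier_FactGroup carrier_Fr divisor_class_def[abs_def])

lemma D_mult: "E \<in> carrier C \<Longrightarrow> F \<in> carrier C \<Longrightarrow>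
    divisor_class m E \<otimes>\<^bsub>D\<^esub> divisor_class m F = divisor_class m (E + F)"
  unfolding D_simps divisor_class_def
  using normal.rcos_sum[OF normal_principal, of E F] by (simp add: carrier_Fr)

lemma D_one: "\<one>\<^bsub>D\<^esub> = divisor_class m 0"
  by (simp add: D_simps divisor_class_def r_coset_def)

text \<open>The substitution preserves degrees and a divisor class is the set of all divisors of one
  degree, so \<open>g\<close> maps it into itself; the action of the inverse of \<open>g\<close>
  shows that it maps onto it.\<close>

lemma act_D: assumes "g \<in> carrier G" "E \<in> carrier C" shows "act D g (divisor_class m E) = divisor_class m E"
proof -
  have "act C g ` {F \<in> carrier C. div_degree m F = div_degree m E} = {F \<in> carrier C. div_degree m F = div_degree m E}"
  proof (intro Set.set_eqI iffI)
    fix F assume F: "F \<in> {F \<in> carrier C. div_degree m F = div_degree m E}"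
    then have "F = act C g (act C (inv g) F)" using assms(1) act_one_C by (simp flip: C.act_act)
    moreover have "act C (inv g) F \<in> {F \<in> carrier C. div_degree m F = div_degree m E}"
      using F assms(1) by (simp add: degree_act)
    ultimately show "F \<in> act C g ` {F \<in> carrier C. div_degree m F = div_degree m E}" by blast
  qed (use assms in \<open>auto simp: degree_act\<close>)
  then show ?thesis unfolding D_simps divisor_class_eq[OF assms(2)] by (simp add: C_simps)
qed

sublocale D: trivial_cyclic_module G \<sigma> m D
proof -
  interpret D: comm_group D
  proof (rule comm_groupI)
    fix x y assume "x \<in> carrier D" "y \<in> carrier D"
    then obtain E F where EF: "E \<in> carrier C" "F \<in> carrier C" "x = divisor_class m E" "y = divisor_class m F"
      by (auto simp: D_simps)
    have c: "E + F \<in> carrier C" using C.m_closed[OF EF(1,2)] by (simp add: C_simps)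
    then show "x \<otimes>\<^bsub>D\<^esub> y \<in> carrier D" using EF by (simp add: D_mult) (simp add: D_simps)
    show "x \<otimes>\<^bsub>D\<^esub> y = y \<otimes>\<^bsub>D\<^esub> x" using EF by (simp add: D_mult add.commute)
    fix z assume "z \<in> carrier D"
    then obtain H where H: "H \<in> carrier C" "z = divisor_class m H" by (auto simp: D_simps)
    have "F + H \<in> carrier C" using C.m_closed[OF EF(2) H(1)] by (simp add: C_simps)
    then show "x \<otimes>\<^bsub>D\<^esub> y \<otimes>\<^bsub>D\<^esub> z = x \<otimes>\<^bsub>D\<^esub> (y \<otimes>\<^bsub>D\<^esub> z)" using EF H c by (simp add: D_mult add.assoc)
  next
    have z: "0 \<in> carrier C" by (simp add: C_simps)
    show "\<one>\<^bsub>D\<^esub> \<in> carrier D" unfolding D_one using z by (simp add: D_simps)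
    fix x assume "x \<in> carrier D"
    then obtain E where E: "E \<in> carrier C" "x = divisor_class m E" by (auto simp: D_simps)
    then show "\<one>\<^bsub>D\<^esub> \<otimes>\<^bsub>D\<^esub> x = x" using z unfolding D_one by (simp add: D_mult)
    have "- E \<in> carrier C" using E by (simp add: C_simps)
    then show "\<exists>y\<in>carrier D. y \<otimes>\<^bsub>D\<^esub> x = \<one>\<^bsub>D\<^esub>"
      unfolding D_one using E by (intro bexI[of _ "divisor_class m (- E)"]) (simp_all add: D_mult, simp add: D_simps)
  qed
  have *: "act D g x = x" if "g \<in> carrier G" "x \<in> carrier D" for g x
    using that act_D by (auto simp: D_simps(1))
  show "trivial_cyclic_module G \<sigma> m D"
    by unfold_locales (simp_all add: *)
qed

sublocale i: G_module_hom G A B const_fn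
proof
  show "const_fn \<in> hom A B"
  proof (rule homI)
    fix x assume "x \<in> carrier A"
    then have x: "x \<noteq> 0" by (simp add: A_simps)
    show "const_fn x \<in> carrier B" unfolding B_simps by (intro function_fieldI form_Const[OF x] form_1) simp
  qed (simp add: A_simps B_simps Const_mult)
  show "const_fn (act A g x) = act B g (const_fn x)" for g x
    by (simp add: A_simps B_simps act_fract_Fract) (simp add: act_poly_eq proj.S.S_Const proj.S.S_1)
qed

lemma divisor_of_B:
  "form m p \<Longrightarrow> form m q \<Longrightarrow> total_degree p = total_degree q \<Longrightarrow>
    divisor_of m (Fract p q) = form_divisor m p - form_divisor m q"
  by (rule divisor_of_Fract[OF proj.m2])

sublocale p: G_module_hom G B C "divisor_of m"
proof
  show "divisor_of m \<in> hom B C"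
  proof (rule homI)
    fix x y assume x: "x \<in> carrier B" and y: "y \<in> carrier B"
    obtain p q where pq: "form m p" "form m q" "total_degree p = total_degree q" "x = Fract p q"
      using x unfolding B_simps by (rule function_fieldE)
    obtain r s where rs: "form m r" "form m s" "total_degree r = total_degree s" "y = Fract r s"
      using y unfolding B_simps by (rule function_fieldE)
    have "total_degree (p * r) = total_degree (q * s)" using pq rs by (simp add: total_degree_mult formD)
    then show "divisor_of m (x \<otimes>\<^bsub>B\<^esub> y) = divisor_of m x \<otimes>\<^bsub>C\<^esub> divisor_of m y"
      using pq rs by (simp add: B_simps C_simps divisor_of_B form_mult_iff form_divisor_mult[OF proj.m2])
  next
    fix x assume x: "x \<in> carrier B"
    then have "divisor_of m x \<in> principal_divisors m" by (simp add: principal_divisors_def B_simps)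
    then show "divisor_of m x \<in> carrier C" by (simp add: C_simps principal_divisors_eq[OF proj.m2])
  qed
  fix g x assume x: "x \<in> carrier B"
  obtain p q where pq: "form m p" "form m q" "total_degree p = total_degree q" "x = Fract p q"
    using x unfolding B_simps by (rule function_fieldE)
  then show "divisor_of m (act B g x) = act C g (divisor_of m x)"
    by (simp add: B_simps C_simps act_fract_Fract formD divisor_of_B act_form act_divisor_form)
qed

sublocale q: G_module_hom G C D "divisor_class m"
proof
  show "divisor_class m \<in> hom C D"
    by (rule homI) (simp_all add: D_mult C_simps(2), simp add: D_simps)
  show "divisor_class m (act C g x) = act D g (divisor_class m x)" if "g \<in> carrier G" "x \<in> carrier C" for g x
    using that by (simp add: act_D divisor_class_eq_iff degree_act)
qed

abbreviation "H \<equiv> form_divisor m (Var 0 :: 'k mpoly)"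

lemma H_closed: "H \<in> carrier C"
  using form_divisor_closed[of "Var 0"] m_gt_1 by simp

lemma H_degree: "div_degree m H = 1"
  using div_degree_form_divisor[OF proj.m2, of "Var 0"] m_gt_1 by simp

lemma degree_H_pow: "div_degree m (H [^]\<^bsub>C\<^esub> l) = l" for l :: int
proof -
  interpret d: group_hom C integer_group "div_degree m"
    by unfold_locales (auto intro!: homI simp: C_simps div_degree_add)
  show ?thesis using d.hom_int_pow[OF H_closed, of l] H_degree by simp
qed

lemma class_H_pow: "divisor_class m H [^]\<^bsub>D\<^esub> l = divisor_class m (H [^]\<^bsub>C\<^esub> l)" for l :: int
  using q.hom_int_pow[OF H_closed, of l] by simp

text \<open>Exactness is read off from forms: a function with trivial divisor is a quotient of
  proportional forms, and the principal divisors are those of degree 0. Since \<open>H\<close> has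
  degree 1, the degree shows that its class freely generates \<open>Pic\<close>.\<close>

sublocale seq: cyclic_exact4_free G \<sigma> m A const_fn B "divisor_of m" C "divisor_class m" D "divisor_class m H"
proof
  show "inj_on const_fn (carrier A)" by (rule inj_onI) (simp add: eq_fract)
  show "kernel B C (divisor_of m) = const_fn ` carrier A"
  proof (intro Set.set_eqI iffI)
    fix x assume x: "x \<in> kernel B C (divisor_of m)"
    then have xB: "x \<in> carrier B" "divisor_of m x = 0" by (auto simp: kernel_def C_simps)
    obtain p q where pq: "form m p" "form m q" "total_degree p = total_degree q" "x = Fract p q"
      using xB(1) unfolding B_simps by (rule function_fieldE)
    then obtain c where "c \<noteq> 0" "p = Const c * q"
      using form_divisor_eqD[OF proj.m2 pq(1,2)] xB(2) by (auto simp: divisor_of_B)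
    then have "x = const_fn c" using pq by (simp add: eq_fract formD)
    then show "x \<in> const_fn ` carrier A" using \<open>c \<noteq> 0\<close> by (auto simp: A_simps)
  next
    fix x assume "x \<in> const_fn ` carrier A"
    then obtain c where c: "c \<noteq> 0" "c \<in> carrier A" "x = const_fn c" by (auto simp: A_simps)
    have "divisor_of m x = 0"
      using c form_Const[OF c(1), of m] divisor_of_B[of "Const c" 1]
        form_divisor_Const[OF proj.m2 one_neq_zero] form_divisor_Const[OF proj.m2 c(1)] by simp
    then show "x \<in> kernel B C (divisor_of m)" using c i.hom_closed[OF c(2)] by (simp add: kernel_def C_simps)
  qed
  have P: "divisor_of m ` carrier B = principal_divisors m" by (simp add: principal_divisors_def B_simps)
  show "kernel C D (divisor_class m) = divisor_of m ` carrier B"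
    unfolding P kernel_def D_one using divisor_class_eq_iff[of _ 0]
    by (auto simp: C_simps principal_divisors_eq[OF proj.m2])
  show "divisor_class m ` carrier C = carrier D" by (simp add: D_simps)
  show "act A g x = x" for g x by (simp add: A_simps)
  show "act D g y = y" if "g \<in> carrier G" "y \<in> carrier D" for g y using that by (rule D.act_trivial)
  show "divisor_class m H \<in> carrier D" using H_closed by simp
  show "carrier D = range (\<lambda>l::int. divisor_class m H [^]\<^bsub>D\<^esub> l)"
  proof
    show "carrier D \<subseteq> range (\<lambda>l::int. divisor_class m H [^]\<^bsub>D\<^esub> l)"
    proof
      fix x assume "x \<in> carrier D"
      then obtain E where E: "E \<in> carrier C" "x = divisor_class m E" by (auto simp: D_simps)
      have "x = divisor_class m H [^]\<^bsub>D\<^esub> div_degree m E"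
        unfolding class_H_pow E(2) using E(1) H_closed by (simp add: divisor_class_eq_iff degree_H_pow)
      then show "x \<in> range (\<lambda>l::int. divisor_class m H [^]\<^bsub>D\<^esub> l)" by blast
    qed
  qed (use H_closed in auto)
  fix l :: int assume "divisor_class m H [^]\<^bsub>D\<^esub> l = \<one>\<^bsub>D\<^esub>"
  then have "div_degree m (H [^]\<^bsub>C\<^esub> l) = div_degree m 0"
    unfolding class_H_pow D_one using H_closed C.one_closed by (subst (asm) divisor_class_eq_iff) (auto simp: C_simps(3))
  then show "l = 0" by (simp add: degree_H_pow)
qed

section \<open>The functions \<open>u\<close> and the resulting invariants\<close>

definition u :: "'g \<Rightarrow> 'k mpoly fract" where "u g = Fract (ap g (Var 0)) (Var 0)"

lemma form_Var0: "form m (Var 0 :: 'k mpoly)"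
  using m_gt_1 by simp

lemma u_closed: "u \<in> carrier G \<rightarrow> carrier B"
  unfolding u_def B_simps using form_Var0 by (intro Pi_I function_fieldI) (simp_all add: act_form)

lemma divisor_u: "divisor_of m (u g) = act C g H \<otimes>\<^bsub>C\<^esub> inv\<^bsub>C\<^esub> H"
proof -
  have "inv\<^bsub>C\<^esub> H = - H"
    using H_closed by (intro C.inv_equality) (auto simp: C_simps)
  moreover have "act C g H = form_divisor m (ap g (Var 0))"
    by (simp add: C_simps act_divisor_def act_poly_eq proj.S.S_form_divisor[OF proj.m2 form_Var0])
  ultimately show ?thesis unfolding u_def using form_Var0 by (simp add: divisor_of_B act_form C_simps)
qed

text \<open>Everything cancels except the quotient of \<open>g (h x_0)\<close> by
  \<open>(g h) x_0\<close>, and since \<open>x_0\<close> has degree 1 this is \<open>b\<close>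
  raised to the carry.\<close>

lemma coboundary_u:
  assumes "g \<in> carrier G" "h \<in> carrier G"
  shows "act B g (u h) \<otimes>\<^bsub>B\<^esub> inv\<^bsub>B\<^esub> (u (g \<otimes> h)) \<otimes>\<^bsub>B\<^esub> u g = const_fn b [^]\<^bsub>B\<^esub> carry g h"
proof -
  let ?x = "Var 0 :: 'k mpoly"
  have nz: "?x \<noteq> 0" "ap k ?x \<noteq> 0" for k using formD(2)[OF act_form(1)[OF form_Var0]] by auto
  have "inv\<^bsub>B\<^esub> (u (g \<otimes> h)) = Fract ?x (ap (g \<otimes> h) ?x)"
  proof (rule B.inv_equality)
    show "Fract ?x (ap (g \<otimes> h) ?x) \<otimes>\<^bsub>B\<^esub> u (g \<otimes> h) = \<one>\<^bsub>B\<^esub>"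
      using nz by (simp add: B_simps u_def One_fract_def eq_fract)
    show "u (g \<otimes> h) \<in> carrier B" using u_closed assms by auto
    show "Fract ?x (ap (g \<otimes> h) ?x) \<in> carrier B"
      unfolding B_simps using form_Var0 by (intro function_fieldI) (simp_all add: act_form)
  qed
  moreover have "act B g (u h) = Fract (ap g (ap h ?x)) (ap g ?x)"
    unfolding u_def B_simps using act_form(1)[OF form_Var0] form_Var0 nz by (intro act_fract_Fract) (auto simp: formD)
  moreover have "ap g (ap h ?x) = Const (b ^ nat (carry g h)) * ap (g \<otimes> h) ?x"
    using act_poly_act_poly[OF assms form_Var0] by simp
  ultimately have "act B g (u h) \<otimes>\<^bsub>B\<^esub> inv\<^bsub>B\<^esub> (u (g \<otimes> h)) \<otimes>\<^bsub>B\<^esub> u g = const_fn (b ^ nat (carry g h))"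
    using nz by (simp add: B_simps u_def eq_fract mult_ac)
  also have "\<dots> = const_fn b [^]\<^bsub>B\<^esub> carry g h"
    \<comment> \<open>The carry is 0 or 1, so the natural power and the integer power in
      \<open>B\<close> agree case by case.\<close>
    by (rule carry_cases[OF assms]) (use i.hom_closed[of b] b0 in \<open>auto simp: A_simps B_simps One_fract_def\<close>)
  finally show ?thesis .
qed

lemma b_closed: "b \<in> carrier A"
  using b0 by (simp add: A_simps)

lemma nat_pow_A: "x [^]\<^bsub>A\<^esub> (n::nat) = x ^ n"
  by (induction n) (simp_all add: A_simps mult.commute)

lemma beta_trivial_iff: "beta_proj G \<sigma> m b = \<one>\<^bsub>cohomology G (T_NS G \<sigma> m b) 2\<^esub> \<longleftrightarrow> b \<in> unit_powers m"
  unfolding beta_proj_def T_NS_def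
  using seq.torsor_obstruction_trivial_iff[OF H_closed refl u_closed b_closed divisor_u coboundary_u]
  by (auto simp: unit_powers_def A_simps nat_pow_A)

lemma Am_proj_odd:
  assumes "n \<ge> 2" "odd n" shows "carrier (Am_proj G \<sigma> m b n) = {\<one>\<^bsub>cohomology G A n\<^esub>}"
  unfolding Am_proj_def using seq.Am_odd[OF _ assms(2,1)] seq.torsion_free m_gt_1 by simp

abbreviation "U \<equiv> units_group :: 'k monoid"

text \<open>Both groups are images of the integers: \<open>l\<close> goes to the carry class of the
  \<open>l\<close>-th power of \<open>b\<close> on one side and to the \<open>l\<close>-th power of
  the coset of \<open>b\<close> on the other.\<close>

lemma Am_proj_even:
  assumes "n \<ge> 2" "even n"
  shows "Am_proj G \<sigma> m b n \<cong> subgroup_generated (U Mod unit_powers m) {unit_powers m #>\<^bsub>U\<^esub> b}"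
proof -
  have Us: "carrier U = - {0}" "x \<otimes>\<^bsub>U\<^esub> y = x * y" "\<one>\<^bsub>U\<^esub> = 1" for x y by (simp_all add: units_group_def)
  interpret U: comm_group U
  proof (rule comm_groupI; unfold Us)
    fix x :: 'k assume "x \<in> - {0}"
    then show "\<exists>y\<in>- {0}. y * x = 1" by (intro bexI[of _ "inverse x"]) auto
  qed auto
  have "subgroup (unit_powers m) U"
  proof (rule U.subgroupI)
    show "unit_powers m \<subseteq> carrier U" by (auto simp: unit_powers_def Us)
    have "(1 :: 'k) ^ m \<in> unit_powers m" unfolding unit_powers_def by (rule imageI) simp
    then show "(unit_powers m :: 'k set) \<noteq> {}" by blast
    fix x :: 'k assume "x \<in> unit_powers m"
    then obtain w where w: "w \<noteq> 0" "x = w ^ m" by (auto simp: unit_powers_def)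
    have "inv\<^bsub>U\<^esub> x = inverse w ^ m" using w by (intro U.inv_equality) (auto simp: Us power_inverse)
    then show "inv\<^bsub>U\<^esub> x \<in> unit_powers m" using w by (auto simp: unit_powers_def intro!: image_eqI[of _ _ "inverse w"])
    fix y :: 'k assume "y \<in> unit_powers m"
    then obtain v where v: "v \<noteq> 0" "y = v ^ m" by (auto simp: unit_powers_def)
    show "x \<otimes>\<^bsub>U\<^esub> y \<in> unit_powers m" using w v unfolding Us
      by (auto simp: unit_powers_def power_mult_distrib intro!: image_eqI[of _ _ "w * v"])
  qed
  then interpret N: normal "unit_powers m" U by (rule U.subgroup_imp_normal)
  interpret Q: group "U Mod unit_powers m" by (rule N.factorgroup_is_group)
  interpret qu: group_hom U "U Mod unit_powers m" "\<lambda>x. unit_powers m #>\<^bsub>U\<^esub> x"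
    using N.r_coset_hom_Mod by unfold_locales
  let ?c = "unit_powers m #>\<^bsub>U\<^esub> b"
  have bU: "b \<in> carrier U" using b0 by (simp add: Us)
  let ?\<alpha> = "\<lambda>l::int. cohomology_class G A n (A.carry_cochain (b [^]\<^bsub>A\<^esub> l) n)"
  let ?\<beta> = "\<lambda>l::int. ?c [^]\<^bsub>U Mod unit_powers m\<^esub> l"
  interpret coh: group "cohomology G A n" by (rule A.group_cohomology)
  interpret ch: group_hom A "cohomology G A n" "\<lambda>x. cohomology_class G A n (A.carry_cochain x n)"
    using A.carry_cochain_hom[OF assms(2)] by unfold_locales
  have \<alpha>: "group_hom integer_group (cohomology G A n) ?\<alpha>"
    by unfold_locales (use b_closed in \<open>simp_all add: hom_def A.int_pow_mult\<close>)
  have \<beta>: "group_hom integer_group (U Mod unit_powers m) ?\<beta>"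
    using Q.hom_integer_group_pow[of ?c] qu.hom_closed[OF bU] by unfold_locales auto
  interpret AU: group_hom A U "\<lambda>x. x"
    by unfold_locales (auto intro!: homI simp: A_simps Us)
  \<comment> \<open>In both cases the kernel consists of those \<open>l\<close> for which the
    \<open>l\<close>-th power of \<open>b\<close> is an \<open>m\<close>-th power.\<close>
  have ker: "?\<alpha> l = \<one>\<^bsub>cohomology G A n\<^esub> \<longleftrightarrow> ?\<beta> l = \<one>\<^bsub>U Mod unit_powers m\<^esub>" for l
  proof -
    have "?\<alpha> l = \<one>\<^bsub>cohomology G A n\<^esub> \<longleftrightarrow> (\<exists>w\<in>carrier A. b [^]\<^bsub>A\<^esub> l = w [^]\<^bsub>A\<^esub> m)"
      using A.carry_cochain_trivial_iff[OF assms(2), of "b [^]\<^bsub>A\<^esub> l"] assms(1) b_closed by simp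
    also have "\<dots> \<longleftrightarrow> b [^]\<^bsub>A\<^esub> l \<in> unit_powers m"
      by (auto simp: unit_powers_def A_simps nat_pow_A)
    also have "\<dots> \<longleftrightarrow> unit_powers m #>\<^bsub>U\<^esub> (b [^]\<^bsub>U\<^esub> l) = unit_powers m"
      unfolding AU.hom_int_pow[OF b_closed]
      using U.coset_join1 U.coset_join2 N.subgroup_axioms bU N.subset by (metis U.int_pow_closed)
    also have "unit_powers m #>\<^bsub>U\<^esub> (b [^]\<^bsub>U\<^esub> l) = ?\<beta> l" using qu.hom_int_pow[OF bU] by simp
    finally show ?thesis by simp
  qed
  have "Am_proj G \<sigma> m b n = (cohomology G A n)\<lparr>carrier := range ?\<alpha>\<rparr>"
    using seq.Am_even_carrier[OF assms(2,1) H_closed u_closed b_closed divisor_u coboundary_u seq.gen]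
    by (simp add: Am_proj_def Am_group_def)
  moreover have "subgroup_generated (U Mod unit_powers m) {?c} = (U Mod unit_powers m)\<lparr>carrier := range ?\<beta>\<rparr>"
    using Q.carrier_subgroup_generated_by_singleton[OF qu.hom_closed[OF bU]]
    by (simp add: subgroup_generated_def)
  ultimately show ?thesis
    using iso_of_images[OF \<alpha> \<beta>] ker by simp
qed

end

theorem proposition6p2:
  fixes G :: "('g, 'x) monoid_scheme" and \<sigma> :: 'g and m :: nat and b :: "'k::field"
  assumes "m \<ge> 2" and "b \<noteq> 0"
    and "group G" and "order G = m" and "\<sigma> \<in> carrier G" and "generate G {\<sigma>} = carrier G"
  shows "(beta_proj G \<sigma> m b = \<one>\<^bsub>cohomology G (T_NS G \<sigma> m b) 2\<^esub> \<longleftrightarrow> b \<in> unit_powers m) \<and>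
    (\<forall>n\<ge>2.
      (odd n \<longrightarrow> carrier (Am_proj G \<sigma> m b n) = {\<one>\<^bsub>cohomology G (const_units :: ('k, 'g) gmodule) n\<^esub>}) \<and>
      (even n \<longrightarrow> Am_proj G \<sigma> m b n \<cong>
         subgroup_generated (units_group Mod unit_powers m) {unit_powers m #>\<^bsub>units_group\<^esub> b}))"
proof -
  interpret group G by fact
  interpret proj_cyclic G \<sigma> m b
    using assms by unfold_locales auto
  show ?thesis using beta_trivial_iff Am_proj_odd Am_proj_even by blast
qed

end
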